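(* Let $Y=(Y_t)_{t\in T}$ be a nonnegative process with $\theta(t)=\mathbb{E}Y_t<\infty$ for every $t\in T$. Suppose that for every $s\in T$ having $\theta(s)>0$ there exists a stochastic process $Z^s=(Z^s_t)_{t\in T}$ independent of $Y$ such that for any measurable functional $F:\mathbb{R}^T\to\mathbb{R}$ $$\mathbb{E}\big[F\big((Y_t+Z^s_t)_{t\in T}\big)\big]=\mathbb{E}\big[F\big((Y_t)_{t\in T}\big)\,\theta(s)^{-1}Y_s\big].\qquad( * )$$ Then the process $Y$ is infinitely divisible. If, in addition, $Y$ is separable in probability with a separant $T_0=(s_k)_{k\ge1}$, then the Lévy measure $\nu$ of $Y$ is of the form $$\nu=\sum_{k\ge1}\mathbf{1}_{A_k}\nu_k,$$ where the sets $A_k=\{y\in\mathbb{R}_+^T:\ y(s_i)=0\ \forall\,i<k,\ y(s_k)>0\}$ are disjoint and $\nu_k$ are Lévy measures given by $$\nu_k(dy)=\theta(s_k)\,y(s_k)^{-1}\,\mathbf{1}_{\{y(s_k)>0\}}\,\mathcal{L}(Z^{s_k})(dy),\qquad k=1,2,\dots$$ (with $\nu_k=0$ when $\theta(s_k)=0$). The drift of $Y$ is given by $c=(\theta(t)\,\mathbb{P}(Z^t_t=0):\ t\in T)$ (with value $0$ at $t$ when $\theta(t)=0$). Moreover, any nonnegative finite mean infinitely divisible process $Y=(Y_t)_{t\in T}$ satisfies $( * )$, for every $s$ with $\theta(s)=\mathbb{E}Y_s>0$, with a process $Z^s=(Z^s_t)_{t\in T}$ independent of $Y$ whose law is determined by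 $$\mathcal{L}(Z^s)(dy)=\frac{c(s)}{\theta(s)}\,\delta_{0_T}(dy)+\frac{y(s)}{\theta(s)}\,\nu(dy),$$ where $c$ and $\nu$ are the drift and Lévy measure of $Y$, respectively.
   Context: $T$ is an arbitrary nonempty set, $\mathbb{R}^T$ the space of all functions $x:T\to\mathbb{R}$ with its cylindrical (product) $\sigma$-algebra $\mathcal{B}^T$; $0_T$ is the zero function. $\mathcal{L}(Z)$ is the law of $Z$. Identities between expectations read: if one side exists then the other does and they are equal. Since $( * )$ forces $Z^s_t\ge0$ a.s. for each $t$, the laws $\mathcal{L}(Z^s)$ and the Lévy measures here are regarded as measures on $\mathbb{R}_+^T$ with its cylindrical $\sigma$-algebra. A measure $\nu$ on $(\mathbb{R}^T,\mathcal{B}^T)$ is a Lévy measure if (L1) $\int|x(t)|^2\wedge1\,\nu(dx)<\infty$ for every $t\in T$, and (L2) $\nu(A)=\nu_*(A\setminus\{0_T\})$ for every $A\in\mathcal{B}^T$, where $\nu_*(E)=\sup\{\nu(D):D\subset E,\ D\in\mathcal{B}^T\}$ (and analogously on $\mathbb{R}_+^T$). A process is infinitely divisible if all its finite-dimensional distributions are. A nonnegative infinitely divisible process $Y$ has a unique Lévy measure $\nu$ and drift $c:T\to\mathbb{R}_+$, characterized by $$\mathbb{E}\exp\Big\{-\sum_{i=1}^n\alpha_iY_{t_i}\Big\}=\exp\Big\{-\sum_{i=1}^n\alpha_ic(t_i)-\int_{\mathbb{R}_+^T}\big(1-e^{-\sum_{i=1}^n\alpha_iy(t_i)}\big)\,\nu(dy)\Big\}$$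 for all $t_1,\dots,t_n\in T$, $\alpha_1,\dots,\alpha_n\ge0$, $n\ge1$. $Y$ is separable in probability, with separant $T_0$, if $T_0\subset T$ is nonempty countable and for every $t\in T$ there is a sequence in $T_0$ along which $Y$ converges in probability to $Y_t$. *)

theory Defs
  imports "HOL-Probability.Probability"
begin

text \<open>The index set T is the universe of an arbitrary type (types are nonempty), so that
  paths are total functions on that type.\<close>

definition cyl :: "('t \<Rightarrow> real) measure" where
  "cyl = PiM UNIV (\<lambda>_. borel)"

definition cyl_nonneg :: "('t \<Rightarrow> real) measure" where
  "cyl_nonneg = PiM UNIV (\<lambda>_. restrict_space borel {0..})"

definition process :: "'w measure \<Rightarrow> ('t \<Rightarrow> 'w \<Rightarrow> real) \<Rightarrow> bool" where
  "process M X \<longleftrightarrow> (\<forall>t. X t \<in> borel_measurable M)"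

text \<open>The law of a process, regarded as a measure on the nonnegative paths.  It is meant for
  processes with \<open>X t \<ge> 0\<close> almost surely for every t; the set of nonnegative paths need not be
  measurable in \<open>cyl\<close>, so the law is taken of the modification \<open>max 0 (X t)\<close>.  Lemma
  \<open>distr_law_nonneg\<close> below shows that nothing is lost by this.\<close>

definition law_nonneg :: "'w measure \<Rightarrow> ('t \<Rightarrow> 'w \<Rightarrow> real) \<Rightarrow> ('t \<Rightarrow> real) measure" where
  "law_nonneg M X = distr M cyl_nonneg (\<lambda>\<omega> t. max 0 (X t \<omega>))"

definition inner_measure :: "'a measure \<Rightarrow> 'a set \<Rightarrow> ennreal" where
  "inner_measure \<nu> E = (SUP D\<in>{D \<in> sets \<nu>. D \<subseteq> E}. emeasure \<nu> D)"

definition levy_measure :: "('t \<Rightarrow> real) measure \<Rightarrow> bool" where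
  "levy_measure \<nu> \<longleftrightarrow>
     sets \<nu> = sets cyl_nonneg \<and>
     (\<forall>t. (\<integral>\<^sup>+ x. ennreal (min (\<bar>x t\<bar>\<^sup>2) 1) \<partial>\<nu>) < \<infinity>) \<and>
     (\<forall>A\<in>sets \<nu>. emeasure \<nu> A = inner_measure \<nu> (A - {\<lambda>_. 0}))"

text \<open>\<open>\<nu>\<close> and \<open>c\<close> are the Levy measure and the drift of the nonnegative process \<open>Y\<close>.  The left-hand
  side of the formula is positive, so the integral on the right is finite; integrability is
  demanded because a Bochner integral that does not exist would be 0.\<close>

definition levy_characteristics ::
    "'w measure \<Rightarrow> ('t \<Rightarrow> 'w \<Rightarrow> real) \<Rightarrow> ('t \<Rightarrow> real) measure \<Rightarrow> ('t \<Rightarrow> real) \<Rightarrow> bool" where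
  "levy_characteristics M Y \<nu> c \<longleftrightarrow>
     levy_measure \<nu> \<and> (\<forall>t. 0 \<le> c t) \<and>
     (\<forall>(n::nat) (t :: nat \<Rightarrow> 't) (\<alpha> :: nat \<Rightarrow> real). 1 \<le> n \<longrightarrow> (\<forall>i<n. 0 \<le> \<alpha> i) \<longrightarrow>
        integrable \<nu> (\<lambda>y. 1 - exp (- (\<Sum>i<n. \<alpha> i * y (t i)))) \<and>
        (\<integral>\<omega>. exp (- (\<Sum>i<n. \<alpha> i * Y (t i) \<omega>)) \<partial>M) =
          exp (- (\<Sum>i<n. \<alpha> i * c (t i))
               - (\<integral>y. 1 - exp (- (\<Sum>i<n. \<alpha> i * y (t i))) \<partial>\<nu>)))"

definition fin_dim_law ::
    "'w measure \<Rightarrow> ('t \<Rightarrow> 'w \<Rightarrow> real) \<Rightarrow> 't set \<Rightarrow> ('t \<Rightarrow> real) measure" where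
  "fin_dim_law M X J = distr M (PiM J (\<lambda>_. borel)) (\<lambda>\<omega>. \<lambda>t\<in>J. X t \<omega>)"

text \<open>For every n, the measure \<open>\<mu>\<close> on the paths over J is the law of a sum of n independent
  vectors with a common law \<open>\<rho>\<close>.\<close>

definition inf_divisible_law :: "'t set \<Rightarrow> ('t \<Rightarrow> real) measure \<Rightarrow> bool" where
  "inf_divisible_law J \<mu> \<longleftrightarrow>
     (\<forall>n::nat. 1 \<le> n \<longrightarrow>
        (\<exists>\<rho>. prob_space \<rho> \<and> sets \<rho> = sets (PiM J (\<lambda>_. borel :: real measure)) \<and>
             \<mu> = distr (PiM {..<n} (\<lambda>_. \<rho>)) (PiM J (\<lambda>_. borel))
                    (\<lambda>x. \<lambda>t\<in>J. \<Sum>i<n. x i t)))"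

definition inf_divisible_process :: "'w measure \<Rightarrow> ('t \<Rightarrow> 'w \<Rightarrow> real) \<Rightarrow> bool" where
  "inf_divisible_process M X \<longleftrightarrow>
     (\<forall>J. finite J \<longrightarrow> inf_divisible_law J (fin_dim_law M X J))"

definition converges_in_prob :: "'w measure \<Rightarrow> (nat \<Rightarrow> 'w \<Rightarrow> real) \<Rightarrow> ('w \<Rightarrow> real) \<Rightarrow> bool" where
  "converges_in_prob M X L \<longleftrightarrow>
     (\<forall>\<epsilon>>0. (\<lambda>n. measure M {\<omega> \<in> space M. \<epsilon> < \<bar>X n \<omega> - L \<omega>\<bar>}) \<longlonglongrightarrow> 0)"

definition separant :: "'w measure \<Rightarrow> ('t \<Rightarrow> 'w \<Rightarrow> real) \<Rightarrow> 't set \<Rightarrow> bool" where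
  "separant M Y T0 \<longleftrightarrow>
     T0 \<noteq> {} \<and> countable T0 \<and>
     (\<forall>t. \<exists>r. range r \<subseteq> T0 \<and> converges_in_prob M (\<lambda>n. Y (r n)) (Y t))"

text \<open>\<open>Z\<close> is independent of \<open>Y\<close> and satisfies the size-bias identity at \<open>s\<close>.  Since \<open>M\<close> need not be
  rich enough to carry a process independent of \<open>Y\<close>, \<open>Z\<close> lives on an extension \<open>N\<close> of \<open>M\<close>, to which
  \<open>Y\<close> is lifted along the measure-preserving map \<open>\<pi>\<close>; the choice \<open>N = M\<close>, \<open>\<pi> = id\<close> gives processes
  on the same space.\<close>

definition extension_of :: "'v measure \<Rightarrow> ('v \<Rightarrow> 'w) \<Rightarrow> 'w measure \<Rightarrow> bool" where
  "extension_of N \<pi> M \<longleftrightarrow> prob_space N \<and> \<pi> \<in> measurable N M \<and> distr N M \<pi> = M"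

definition size_bias ::
    "'w measure \<Rightarrow> ('t \<Rightarrow> 'w \<Rightarrow> real) \<Rightarrow> 't \<Rightarrow> 'v measure \<Rightarrow> ('v \<Rightarrow> 'w) \<Rightarrow> ('t \<Rightarrow> 'v \<Rightarrow> real) \<Rightarrow> bool"
  where
  "size_bias M Y s N \<pi> Z \<longleftrightarrow>
     extension_of N \<pi> M \<and> process N Z \<and>
     prob_space.indep_var N cyl (\<lambda>\<omega> t. Y t (\<pi> \<omega>)) cyl (\<lambda>\<omega> t. Z t \<omega>) \<and>
     (\<forall>F \<in> borel_measurable cyl.
        (integrable N (\<lambda>\<omega>. F (\<lambda>t. Y t (\<pi> \<omega>) + Z t \<omega>)) \<longleftrightarrow>
         integrable M (\<lambda>\<omega>. F (\<lambda>t. Y t \<omega>) * (inverse (\<integral>\<omega>. Y s \<omega> \<partial>M) * Y s \<omega>))) \<and>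
        (\<integral>\<omega>. F (\<lambda>t. Y t (\<pi> \<omega>) + Z t \<omega>) \<partial>N) =
        (\<integral>\<omega>. F (\<lambda>t. Y t \<omega>) * (inverse (\<integral>\<omega>. Y s \<omega> \<partial>M) * Y s \<omega>) \<partial>M))"

definition first_positive :: "(nat \<Rightarrow> 't) \<Rightarrow> nat \<Rightarrow> ('t \<Rightarrow> real) set" where
  "first_positive s k = {y \<in> space cyl_nonneg. (\<forall>i<k. y (s i) = 0) \<and> 0 < y (s k)}"

lemma distr_law_nonneg:
  fixes X :: "'t \<Rightarrow> 'w \<Rightarrow> real"
  assumes "prob_space M" "process M X" "\<And>t. AE \<omega> in M. 0 \<le> X t \<omega>"
  shows "distr (law_nonneg M X) cyl (\<lambda>y. y) = distr M cyl (\<lambda>\<omega> t. X t \<omega>)"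
proof -
  interpret prob_space M by fact
  have [measurable]: "X t \<in> borel_measurable M" for t
    using assms(2) by (auto simp: process_def)
  have m1: "(\<lambda>\<omega> t. max 0 (X t \<omega>)) \<in> measurable M cyl_nonneg"
    unfolding cyl_nonneg_def by (rule measurable_PiM_single') (auto simp: measurable_restrict_space2_iff)
  have m2: "(\<lambda>y :: 't \<Rightarrow> real. y) \<in> measurable cyl_nonneg cyl"
    unfolding cyl_nonneg_def cyl_def
  proof (rule measurable_PiM_single')
    fix t :: 't
    have "(\<lambda>y. y t) \<in> measurable (PiM UNIV (\<lambda>_. restrict_space borel {0..})) (restrict_space (borel :: real measure) {0..})"
      by (rule measurable_component_singleton) simp
    then show "(\<lambda>y. y t) \<in> measurable (PiM UNIV (\<lambda>_. restrict_space borel {0..})) (borel :: real measure)"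
      by (simp add: measurable_restrict_space2_iff)
  qed auto
  have m3: "(\<lambda>\<omega> t. X t \<omega>) \<in> measurable M cyl"
    unfolding cyl_def by (rule measurable_PiM_single') auto
  have m4: "(\<lambda>\<omega> t. max 0 (X t \<omega>)) \<in> measurable M cyl"
    unfolding cyl_def by (rule measurable_PiM_single') auto
  have eq: "distr (law_nonneg M X) cyl (\<lambda>y. y) = distr M cyl (\<lambda>\<omega> t. max 0 (X t \<omega>))"
    unfolding law_nonneg_def using m1 m2 by (subst distr_distr) (auto simp: comp_def)
  show ?thesis
    unfolding eq
  proof (rule measure_eqI_PiM_infinite[where M = "\<lambda>_. borel" and I = UNIV])
    fix A and J :: "'t set"
    assume J: "finite J" "J \<subseteq> UNIV" and A: "\<And>i. i \<in> J \<Longrightarrow> A i \<in> sets (borel :: real measure)"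
    let ?E = "prod_emb UNIV (\<lambda>_. borel :: real measure) J (Pi\<^sub>E J A)"
    have E: "?E \<in> sets cyl"
      unfolding cyl_def using J A by (intro sets_PiM_I) auto
    have "AE \<omega> in M. \<forall>t\<in>J. 0 \<le> X t \<omega>"
      using assms(3) J by (simp add: AE_finite_all)
    then have "emeasure M ((\<lambda>\<omega> t. max 0 (X t \<omega>)) -` ?E \<inter> space M)
             = emeasure M ((\<lambda>\<omega> t. X t \<omega>) -` ?E \<inter> space M)"
      using measurable_sets[OF m4 E] measurable_sets[OF m3 E]
      by (intro emeasure_eq_AE)
         (auto simp: prod_emb_def PiE_iff max_def Ball_def elim!: eventually_mono)
    then show "emeasure (distr M cyl (\<lambda>\<omega> t. max 0 (X t \<omega>))) ?E
             = emeasure (distr M cyl (\<lambda>\<omega> t. X t \<omega>)) ?E"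
      using E m3 m4 by (simp add: emeasure_distr)
  qed (auto simp: cyl_def intro!: finite_measure.finite_measure_distr finite_measure_distr m4[unfolded cyl_def])
qed

end

theory Submission
  imports Defs
begin

text \<open>
  Everything is read off from Laplace transforms of measures on the nonnegative paths, taken at the
  functionals \<open>g y = (\<Sum>i<n. \<alpha> i * y (t i))\<close> with \<open>\<alpha> i \<ge> 0\<close>.  Finite measures are determined by these
  transforms (\<open>laplace_unique\<close>).  Write \<open>P\<close> for the law of \<open>Y\<close> and \<open>m s\<close> for the measure
  \<open>\<theta> s * \<L>(Z s)\<close>.  The size-bias identity, tested on \<open>exp (- g)\<close>, says that
  \<open>\<integral>y s * exp (- g) dP = (\<integral>exp (- g) dP) * (\<integral>exp (- g) d(m s))\<close>: up to sign, the transform of \<open>m s\<close>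
  is the derivative of the logarithm of the transform of \<open>P\<close> in direction \<open>s\<close>.

  Second logarithmic derivatives are symmetric, so \<open>y t * m s(dy) = y s * m t(dy)\<close>
  (\<open>density_compat\<close>).  Hence the measures \<open>m s(dy) / y s\<close> agree wherever two of them are both defined,
  and they can be glued along \<open>first_positive s k\<close> to one measure \<open>\<nu>\<close> with \<open>y t * \<nu>(dy) = m t(dy)\<close> on
  \<open>{y. 0 < y t}\<close>.  What is left of \<open>m t\<close> is carried by \<open>{y. y t = 0}\<close>, where every other coordinate
  vanishes almost everywhere too; its mass is the drift.  Integrating the logarithmic derivative of
  the transform of \<open>P\<close> along rays gives the Levy formula (\<open>laplace_levyI\<close>).  The gluing only needs a
  sequence of indices whose joint vanishing forces \<open>y t = 0\<close> almost everywhere under \<open>m t\<close>.  A separant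
  is such a sequence, because the identity carries convergence in probability over from \<open>P\<close> to \<open>m t\<close>
  (\<open>AE_m_zero_of_approximation\<close>).

  Without separability the same construction applies to the process set to zero off a finite set \<open>J\<close>
  of indices, for which an enumeration of \<open>J\<close> is such a sequence.  The resulting \<open>\<nu>\<close> is
  \<open>\<sigma>\<close>-finite, so \<open>\<nu> / n\<close> and \<open>c / n\<close> are realized by a sum of independent compound Poisson laws
  (\<open>levy_realization\<close>).  That sum is an n-th convolution root, which gives infinite divisibility.

  Conversely, differentiating the Levy formula shows that \<open>c s * \<delta>\<^sub>0 + y s * \<nu>(dy)\<close> satisfies the
  identity required of \<open>m s\<close> (\<open>size_biased_family_bias_measure\<close>).  Normalized and put on a product space
  with \<open>Y\<close>, it is the law of the required \<open>Z s\<close>.  It also yields uniqueness: \<open>m s\<close> is determined by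
  \<open>P\<close>, hence so are \<open>c s\<close> and \<open>y s * \<nu>(dy)\<close> for all \<open>s\<close>, and inner regularity of a Levy measure
  excludes any mass on the paths that vanish along the separant (\<open>levy_drift_unique\<close>).
\<close>


section \<open>Nonnegative linear functionals of a path\<close>

lemma space_cyl_nonneg: "space cyl_nonneg = {y :: 't \<Rightarrow> real. \<forall>t. 0 \<le> y t}"
  by (auto simp: cyl_nonneg_def space_PiM PiE_iff space_restrict_space)

lemma measurable_cyl_nonneg_component: "(\<lambda>y :: 't \<Rightarrow> real. y t) \<in> borel_measurable cyl_nonneg"
proof -
  have "(\<lambda>y. y t) \<in> measurable (PiM UNIV (\<lambda>_. restrict_space borel {0..})) (restrict_space (borel :: real measure) {0..})"
    by (rule measurable_component_singleton) simp
  then show ?thesis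
    by (simp add: measurable_restrict_space2_iff cyl_nonneg_def)
qed

lemma measurable_cyl_component: "(\<lambda>y :: 't \<Rightarrow> real. y t) \<in> borel_measurable cyl"
  unfolding cyl_def by simp

lemma measurable_component_of_sets:
  assumes "sets \<mu> = sets cyl_nonneg"
  shows "(\<lambda>y :: 't \<Rightarrow> real. y t) \<in> borel_measurable \<mu>"
  by (subst measurable_cong_sets[OF assms refl]) (rule measurable_cyl_nonneg_component)

lemma measurable_into_cyl_nonneg:
  assumes "\<And>t. (\<lambda>\<omega>. f \<omega> t) \<in> borel_measurable M" "\<And>\<omega> t. \<omega> \<in> space M \<Longrightarrow> 0 \<le> f \<omega> t"
  shows "f \<in> measurable M cyl_nonneg"
  unfolding cyl_nonneg_def
  by (rule measurable_PiM_single')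
     (use assms in \<open>auto simp: measurable_restrict_space2_iff space_restrict_space\<close>)

lemma measurable_into_cyl:
  assumes "\<And>t. (\<lambda>\<omega>. f \<omega> t) \<in> borel_measurable M"
  shows "f \<in> measurable M cyl"
  unfolding cyl_def by (rule measurable_PiM_single') (use assms in auto)

text \<open>The functionals \<open>y \<mapsto> \<Sum>i<n. \<alpha> i * y (t i)\<close> with \<open>\<alpha> i \<ge> 0\<close>.  The inductive form lets facts
  about them be proved one coordinate at a time, and absorbs repetitions among the \<open>t i\<close>.\<close>

inductive_set nonneg_combs :: "(('t \<Rightarrow> real) \<Rightarrow> real) set" where
  zero: "(\<lambda>y. 0) \<in> nonneg_combs"
| add: "g \<in> nonneg_combs \<Longrightarrow> 0 \<le> a \<Longrightarrow> (\<lambda>y. g y + a * y t) \<in> nonneg_combs"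

lemma nonneg_combs_sum:
  "(\<forall>i<n::nat. 0 \<le> \<alpha> i) \<Longrightarrow> (\<lambda>y. \<Sum>i<n. \<alpha> i * y (t i)) \<in> nonneg_combs"
  by (induction n) (auto intro: nonneg_combs.intros)

text \<open>The zero functional is represented by one term with coefficient 0, so that \<open>1 \<le> n\<close> can be kept.\<close>

lemma nonneg_combsE:
  assumes "g \<in> nonneg_combs"
  obtains n :: nat and t \<alpha> where "1 \<le> n" "\<forall>i<n. 0 \<le> \<alpha> i" "g = (\<lambda>y. \<Sum>i<n. \<alpha> i * y (t i))"
proof -
  have "\<exists>(n::nat) t \<alpha>. 1 \<le> n \<and> (\<forall>i<n. 0 \<le> \<alpha> i) \<and> g = (\<lambda>y. \<Sum>i<n. \<alpha> i * y (t i))"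
    using assms
  proof induction
    case zero
    show ?case
      by (rule exI[of _ 1], rule exI, rule exI[of _ "\<lambda>_. 0"]) auto
  next
    case (add g a s)
    then obtain n :: nat and t \<alpha> where *: "1 \<le> n" "\<forall>i<n. 0 \<le> \<alpha> i" "g = (\<lambda>y. \<Sum>i<n. \<alpha> i * y (t i))"
      by blast
    show ?case
      by (rule exI[of _ "Suc n"], rule exI[of _ "t(n := s)"], rule exI[of _ "\<alpha>(n := a)"])
         (use * add in auto)
  qed
  then show ?thesis using that by blast
qed

lemma nonneg_combs_component: "(\<lambda>y. y t) \<in> nonneg_combs"
  using nonneg_combs.add[OF nonneg_combs.zero, of 1 t] by simp

lemma nonneg_combs_scale:
  assumes "g \<in> nonneg_combs" "0 \<le> u"
  shows "(\<lambda>y. u * g y) \<in> nonneg_combs"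
  using assms(1)
proof induction
  case (add g a t)
  then show ?case
    using nonneg_combs.add[OF add.IH, of "u * a" t] assms(2) by (simp add: algebra_simps)
qed (simp add: nonneg_combs.zero)

lemma nonneg_combs_nonneg: "g \<in> nonneg_combs \<Longrightarrow> (\<And>t. 0 \<le> y t) \<Longrightarrow> 0 \<le> g y"
  by (induction rule: nonneg_combs.induct) auto

lemma nonneg_combs_nonneg_space: "g \<in> nonneg_combs \<Longrightarrow> y \<in> space cyl_nonneg \<Longrightarrow> 0 \<le> g y"
  by (erule nonneg_combs_nonneg) (simp add: space_cyl_nonneg)

lemma nonneg_combs_zero_path: "g \<in> nonneg_combs \<Longrightarrow> g (\<lambda>_. 0) = 0"
  by (induction rule: nonneg_combs.induct) auto

lemma nonneg_combs_additive:
  "g \<in> nonneg_combs \<Longrightarrow> g (\<lambda>t. x t + y t) = g x + g y"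
  by (induction rule: nonneg_combs.induct) (auto simp: algebra_simps)

lemma nonneg_combs_homogeneous:
  "g \<in> nonneg_combs \<Longrightarrow> g (\<lambda>t. a * x t) = a * g x"
  by (induction rule: nonneg_combs.induct) (auto simp: algebra_simps)

lemma nonneg_combs_path_sum:
  assumes "g \<in> nonneg_combs" "finite I"
  shows "g (\<lambda>t. \<Sum>i\<in>I. x i t) = (\<Sum>i\<in>I. g (x i))"
  using assms(2)
  by (induction) (simp_all add: nonneg_combs_zero_path[OF assms(1)] nonneg_combs_additive[OF assms(1)])

lemma nonneg_combs_measurable:
  assumes "g \<in> nonneg_combs" "\<And>t. (\<lambda>\<omega>. f \<omega> t) \<in> borel_measurable M"
  shows "(\<lambda>\<omega>. g (f \<omega>)) \<in> borel_measurable M"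
  using assms(1) by induction (use assms(2) in auto)

lemma nonneg_combs_measurable_of_sets:
  assumes "g \<in> nonneg_combs" "sets \<mu> = sets cyl_nonneg"
  shows "g \<in> borel_measurable \<mu>"
  using nonneg_combs_measurable[OF assms(1), of "\<lambda>y. y" \<mu>] measurable_component_of_sets[OF assms(2)]
  by simp

text \<open>Only finitely many coordinates occur in \<open>g\<close>, so their exceptional null sets may be united although
  the index set is uncountable.\<close>

lemma nonneg_combs_AE_cong:
  assumes "g \<in> nonneg_combs" "\<And>t. AE \<omega> in M. x \<omega> t = y \<omega> t"
  shows "AE \<omega> in M. g (x \<omega>) = g (y \<omega>)"
  using assms(1)
proof induction
  case (add g a t)
  show ?case using add.IH assms(2)[of t] by eventually_elim auto
qed simp

abbreviation laplace :: "('t \<Rightarrow> real) measure \<Rightarrow> (('t \<Rightarrow> real) \<Rightarrow> real) \<Rightarrow> real" where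
  "laplace \<mu> g \<equiv> (\<integral>y. exp (- g y) \<partial>\<mu>)"

lemma integrable_exp_neg_comb:
  assumes "finite_measure \<mu>" "sets \<mu> = sets cyl_nonneg" "g \<in> nonneg_combs"
  shows "integrable \<mu> (\<lambda>y. exp (- g y))"
proof -
  interpret finite_measure \<mu> by fact
  have [measurable]: "g \<in> borel_measurable \<mu>"
    by (rule nonneg_combs_measurable_of_sets) fact+
  show ?thesis
    by (rule integrable_const_bound[of _ 1])
       (auto intro!: nonneg_combs_nonneg_space[OF assms(3)] simp: sets_eq_imp_space_eq[OF assms(2)])
qed

lemma integrable_mult_exp_neg_comb:
  assumes "sets \<mu> = sets cyl_nonneg" "integrable \<mu> f" "g \<in> nonneg_combs"
  shows "integrable \<mu> (\<lambda>y. f y * exp (- g y))"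
proof (rule Bochner_Integration.integrable_bound[OF assms(2)])
  have [measurable]: "g \<in> borel_measurable \<mu>" "f \<in> borel_measurable \<mu>"
    using nonneg_combs_measurable_of_sets[OF assms(3,1)] assms(2) by auto
  show "(\<lambda>y. f y * exp (- g y)) \<in> borel_measurable \<mu>" by measurable
  show "AE y in \<mu>. norm (f y * exp (- g y)) \<le> norm (f y)"
    using nonneg_combs_nonneg_space[OF assms(3)]
    by (intro AE_I2) (simp add: sets_eq_imp_space_eq[OF assms(1)] abs_mult mult_left_le)
qed

lemma laplace_scale_measure:
  assumes "sets \<mu> = sets cyl_nonneg" "g \<in> nonneg_combs" "0 \<le> a"
  shows "laplace (scale_measure (ennreal a) \<mu>) g = a * laplace \<mu> g"
proof -
  have "scale_measure (ennreal a) \<mu> = density \<mu> (\<lambda>_. ennreal a)"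
    by (intro measure_eqI) (auto simp: emeasure_density_const)
  then show ?thesis
    using nonneg_combs_measurable_of_sets[OF assms(2,1)] assms(3) by (simp add: integral_density)
qed

section \<open>Uniqueness of Laplace transforms\<close>

text \<open>The variable \<open>exp (- x)\<close> is bounded, so the power series of its characteristic function may be
  integrated term by term, and its moments are the Laplace transform at the integers.\<close>

lemma char_exp_neg_sums:
  assumes "finite_measure M" "sets M = sets (borel :: real measure)" "AE x in M. 0 \<le> x"
  shows "(\<lambda>k. (\<i> * of_real t) ^ k / fact k * of_real (\<integral>x. exp (- real k * x) \<partial>M))
          sums (\<integral>x. iexp (t * exp (- x)) \<partial>M)"
proof -
  interpret finite_measure M by fact
  have [measurable_cong]: "sets M = sets borel" by fact
  have int: "integrable M (\<lambda>x. exp (- real k * x))" for k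
    by (rule integrable_const_bound[of _ 1]) (use assms(3) in \<open>auto elim!: eventually_mono\<close>)
  define f :: "nat \<Rightarrow> real \<Rightarrow> complex" where "f k x = (\<i> * of_real t) ^ k / fact k * of_real (exp (- real k * x))" for k x
  have f_int: "integrable M (f k)" for k
    unfolding f_def using int[of k] by (intro integrable_mult_right integrable_of_real) 
  have f_eq: "f k x = (\<i> * of_real (t * exp (- x))) ^ k /\<^sub>R fact k" for k x
    by (simp add: f_def scaleR_conv_of_real power_mult_distrib exp_of_nat_mult[symmetric] exp_minus
        field_simps flip: of_real_power)
  have f_sums: "(\<lambda>k. f k x) sums iexp (t * exp (- x))" for x
    unfolding f_eq by (rule exp_converges)
  have nf: "norm (f k x) \<le> \<bar>t\<bar> ^ k /\<^sub>R fact k" if "0 \<le> x" for k x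
    using that by (simp add: f_def norm_mult norm_power norm_divide divide_simps mult_left_le)
  have sum_t: "summable (\<lambda>k. \<bar>t\<bar> ^ k /\<^sub>R fact k)"
    by (rule summable_exp_generic)
  have "(\<lambda>k. integral\<^sup>L M (f k)) sums (\<integral>x. (\<Sum>k. f k x) \<partial>M)"
  proof (rule sums_integral[OF f_int])
    show "AE x in M. summable (\<lambda>k. norm (f k x))"
      using assms(3)
    proof eventually_elim
      case (elim x)
      show ?case
        by (rule summable_comparison_test'[OF sum_t, of 0]) (use nf[OF elim] in auto)
    qed
    show "summable (\<lambda>k. \<integral>x. norm (f k x) \<partial>M)"
    proof (rule summable_comparison_test'[OF summable_mult2[OF sum_t, of "measure M (space M)"], of 0])
      fix k
      have "(\<integral>x. norm (f k x) \<partial>M) \<le> (\<integral>x. \<bar>t\<bar> ^ k /\<^sub>R fact k \<partial>M)"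
        using f_int[of k] assms(3) nf by (intro integral_mono_AE) (auto elim!: eventually_mono)
      then show "norm (\<integral>x. norm (f k x) \<partial>M) \<le> \<bar>t\<bar> ^ k /\<^sub>R fact k * measure M (space M)"
        by (simp add: mult_ac)
    qed
  qed
  moreover have "integral\<^sup>L M (f k) = (\<i> * of_real t) ^ k / fact k * of_real (\<integral>x. exp (- real k * x) \<partial>M)" for k
    unfolding f_def using int[of k] by simp
  moreover have "(\<Sum>k. f k x) = iexp (t * exp (- x))" for x
    using f_sums sums_unique by metis
  ultimately show ?thesis by simp
qed

lemma laplace_unique_real:
  assumes fin: "finite_measure M" "finite_measure N"
    and sets: "sets M = sets (borel :: real measure)" "sets N = sets (borel :: real measure)"
    and nonneg: "AE x in M. 0 \<le> x" "AE x in N. 0 \<le> x"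
    and eq: "\<And>k::nat. (\<integral>x. exp (- real k * x) \<partial>M) = (\<integral>x. exp (- real k * x) \<partial>N)"
  shows "M = N"
proof -
  interpret M: finite_measure M by fact
  interpret N: finite_measure N by fact
  have [measurable_cong]: "sets M = sets borel" "sets N = sets borel" by fact+
  have sp: "space M = UNIV" "space N = UNIV"
    using sets_eq_imp_space_eq[OF sets(1)] sets_eq_imp_space_eq[OF sets(2)] by auto
  define a where "a = measure M UNIV"
  have a: "measure M UNIV = a" "measure N UNIV = a" "0 \<le> a"
    using eq[of 0] by (auto simp: a_def sp)
  show ?thesis
  proof (cases "a = 0")
    case True
    have "emeasure M A = 0" "emeasure N A = 0" if "A \<in> sets borel" for A
      using a emeasure_mono[of A UNIV M] emeasure_mono[of A UNIV N] True
      by (auto simp: M.emeasure_eq_measure N.emeasure_eq_measure sets)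
    then show ?thesis by (intro measure_eqI) (auto simp: sets)
  next
    case False
    with a have apos: "0 < a" by simp
    define E where "E K = distr (scale_measure (ennreal (1 / a)) K) borel (\<lambda>x::real. exp (- x))" for K :: "real measure"
    have rd: "real_distribution (E K)" if "finite_measure K" "sets K = sets borel" "measure K UNIV = a" for K
    proof -
      interpret K: finite_measure K by fact
      have [measurable_cong]: "sets K = sets borel" by fact
      have "emeasure (scale_measure (ennreal (1 / a)) K) (space K) = 1"
        using that apos sets_eq_imp_space_eq[OF that(2)]
        by (simp add: K.emeasure_eq_measure flip: ennreal_mult)
      then have "prob_space (scale_measure (ennreal (1 / a)) K)"
        by (intro prob_spaceI) (simp add: space_scale_measure)
      then show ?thesis
        unfolding E_def real_distribution_def real_distribution_axioms_def
        by (intro conjI prob_space.prob_space_distr) auto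
    qed
    have char_E: "char (E K) t = (\<integral>x. iexp (t * exp (- x)) \<partial>K) /\<^sub>R a"
      if "finite_measure K" "sets K = sets borel" for K t
    proof -
      have [measurable_cong]: "sets K = sets borel" by fact
      have "scale_measure (ennreal (1 / a)) K = density K (\<lambda>_. ennreal (1 / a))"
        by (intro measure_eqI) (auto simp: emeasure_density_const)
      then show ?thesis
        unfolding E_def char_def using apos
        by (simp add: integral_distr integral_density divide_inverse)
    qed
    have "char (E M) = char (E N)"
    proof
      fix t
      have "(\<integral>x. iexp (t * exp (- x)) \<partial>M) = (\<integral>x. iexp (t * exp (- x)) \<partial>N)"
        using char_exp_neg_sums[OF fin(1) sets(1) nonneg(1), of t]
              char_exp_neg_sums[OF fin(2) sets(2) nonneg(2), of t]
        unfolding eq by (rule sums_unique2)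
      then show "char (E M) t = char (E N) t"
        by (simp add: char_E fin sets)
    qed
    then have EE: "E M = E N"
      using a by (intro Levy_uniqueness rd fin sets) auto
    have recover: "K = scale_measure (ennreal a) (distr (E K) borel (\<lambda>u. - ln u))" if "sets K = sets borel" for K
    proof -
      have [measurable_cong]: "sets K = sets borel" by fact
      have "distr (E K) borel (\<lambda>u. - ln u) = distr (scale_measure (ennreal (1 / a)) K) borel (\<lambda>x. x)"
        unfolding E_def by (subst distr_distr) (auto simp: comp_def)
      also have "\<dots> = scale_measure (ennreal (1 / a)) K"
        by (rule distr_id2) (simp add: that)
      finally show ?thesis
        using apos by (simp flip: ennreal_mult)
    qed
    show ?thesis
      using recover[OF sets(1)] recover[OF sets(2)] EE by simp
  qed
qed

text \<open>Exponentials are traded for indicators one coordinate at a time: with the other coordinates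
  fixed, the weighted image measures on the line have the same Laplace transform.\<close>

theorem laplace_unique:
  fixes \<mu> \<nu> :: "('t \<Rightarrow> real) measure"
  assumes fin: "finite_measure \<mu>" "finite_measure \<nu>"
    and sets: "sets \<mu> = sets cyl_nonneg" "sets \<nu> = sets cyl_nonneg"
    and eq: "\<And>g. g \<in> nonneg_combs \<Longrightarrow> laplace \<mu> g = laplace \<nu> g"
  shows "\<mu> = \<nu>"
proof -
  have sp: "space \<mu> = space cyl_nonneg" "space \<nu> = space cyl_nonneg"
    by (rule sets_eq_imp_space_eq[OF sets(1)], rule sets_eq_imp_space_eq[OF sets(2)])
  have cylinders: "(\<integral>y. (\<Prod>t\<in>J. indicator (A t) (y t)) * exp (- g y) \<partial>\<mu>)
                 = (\<integral>y. (\<Prod>t\<in>J. indicator (A t) (y t)) * exp (- g y) \<partial>\<nu>)"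
    if "finite J" "\<And>t. A t \<in> sets borel" "g \<in> nonneg_combs" for J g and A :: "'t \<Rightarrow> real set"
    using that(1,3)
  proof (induction J arbitrary: g)
    case empty
    then show ?case using eq by simp
  next
    case (insert s J)
    define w where "w y = (\<Prod>t\<in>J. indicator (A t) (y t)) * exp (- g y)" for y
    have w_nonneg: "0 \<le> w y" for y
      unfolding w_def by (intro mult_nonneg_nonneg prod_nonneg) auto
    have w_le_1: "w y \<le> 1" if "y \<in> space cyl_nonneg" for y
      using nonneg_combs_nonneg_space[OF insert.prems that]
      unfolding w_def by (intro mult_le_one prod_le_1) (auto split: split_indicator)
    note w01 = w_nonneg w_le_1
    define D where "D K = distr (density K (\<lambda>y. ennreal (w y))) borel (\<lambda>y. y s)" for K :: "('t \<Rightarrow> real) measure"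
    have meas: "w \<in> borel_measurable K" "(\<lambda>y. y s) \<in> borel_measurable K" if K: "sets K = sets cyl_nonneg" for K
    proof -
      have [measurable]: "(\<lambda>y. y t) \<in> borel_measurable K" for t
        by (rule measurable_component_of_sets[OF K])
      have [measurable]: "g \<in> borel_measurable K"
        using nonneg_combs_measurable_of_sets[OF insert.prems K] .
      have [measurable]: "A t \<in> sets borel" for t by fact
      show "w \<in> borel_measurable K" unfolding w_def by measurable
      show "(\<lambda>y. y s) \<in> borel_measurable K" by measurable
    qed
    have D_fin: "finite_measure (D K)" if "finite_measure K" and K: "sets K = sets cyl_nonneg" for K
    proof -
      interpret K: finite_measure K by fact
      note [measurable] = meas[OF K]
      have "(\<integral>\<^sup>+y. ennreal (w y) \<partial>K) \<le> (\<integral>\<^sup>+y. 1 \<partial>K)"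
        using w01 by (intro nn_integral_mono) (auto simp: sets_eq_imp_space_eq[OF K])
      then have "finite_measure (density K (\<lambda>y. ennreal (w y)))"
        by (intro finite_measureI) (auto simp: emeasure_density top_unique cong: nn_integral_cong_AE)
      then show ?thesis
        unfolding D_def by (intro finite_measure.finite_measure_distr) auto
    qed
    have D_nonneg: "AE x in D K. 0 \<le> x" if K: "sets K = sets cyl_nonneg" for K
    proof -
      note [measurable] = meas[OF K]
      show ?thesis unfolding D_def
        by (subst AE_distr_iff) (auto simp: AE_density sets_eq_imp_space_eq[OF K] space_cyl_nonneg intro!: AE_I2)
    qed
    have D_int: "(\<integral>x. f x \<partial>D K) = (\<integral>y. w y * f (y s) \<partial>K)" if K: "sets K = sets cyl_nonneg"
      and [measurable]: "f \<in> borel_measurable borel" for K and f :: "real \<Rightarrow> real"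
    proof -
      note [measurable] = meas[OF K]
      show ?thesis
        unfolding D_def by (simp add: integral_distr integral_density w01)
    qed
    have "D \<mu> = D \<nu>"
    proof (rule laplace_unique_real)
      fix k :: nat
      have "(\<integral>y. w y * exp (- real k * y s) \<partial>\<mu>) = (\<integral>y. w y * exp (- real k * y s) \<partial>\<nu>)"
        using insert.IH[OF nonneg_combs.add[OF insert.prems, of "real k" s]]
        by (simp add: w_def mult.assoc flip: exp_add)
      then show "(\<integral>x. exp (- real k * x) \<partial>D \<mu>) = (\<integral>x. exp (- real k * x) \<partial>D \<nu>)"
        using D_int[OF sets(1), of "\<lambda>x. exp (- real k * x)"] D_int[OF sets(2), of "\<lambda>x. exp (- real k * x)"]
        by simp
    qed (use D_fin D_nonneg fin sets in \<open>auto simp: D_def\<close>)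
    then have "(\<integral>y. w y * indicator (A s) (y s) \<partial>\<mu>) = (\<integral>y. w y * indicator (A s) (y s) \<partial>\<nu>)"
      using D_int[OF sets(1), of "indicator (A s)"] D_int[OF sets(2), of "indicator (A s)"] that(2)
      by simp
    then show ?case
      using insert.hyps by (simp add: w_def mult_ac)
  qed
  show ?thesis
  proof (rule measure_eqI_PiM_infinite[where I = UNIV and M = "\<lambda>_. restrict_space borel {0..}"])
    fix A and J :: "'t set"
    assume J: "finite J" "J \<subseteq> UNIV" and A: "\<And>i. i \<in> J \<Longrightarrow> A i \<in> sets (restrict_space (borel :: real measure) {0..})"
    let ?E = "prod_emb UNIV (\<lambda>_. restrict_space (borel :: real measure) {0..}) J (Pi\<^sub>E J A)"
    define B where "B t = (if t \<in> J then A t else UNIV)" for t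
    have B: "B t \<in> sets borel" for t
      using A[of t] by (auto simp: B_def sets_restrict_space)
    have ind: "indicat_real ?E y = (\<Prod>t\<in>J. indicator (B t) (y t)) * exp (- (\<lambda>y. 0) y)"
      if "y \<in> space cyl_nonneg" for y :: "'t \<Rightarrow> real"
    proof -
      have "y \<in> ?E \<longleftrightarrow> (\<forall>t\<in>J. y t \<in> A t)"
        using that by (auto simp: prod_emb_def PiE_iff cyl_nonneg_def space_PiM)
      moreover have "(\<Prod>t\<in>J. indicator (B t) (y t) :: real) = (if \<forall>t\<in>J. y t \<in> A t then 1 else 0)"
      proof (cases "\<forall>t\<in>J. y t \<in> A t")
        case False
        then obtain t where "t \<in> J" "y t \<notin> A t" by blast
        then show ?thesis
          using J(1) by (subst prod_zero) (auto simp: B_def intro!: bexI[of _ t])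
      qed (auto simp: B_def intro: prod.neutral)
      ultimately show ?thesis
        by (simp add: indicator_def)
    qed
    have E: "?E \<in> sets cyl_nonneg"
      unfolding cyl_nonneg_def using J A by (intro sets_PiM_I) auto
    have "measure \<mu> ?E = (\<integral>y. indicator ?E y \<partial>\<mu>)"
      using E by (simp add: sets sets.Int_space_eq2)
    also have "\<dots> = (\<integral>y. (\<Prod>t\<in>J. indicator (B t) (y t)) * exp (- (\<lambda>y. 0) y) \<partial>\<mu>)"
      by (rule Bochner_Integration.integral_cong) (use ind sp in auto)
    also have "\<dots> = (\<integral>y. (\<Prod>t\<in>J. indicator (B t) (y t)) * exp (- (\<lambda>y. 0) y) \<partial>\<nu>)"
      using J B by (intro cylinders) (auto intro: nonneg_combs.zero)
    also have "\<dots> = (\<integral>y. indicator ?E y \<partial>\<nu>)"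
      by (rule Bochner_Integration.integral_cong) (use ind sp in auto)
    also have "\<dots> = measure \<nu> ?E"
      using E by (simp add: sets sets.Int_space_eq2)
    finally show "emeasure \<mu> ?E = emeasure \<nu> ?E"
      by (simp add: finite_measure.emeasure_eq_measure fin)
  qed (use fin sets in \<open>auto simp: cyl_nonneg_def\<close>)
qed

section \<open>Countable sums of measures\<close>

text \<open>The argument \<open>M\<close> only supplies the space and the \<open>\<sigma>\<close>-algebra.\<close>

definition measure_series :: "'a measure \<Rightarrow> (nat \<Rightarrow> 'a measure) \<Rightarrow> 'a measure" where
  "measure_series M \<mu> = measure_of (space M) (sets M) (\<lambda>B. \<Sum>k. emeasure (\<mu> k) B)"

lemma sets_measure_series [simp, measurable_cong]: "sets (measure_series M \<mu>) = sets M"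
  by (simp add: measure_series_def)

lemma space_measure_series [simp]: "space (measure_series M \<mu>) = space M"
  by (simp add: measure_series_def)

lemma emeasure_measure_series:
  assumes "\<And>k. sets (\<mu> k) = sets M" "B \<in> sets M"
  shows "emeasure (measure_series M \<mu>) B = (\<Sum>k. emeasure (\<mu> k) B)"
proof (rule emeasure_measure_of[OF measure_series_def])
  show "countably_additive (sets (measure_series M \<mu>)) (\<lambda>B. \<Sum>k. emeasure (\<mu> k) B)"
  proof (rule countably_additiveI)
    fix A :: "nat \<Rightarrow> 'a set"
    assume A: "range A \<subseteq> sets (measure_series M \<mu>)" "disjoint_family A"
    have "(\<Sum>i. \<Sum>k. emeasure (\<mu> k) (A i)) = (\<Sum>k. \<Sum>i. emeasure (\<mu> k) (A i))"
    proof -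
      have "(\<Sum>i. \<Sum>k. emeasure (\<mu> k) (A i)) = (\<Sum>i. \<integral>\<^sup>+k. emeasure (\<mu> k) (A i) \<partial>count_space UNIV)"
        by (simp add: nn_integral_count_space_nat)
      also have "\<dots> = (\<integral>\<^sup>+k. (\<Sum>i. emeasure (\<mu> k) (A i)) \<partial>count_space UNIV)"
        by (rule nn_integral_suminf[symmetric]) auto
      finally show ?thesis
        by (simp add: nn_integral_count_space_nat)
    qed
    also have "\<dots> = (\<Sum>k. emeasure (\<mu> k) (\<Union>i. A i))"
      using A assms(1) by (intro suminf_cong suminf_emeasure) auto
    finally show "(\<Sum>i. \<Sum>k. emeasure (\<mu> k) (A i)) = (\<Sum>k. emeasure (\<mu> k) (\<Union>i. A i))" .
  qed
  show "sets M \<subseteq> Pow (space M)" by (rule sets.space_closed)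
  show "B \<in> sets (measure_series M \<mu>)" using assms(2) by simp
qed (simp add: positive_def)

lemma nn_integral_measure_series:
  assumes "\<And>k. sets (\<mu> k) = sets M" "f \<in> borel_measurable M"
  shows "(\<integral>\<^sup>+x. f x \<partial>measure_series M \<mu>) = (\<Sum>k. \<integral>\<^sup>+x. f x \<partial>\<mu> k)"
proof -
  have [measurable_cong]: "sets (\<mu> k) = sets M" for k by (rule assms(1))
  have sp: "space (\<mu> k) = space M" for k
    by (rule sets_eq_imp_space_eq[OF assms(1)])
  have "f \<in> borel_measurable (measure_series M \<mu>)" using assms(2) by simp
  then show ?thesis
  proof (induction rule: borel_measurable_induct)
    case (cong f g)
    then have "(\<integral>\<^sup>+x. f x \<partial>\<mu> k) = (\<integral>\<^sup>+x. g x \<partial>\<mu> k)" for k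
      by (intro nn_integral_cong) (auto simp: sp)
    moreover have "(\<integral>\<^sup>+x. f x \<partial>measure_series M \<mu>) = (\<integral>\<^sup>+x. g x \<partial>measure_series M \<mu>)"
      using cong by (intro nn_integral_cong) auto
    ultimately show ?case
      using cong by simp
  next
    case (set A)
    then show ?case using assms(1) by (simp add: emeasure_measure_series)
  next
    case (mult u c)
    then show ?case by (simp add: nn_integral_cmult)
  next
    case (add u v)
    then show ?case by (simp add: nn_integral_add suminf_add)
  next
    case (seq U)
    then have [measurable]: "U i \<in> borel_measurable M" for i by simp
    have "(\<integral>\<^sup>+x. (SUP i. U i) x \<partial>measure_series M \<mu>) = (SUP i. \<integral>\<^sup>+x. U i x \<partial>measure_series M \<mu>)"
      unfolding SUP_apply using seq by (intro nn_integral_monotone_convergence_SUP) auto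
    also have "\<dots> = (SUP i. \<Sum>k. \<integral>\<^sup>+x. U i x \<partial>\<mu> k)"
      using seq by simp
    also have "\<dots> = (\<Sum>k. SUP i. \<integral>\<^sup>+x. U i x \<partial>\<mu> k)"
      using seq(3) by (intro ennreal_suminf_SUP_eq[symmetric] incseq_nn_integral)
    also have "\<dots> = (\<Sum>k. \<integral>\<^sup>+x. (SUP i. U i) x \<partial>\<mu> k)"
      unfolding SUP_apply using seq
      by (intro suminf_cong nn_integral_monotone_convergence_SUP[symmetric]) auto
    finally show ?case .
  qed
qed

definition measure_plus :: "'a measure \<Rightarrow> 'a measure \<Rightarrow> 'a measure" where
  "measure_plus \<mu> \<nu> = measure_series \<mu> (\<lambda>k. if k = 0 then \<mu> else if k = 1 then \<nu> else null_measure \<mu>)"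

lemma sets_measure_plus [simp, measurable_cong]: "sets (measure_plus \<mu> \<nu>) = sets \<mu>"
  by (simp add: measure_plus_def)

lemma space_measure_plus [simp]: "space (measure_plus \<mu> \<nu>) = space \<mu>"
  by (simp add: measure_plus_def)

lemma suminf_two: "(\<Sum>k. if k = 0 then a else if k = 1 then b else 0 :: ennreal) = a + b"
  by (subst suminf_finite[of "{0, 1::nat}"]) auto

lemma emeasure_measure_plus:
  assumes "sets \<nu> = sets \<mu>" "B \<in> sets \<mu>"
  shows "emeasure (measure_plus \<mu> \<nu>) B = emeasure \<mu> B + emeasure \<nu> B"
  unfolding measure_plus_def
  by (subst emeasure_measure_series, use assms in simp, use assms in simp, subst suminf_two[symmetric])
     (auto intro!: suminf_cong)

lemma nn_integral_measure_plus:
  assumes "sets \<nu> = sets \<mu>" "f \<in> borel_measurable \<mu>"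
  shows "(\<integral>\<^sup>+x. f x \<partial>measure_plus \<mu> \<nu>) = (\<integral>\<^sup>+x. f x \<partial>\<mu>) + (\<integral>\<^sup>+x. f x \<partial>\<nu>)"
  unfolding measure_plus_def
  by (subst nn_integral_measure_series, use assms in simp, use assms in simp, subst suminf_two[symmetric])
     (auto intro!: suminf_cong)

section \<open>Differentiating an integrated exponential\<close>

lemma exp_neg_lipschitz:
  assumes "0 \<le> x" "0 \<le> (y :: real)"
  shows "\<bar>exp (- x) - exp (- y)\<bar> \<le> \<bar>x - y\<bar>"
proof -
  have *: "exp (- x) - exp (- y) \<le> y - x" if "x \<le> y" "0 \<le> x" for x y :: real
  proof -
    have "exp (- x) - exp (- y) = exp (- x) * (1 - exp (- (y - x)))"
      by (simp add: algebra_simps flip: exp_add)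
    also have "\<dots> \<le> 1 * (y - x)"
    proof (intro mult_mono)
      show "1 - exp (- (y - x)) \<le> y - x"
        using exp_ge_add_one_self[of "- (y - x)"] by linarith
    qed (use that in auto)
    finally show ?thesis by simp
  qed
  show ?thesis
    using *[of x y] *[of y x] assms by (cases "x \<le> y") auto
qed

text \<open>Integrating \<open>1 - exp (- u * X)\<close>, which is bounded by \<open>u * X\<close>, rather than \<open>exp (- u * X)\<close> admits
  infinite measures.  The derivative is one-sided at \<open>u = 0\<close>, where the Laplace variable may lie.\<close>

lemma has_derivative_integral_exp:
  fixes W X :: "'a \<Rightarrow> real"
  assumes [measurable]: "W \<in> borel_measurable M" "X \<in> borel_measurable M"
    and nonneg: "AE x in M. 0 \<le> X x"
    and int: "integrable M (\<lambda>x. W x * X x)"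
    and u: "0 \<le> u"
  shows "((\<lambda>u. \<integral>x. W x * (1 - exp (- (u * X x))) \<partial>M) has_real_derivative
          (\<integral>x. W x * X x * exp (- (u * X x)) \<partial>M)) (at u within {0..})"
proof -
  have bound: "\<bar>W x * (1 - exp (- (v * X x))) - W x * (1 - exp (- (u * X x)))\<bar> \<le> \<bar>W x * X x\<bar> * \<bar>v - u\<bar>"
    if "0 \<le> X x" "0 \<le> u" "0 \<le> v" for x u v
  proof -
    have "\<bar>W x * (1 - exp (- (v * X x))) - W x * (1 - exp (- (u * X x)))\<bar>
        = \<bar>W x\<bar> * \<bar>exp (- (u * X x)) - exp (- (v * X x))\<bar>"
      by (simp add: algebra_simps flip: abs_mult)
    also have "\<dots> \<le> \<bar>W x\<bar> * \<bar>u * X x - v * X x\<bar>"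
      using that by (intro mult_left_mono exp_neg_lipschitz) auto
    also have "\<dots> = \<bar>W x * X x\<bar> * \<bar>v - u\<bar>"
      using that by (simp add: abs_mult mult_ac flip: left_diff_distrib) (simp add: abs_minus_commute)
    finally show ?thesis .
  qed
  have int': "integrable M (\<lambda>x. W x * (1 - exp (- (v * X x))))" if "0 \<le> v" for v
  proof (rule Bochner_Integration.integrable_bound[OF integrable_mult_left[OF int, of v]])
    show "AE x in M. norm (W x * (1 - exp (- (v * X x)))) \<le> norm (W x * X x * v)"
      using nonneg by eventually_elim (use bound[of _ 0 v] that in \<open>simp add: abs_mult\<close>)
  qed measurable
  define D where "D v x = (W x * (1 - exp (- (v * X x))) - W x * (1 - exp (- (u * X x)))) / (v - u)" for v x
  have "((\<lambda>v. \<integral>x. D v x \<partial>M) \<longlongrightarrow> (\<integral>x. W x * X x * exp (- (u * X x)) \<partial>M)) (at u within {0..})"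
    unfolding tendsto_at_iff_sequentially comp_def
  proof (intro allI impI)
    fix v :: "nat \<Rightarrow> real"
    assume v: "\<forall>i. v i \<in> {0..} - {u}" "v \<longlonglongrightarrow> u"
    show "(\<lambda>i. \<integral>x. D (v i) x \<partial>M) \<longlonglongrightarrow> (\<integral>x. W x * X x * exp (- (u * X x)) \<partial>M)"
    proof (rule integral_dominated_convergence[where w = "\<lambda>x. \<bar>W x * X x\<bar>"])
      show "integrable M (\<lambda>x. \<bar>W x * X x\<bar>)" using int by simp
      show "AE x in M. norm (D (v i) x) \<le> \<bar>W x * X x\<bar>" for i
        using nonneg
      proof eventually_elim
        case (elim x)
        show ?case
          using bound[OF elim u, of "v i"] v(1)[rule_format, of i]
          by (simp add: D_def divide_le_eq)
      qed
      have "(\<lambda>i. D (v i) x) \<longlonglongrightarrow> W x * X x * exp (- (u * X x))" for x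
      proof -
        have "((\<lambda>v. W x * (1 - exp (- (v * X x)))) has_real_derivative W x * X x * exp (- (u * X x))) (at u)"
          by (auto intro!: derivative_eq_intros)
        then have "((\<lambda>v. D v x) \<longlongrightarrow> W x * X x * exp (- (u * X x))) (at u)"
          by (simp add: D_def has_field_derivative_iff)
        then show ?thesis
          using v unfolding tendsto_at_iff_sequentially by (auto simp: comp_def)
      qed
      then show "AE x in M. (\<lambda>i. D (v i) x) \<longlonglongrightarrow> W x * X x * exp (- (u * X x))"
        by simp
    qed (auto simp: D_def)
  qed
  moreover have "\<forall>\<^sub>F v in at u within {0..}. (\<integral>x. D v x \<partial>M)
     = ((\<integral>x. W x * (1 - exp (- (v * X x))) \<partial>M) - (\<integral>x. W x * (1 - exp (- (u * X x))) \<partial>M)) / (v - u)"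
    unfolding eventually_at_filter D_def
    by (intro always_eventually allI impI) (use int' u in simp)
  ultimately show ?thesis
    unfolding has_field_derivative_iff by (rule Lim_transform_eventually)
qed

lemma has_derivative_weighted_laplace:
  fixes W X :: "'a \<Rightarrow> real"
  assumes "integrable M W" "X \<in> borel_measurable M" "AE x in M. 0 \<le> X x"
    and "integrable M (\<lambda>x. W x * X x)" "0 \<le> u"
  shows "((\<lambda>u. \<integral>x. W x * exp (- (u * X x)) \<partial>M) has_real_derivative
          - (\<integral>x. W x * X x * exp (- (u * X x)) \<partial>M)) (at u within {0..})"
proof -
  have [measurable]: "W \<in> borel_measurable M" "X \<in> borel_measurable M"
    using assms by auto
  have int: "integrable M (\<lambda>x. W x * exp (- (v * X x)))" if "0 \<le> v" for v
  proof (rule Bochner_Integration.integrable_bound[OF assms(1)])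
    show "AE x in M. norm (W x * exp (- (v * X x))) \<le> norm (W x)"
      using assms(3) by eventually_elim (use that in \<open>simp add: abs_mult mult_left_le\<close>)
  qed measurable
  have "((\<lambda>u. (\<integral>x. W x \<partial>M) - (\<integral>x. W x * (1 - exp (- (u * X x))) \<partial>M)) has_real_derivative
          0 - (\<integral>x. W x * X x * exp (- (u * X x)) \<partial>M)) (at u within {0..})"
    by (intro DERIV_diff DERIV_const has_derivative_integral_exp) (use assms in auto)
  then have "((\<lambda>u. (\<integral>x. W x \<partial>M) - (\<integral>x. W x * (1 - exp (- (u * X x))) \<partial>M)) has_real_derivative
          - (\<integral>x. W x * X x * exp (- (u * X x)) \<partial>M)) (at u within {0..})"
    by simp
  then show ?thesis
  proof (rule has_field_derivative_transform_within)
    fix v :: real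
    assume "v \<in> {0..}"
    then show "(\<integral>x. W x \<partial>M) - (\<integral>x. W x * (1 - exp (- (v * X x))) \<partial>M) = (\<integral>x. W x * exp (- (v * X x)) \<partial>M)"
      using int[of v] assms(1) by (simp add: right_diff_distrib)
  qed (use assms in \<open>auto intro: zero_less_one\<close>)
qed

lemma has_real_derivative_right_unique:
  assumes "(f has_real_derivative a) (at u within {0..})" "(f has_real_derivative b) (at u within {0..})" "0 \<le> u"
  shows "a = b"
proof -
  have "at u within {0..} \<noteq> bot"
  proof -
    have "at_right u \<le> at u within {0..}"
      using assms(3) by (intro at_le) auto
    then show ?thesis
      using trivial_limit_at_right_real[of u] by (metis le_bot trivial_limit_def)
  qed
  then show ?thesis
    using assms(1,2) unfolding has_field_derivative_iff by (rule tendsto_unique)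
qed

section \<open>Size-biased families\<close>

text \<open>The measure \<open>m s\<close> stands for the mean of the coordinate s times the law of the size-biasing
  increment.  Without normalization, a coordinate of mean zero is covered by \<open>m s = 0\<close>.\<close>

locale size_biased_family =
  fixes P :: "('t \<Rightarrow> real) measure" and m :: "'t \<Rightarrow> ('t \<Rightarrow> real) measure"
  assumes prob_P: "prob_space P"
    and sets_P: "sets P = sets cyl_nonneg"
    and integrable_P: "\<And>t. integrable P (\<lambda>y. y t)"
    and finite_m: "\<And>s. finite_measure (m s)"
    and sets_m: "\<And>s. sets (m s) = sets cyl_nonneg"
    and bias: "\<And>s g. g \<in> nonneg_combs \<Longrightarrow>
      (\<integral>y. y s * exp (- g y) \<partial>P) = laplace P g * laplace (m s) g"

lemma mult_exp_neg_le_1: "0 \<le> x \<Longrightarrow> x * exp (- x) \<le> (1::real)"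
proof -
  assume "0 \<le> x"
  have "x * exp (- x) \<le> exp x * exp (- x)"
    using exp_ge_add_one_self[of x] by (intro mult_right_mono) (linarith, simp)
  then show ?thesis by (simp flip: exp_add)
qed

lemma space_eq_cyl_nonneg: "sets \<mu> = sets cyl_nonneg \<Longrightarrow> space \<mu> = space cyl_nonneg"
  by (rule sets_eq_imp_space_eq)

lemma AE_cyl_nonneg: "sets \<mu> = sets cyl_nonneg \<Longrightarrow> AE y in \<mu>. \<forall>t. 0 \<le> y t"
  by (rule AE_I2) (simp add: space_eq_cyl_nonneg space_cyl_nonneg)

context size_biased_family
begin

sublocale P: prob_space P by (rule prob_P)
sublocale m: finite_measure "m s" for s by (rule finite_m)

lemma measurable_component_P [measurable]: "(\<lambda>y. y t) \<in> borel_measurable P"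
  by (rule measurable_component_of_sets[OF sets_P])

lemma measurable_component_m [measurable]: "(\<lambda>y. y t) \<in> borel_measurable (m s)"
  by (rule measurable_component_of_sets[OF sets_m])

lemma measurable_comb_P: "g \<in> nonneg_combs \<Longrightarrow> g \<in> borel_measurable P"
  by (rule nonneg_combs_measurable_of_sets[OF _ sets_P])

lemma measurable_comb_m: "g \<in> nonneg_combs \<Longrightarrow> g \<in> borel_measurable (m s)"
  by (rule nonneg_combs_measurable_of_sets[OF _ sets_m])

lemmas integrable_exp_P = integrable_exp_neg_comb[OF P.finite_measure_axioms sets_P]
lemmas integrable_exp_m = integrable_exp_neg_comb[OF finite_m sets_m]

lemma laplace_P_pos:
  assumes "g \<in> nonneg_combs"
  shows "0 < laplace P g"
proof -
  have "laplace P g \<noteq> 0"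
    using integral_nonneg_eq_0_iff_AE[OF integrable_exp_P[OF assms]] P.AE_False by simp
  moreover have "0 \<le> laplace P g" by (rule integral_nonneg_AE) simp
  ultimately show ?thesis by linarith
qed

lemma mass_m: "measure (m s) (space (m s)) = (\<integral>y. y s \<partial>P)"
  using bias[OF nonneg_combs.zero, of s] P.prob_space by simp

lemma integrable_component_exp:
  fixes \<mu> :: "('t \<Rightarrow> real) measure"
  assumes "h \<in> nonneg_combs" "\<And>y. \<forall>t. 0 \<le> y t \<Longrightarrow> y t \<le> h y" "finite_measure \<mu>" "sets \<mu> = sets cyl_nonneg"
  shows "integrable \<mu> (\<lambda>y. y t * exp (- h y))"
proof -
  interpret finite_measure \<mu> by fact
  have [measurable]: "h \<in> borel_measurable \<mu>" "(\<lambda>y. y t) \<in> borel_measurable \<mu>"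
    using assms by (auto intro: nonneg_combs_measurable_of_sets measurable_component_of_sets)
  have "y t * exp (- h y) \<le> 1" if "\<forall>t. 0 \<le> y t" for y :: "'t \<Rightarrow> real"
  proof -
    have "y t * exp (- h y) \<le> y t * exp (- y t)"
      using that assms(2)[of y] by (intro mult_left_mono) auto
    also have "\<dots> \<le> 1" using that by (intro mult_exp_neg_le_1) auto
    finally show ?thesis .
  qed
  then show ?thesis
    using AE_cyl_nonneg[OF assms(4)] by (intro integrable_const_bound[of _ 1]) (auto elim!: eventually_mono)
qed

text \<open>Differentiating the identity \<open>bias\<close> in direction t: the left-hand side is symmetric in
  s and t, which is what couples the measures \<open>m s\<close> and \<open>m t\<close>.\<close>

lemma mixed_moment:
  assumes h: "h \<in> nonneg_combs" and dom: "\<And>y. \<forall>t. 0 \<le> y t \<Longrightarrow> y s + y t \<le> h y"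
  shows "(\<integral>y. y s * y t * exp (- h y) \<partial>P) = laplace P h *
    (laplace (m t) h * laplace (m s) h + (\<integral>y. y t * exp (- h y) \<partial>m s))"
proof -
  note [measurable] = measurable_comb_P[OF h] measurable_comb_m[OF h]
  have dom1: "y s \<le> h y" "y t \<le> h y" if "\<forall>t. 0 \<le> y t" for y
    using dom[OF that] that[rule_format, of s] that[rule_format, of t] by auto
  have nnP: "AE y in P. 0 \<le> y t" and nnm: "AE y in m s. 0 \<le> y t"
    using AE_cyl_nonneg[OF sets_P] AE_cyl_nonneg[OF sets_m, of s] by (auto elim: eventually_mono)
  define L where "L a = (\<integral>y. exp (- h y) * exp (- (a * y t)) \<partial>P)" for a
  define S where "S a = (\<integral>y. exp (- h y) * exp (- (a * y t)) \<partial>m s)" for a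
  define B where "B a = (\<integral>y. (y s * exp (- h y)) * exp (- (a * y t)) \<partial>P)" for a
  have int_ys: "integrable P (\<lambda>y. y s * exp (- h y))"
    by (rule integrable_component_exp[OF h _ P.finite_measure_axioms sets_P]) (use dom1 in auto)
  have int_yt: "integrable P (\<lambda>y. exp (- h y) * y t)"
    using integrable_component_exp[OF h _ P.finite_measure_axioms sets_P, of t] dom1 by (simp add: mult.commute)
  have int_ytm: "integrable (m s) (\<lambda>y. exp (- h y) * y t)"
    using integrable_component_exp[OF h _ finite_m sets_m, of t] dom1 by (simp add: mult.commute)
  have int_yst: "integrable P (\<lambda>y. y s * exp (- h y) * y t)"
  proof (rule P.integrable_const_bound[of _ 1])
    have "y s * exp (- h y) * y t \<le> 1" if nn: "\<forall>t. 0 \<le> y t" for y :: "'t \<Rightarrow> real"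
    proof -
      have "y s * exp (- h y) * y t \<le> y s * exp (- (y s + y t)) * y t"
        using nn dom[of y] by (intro mult_right_mono mult_left_mono) auto
      also have "\<dots> = (y s * exp (- y s)) * (y t * exp (- y t))"
        by (simp add: exp_add exp_diff exp_minus field_simps)
      also have "\<dots> \<le> 1"
        using nn by (intro mult_le_one mult_exp_neg_le_1) auto
      finally show ?thesis .
    qed
    then show "AE y in P. norm (y s * exp (- h y) * y t) \<le> 1"
      using AE_cyl_nonneg[OF sets_P] by (auto elim!: eventually_mono)
  qed measurable
  have dL: "(L has_real_derivative - (\<integral>y. exp (- h y) * y t \<partial>P)) (at 0 within {0..})"
    using has_derivative_weighted_laplace[OF integrable_exp_P[OF h] _ nnP int_yt, of 0]
    unfolding L_def by simp
  have dS: "(S has_real_derivative - (\<integral>y. exp (- h y) * y t \<partial>m s)) (at 0 within {0..})"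
    using has_derivative_weighted_laplace[OF integrable_exp_m[OF h] _ nnm int_ytm, of 0]
    unfolding S_def by simp
  have dB: "(B has_real_derivative - (\<integral>y. y s * exp (- h y) * y t \<partial>P)) (at 0 within {0..})"
    using has_derivative_weighted_laplace[OF int_ys _ nnP int_yst, of 0]
    unfolding B_def by simp
  have "B a = L a * S a" if "0 \<le> a" for a
    using bias[OF nonneg_combs.add[OF h that, of t], of s]
    by (simp add: B_def L_def S_def mult.assoc exp_diff exp_minus divide_inverse)
  then have "(B has_real_derivative (- (\<integral>y. exp (- h y) * y t \<partial>P)) * S 0 + (- (\<integral>y. exp (- h y) * y t \<partial>m s)) * L 0) (at 0 within {0..})"
    by (intro has_field_derivative_transform_within[OF DERIV_mult[OF dL dS], of 1]) auto
  from has_real_derivative_right_unique[OF dB this]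
  have "(\<integral>y. y s * exp (- h y) * y t \<partial>P) = (\<integral>y. exp (- h y) * y t \<partial>P) * S 0 + (\<integral>y. exp (- h y) * y t \<partial>m s) * L 0"
    by simp
  moreover have "(\<integral>y. exp (- h y) * y t \<partial>P) = L 0 * laplace (m t) h"
    using bias[OF h, of t] by (simp add: L_def mult.commute)
  ultimately show ?thesis
    by (simp add: L_def S_def algebra_simps)
qed

lemma compat_laplace:
  assumes h: "h \<in> nonneg_combs" and dom: "\<And>y. \<forall>t. 0 \<le> y t \<Longrightarrow> y s + y t \<le> h y"
  shows "(\<integral>y. y t * exp (- h y) \<partial>m s) = (\<integral>y. y s * exp (- h y) \<partial>m t)"
proof -
  have dom': "y t + y s \<le> h y" if "\<forall>t. 0 \<le> y t" for y using dom[OF that] by simp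
  show ?thesis
    using mixed_moment[OF h dom] mixed_moment[OF h dom'] laplace_P_pos[OF h]
    by (simp add: mult_ac)
qed

text \<open>The factor \<open>exp (- (y s + y t))\<close> makes the measures finite; being positive it can be
  divided out again.\<close>

lemma density_compat:
  "density (m s) (\<lambda>y. ennreal (y t)) = density (m t) (\<lambda>y. ennreal (y s))"
proof -
  \<comment> \<open>Symmetry of \<open>D\<close> in s and t is the claim, up to the exponential factor.\<close>
  define D where "D s t = density (m s) (\<lambda>y. ennreal (y t * exp (- (y s + y t))))" for s t
  have h: "(\<lambda>y. g y + y s + y t) \<in> nonneg_combs" if "g \<in> nonneg_combs" for g s t
    using nonneg_combs.add[OF nonneg_combs.add[OF that, of 1 s], of 1 t] by simp
  have h0: "(\<lambda>y. y s + y t) \<in> nonneg_combs" for s t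
    using h[OF nonneg_combs.zero] by simp
  have fin: "finite_measure (D s t)" for s t
  proof -
    have int: "integrable (m s) (\<lambda>y. y t * exp (- (y s + y t)))"
      by (rule integrable_component_exp[OF h0 _ finite_m sets_m]) simp
    have "(\<integral>\<^sup>+y. ennreal (y t * exp (- (y s + y t))) \<partial>m s) < \<infinity>"
      by (subst nn_integral_eq_integral[OF int]) (auto simp: space_eq_cyl_nonneg[OF sets_m] space_cyl_nonneg)
    then show ?thesis
      unfolding D_def by (intro finite_measureI) (simp add: emeasure_density cong: nn_integral_cong)
  qed
  have lap: "laplace (D s t) g = (\<integral>y. y t * exp (- (g y + y s + y t)) \<partial>m s)"
    if g: "g \<in> nonneg_combs" for g s t
  proof -
    note [measurable] = measurable_comb_m[OF g]
    show ?thesis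
      unfolding D_def
      by (subst integral_density)
         (auto simp: space_eq_cyl_nonneg[OF sets_m] space_cyl_nonneg mult.assoc algebra_simps
               simp flip: exp_add intro!: AE_I2)
  qed
  have sym: "D s t = D t s"
  proof (rule laplace_unique[OF fin fin])
    fix g :: "('t \<Rightarrow> real) \<Rightarrow> real" assume g: "g \<in> nonneg_combs"
    have "(\<integral>y. y t * exp (- (g y + y s + y t)) \<partial>m s) = (\<integral>y. y s * exp (- (g y + y s + y t)) \<partial>m t)"
      by (rule compat_laplace[OF h[OF g]]) (simp add: nonneg_combs_nonneg[OF g])
    then show "laplace (D s t) g = laplace (D t s) g"
      by (simp add: lap[OF g] add_ac)
  qed (simp_all add: D_def sets_m)
  have undo: "density (D s t) (\<lambda>y. ennreal (exp (y s + y t))) = density (m s) (\<lambda>y. ennreal (y t))" for s t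
    unfolding D_def
    by (subst density_density_eq)
       (auto simp: ennreal_mult''[symmetric] mult.assoc simp flip: exp_add intro!: density_cong)
  show ?thesis
    unfolding undo[of s t, symmetric] undo[of t s, symmetric] sym
    by (simp only: add.commute[of "_ t" "_ s"])
qed

text \<open>The identity \<open>density_compat\<close>, read on the set \<open>{y. y t = 0}\<close>, on which its left-hand side vanishes.\<close>

lemma AE_m_zero:
  "AE y in m t. y t = 0 \<longrightarrow> y s = 0"
proof -
  have "AE y in density (m s) (\<lambda>y. ennreal (y t)). y t \<noteq> 0"
    by (subst AE_density) auto
  then have "AE y in m t. 0 < ennreal (y s) \<longrightarrow> y t \<noteq> 0"
    unfolding density_compat[of s t] by (subst (asm) AE_density) simp_all
  then show ?thesis
    using AE_cyl_nonneg[OF sets_m] by eventually_elim (auto simp: less_le)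
qed

lemma AE_m_zero_comb:
  assumes "h \<in> nonneg_combs"
  shows "AE y in m t. y t = 0 \<longrightarrow> h y = 0"
  using assms
proof induction
  case (add g a s)
  show ?case using add.IH AE_m_zero[of t s] by eventually_elim auto
qed simp

end

text \<open>The transform of \<open>P\<close> is positive and can be divided out of the identity \<open>bias\<close>.\<close>

lemma size_biased_family_unique:
  assumes "size_biased_family P m" "size_biased_family P m'"
  shows "m s = m' s"
proof -
  interpret A: size_biased_family P m by fact
  interpret B: size_biased_family P m' by fact
  show ?thesis
  proof (rule laplace_unique)
    fix g :: "('a \<Rightarrow> real) \<Rightarrow> real" assume g: "g \<in> nonneg_combs"
    show "laplace (m s) g = laplace (m' s) g"
      using A.bias[OF g, of s] B.bias[OF g, of s] A.laplace_P_pos[OF g] by simp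
  qed (simp_all add: A.finite_m B.finite_m A.sets_m B.sets_m)
qed

section \<open>From a size-biased family to Levy measure and drift\<close>

abbreviation levy_exponent :: "('t \<Rightarrow> real) measure \<Rightarrow> (('t \<Rightarrow> real) \<Rightarrow> real) \<Rightarrow> real" where
  "levy_exponent \<nu> g \<equiv> (\<integral>y. 1 - exp (- g y) \<partial>\<nu>)"

text \<open>The formula that characterizes Levy measure and drift.  The drift is itself a path, so a functional
  \<open>g\<close> can be applied to it.\<close>

definition laplace_levy :: "('t \<Rightarrow> real) measure \<Rightarrow> ('t \<Rightarrow> real) measure \<Rightarrow> ('t \<Rightarrow> real) \<Rightarrow> bool" where
  "laplace_levy P \<nu> c \<longleftrightarrow> (\<forall>g\<in>nonneg_combs.
     integrable \<nu> (\<lambda>y. 1 - exp (- g y)) \<and>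
     laplace P g = exp (- g c - levy_exponent \<nu> g))"

lemma first_positive_sets: "first_positive s k \<in> sets cyl_nonneg"
proof -
  have [measurable]: "(\<lambda>y. y t) \<in> borel_measurable cyl_nonneg" for t
    by (rule measurable_cyl_nonneg_component)
  show ?thesis unfolding first_positive_def by measurable
qed

lemma disjoint_first_positive: "disjoint_family (first_positive s)"
  unfolding disjoint_family_on_def
proof (intro ballI impI)
  fix i j :: nat assume "i \<noteq> j"
  then show "first_positive s i \<inter> first_positive s j = {}"
    by (cases "i < j") (force simp: first_positive_def)+
qed

text \<open>A path that does not vanish along s has a least index k at which \<open>y (s k)\<close> is positive.\<close>

lemma UN_first_positive:
  "(\<Union>k. first_positive s k) = {y \<in> space cyl_nonneg. \<exists>k. y (s k) \<noteq> 0}" (is "?L = ?R")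
proof
  show "?R \<subseteq> ?L"
  proof
    fix y assume y: "y \<in> ?R"
    define k where "k = (LEAST k. y (s k) \<noteq> 0)"
    have "y (s k) \<noteq> 0" unfolding k_def by (rule LeastI_ex) (use y in simp)
    moreover have "y (s i) = 0" if "i < k" for i
      using not_less_Least[OF that[unfolded k_def]] by simp
    ultimately have "y \<in> first_positive s k"
      using y by (auto simp: first_positive_def space_cyl_nonneg less_le)
    then show "y \<in> ?L" by blast
  qed
  show "?L \<subseteq> ?R"
  proof
    fix y assume "y \<in> ?L"
    then obtain k where "y \<in> first_positive s k" by blast
    then show "y \<in> ?R" by (auto simp: first_positive_def intro!: exI[of _ k])
  qed
qed

lemma UN_first_positive_sets: "(\<Union>k. first_positive s k) \<in> sets cyl_nonneg"
  using first_positive_sets by blast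

text \<open>A set that misses the zero path witnesses the inner regularity demanded of a Levy measure as
  soon as its complement is a null set.\<close>

lemma levy_measureI:
  assumes sets: "sets \<nu> = sets cyl_nonneg"
    and fin: "\<And>t. (\<integral>\<^sup>+y. ennreal (y t) \<partial>\<nu>) < \<infinity>"
    and C: "C \<in> sets cyl_nonneg" "(\<lambda>_. 0) \<notin> C" "AE y in \<nu>. y \<in> C"
  shows "levy_measure \<nu>"
  unfolding levy_measure_def
proof (intro conjI allI ballI)
  fix t :: 'a
  have "min (\<bar>y t\<bar>\<^sup>2) 1 \<le> y t" if "0 \<le> y t" for y :: "'a \<Rightarrow> real"
    using that by (cases "y t \<le> 1") (auto simp: power2_eq_square mult_left_le intro: min.coboundedI1 min.coboundedI2)
  then have "(\<integral>\<^sup>+y. ennreal (min (\<bar>y t\<bar>\<^sup>2) 1) \<partial>\<nu>) \<le> (\<integral>\<^sup>+y. ennreal (y t) \<partial>\<nu>)"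
    using AE_cyl_nonneg[OF sets] by (intro nn_integral_mono_AE) (auto elim!: eventually_mono intro!: ennreal_leI)
  then show "(\<integral>\<^sup>+y. ennreal (min (\<bar>y t\<bar>\<^sup>2) 1) \<partial>\<nu>) < \<infinity>"
    using fin[of t] by (rule le_less_trans)
next
  fix A assume A: "A \<in> sets \<nu>"
  show "emeasure \<nu> A = inner_measure \<nu> (A - {\<lambda>_. 0})"
    unfolding inner_measure_def
  proof (rule antisym)
    have "emeasure \<nu> A = emeasure \<nu> (A \<inter> C)"
      using C(3) A C(1) sets by (intro emeasure_eq_AE) (auto elim!: eventually_mono)
    also have "\<dots> \<le> (SUP D\<in>{D \<in> sets \<nu>. D \<subseteq> A - {\<lambda>_. 0}}. emeasure \<nu> D)"
      using A C sets by (intro SUP_upper) auto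
    finally show "emeasure \<nu> A \<le> (SUP D\<in>{D \<in> sets \<nu>. D \<subseteq> A - {\<lambda>_. 0}}. emeasure \<nu> D)" .
    show "(SUP D\<in>{D \<in> sets \<nu>. D \<subseteq> A - {\<lambda>_. 0}}. emeasure \<nu> D) \<le> emeasure \<nu> A"
      using A by (intro SUP_least emeasure_mono) auto
  qed
qed (rule sets)

context size_biased_family
begin

definition drift :: "'t \<Rightarrow> real" where
  "drift t = measure (m t) {y \<in> space (m t). y t = 0}"

lemma drift_nonneg: "0 \<le> drift t"
  by (simp add: drift_def)

text \<open>A measure that has density \<open>1 / y t\<close> against \<open>m t\<close> off \<open>{y. y t = 0}\<close>, for every t, is the
  Levy measure: along a ray the logarithmic derivatives of the two sides agree, by \<open>bias\<close>.\<close>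

lemma laplace_levyI:
  assumes sets: "sets \<nu> = sets cyl_nonneg"
    and dens: "\<And>t. density \<nu> (\<lambda>y. ennreal (y t)) = density (m t) (indicator {y. 0 < y t})"
  shows "laplace_levy P \<nu> drift"
proof -
  have [measurable]: "(\<lambda>y. y t) \<in> borel_measurable \<nu>" for t
    by (rule measurable_component_of_sets[OF sets])
  have meas_comb: "g \<in> borel_measurable \<nu>" if "g \<in> nonneg_combs" for g
    by (rule nonneg_combs_measurable_of_sets[OF that sets])
  have weighted: "(\<integral>\<^sup>+y. ennreal (y t) * f y \<partial>\<nu>) = (\<integral>\<^sup>+y. indicator {y. 0 < y t} y * f y \<partial>m t)"
    if f: "f \<in> borel_measurable cyl_nonneg" for f t
  proof -
    have [measurable]: "f \<in> borel_measurable \<nu>" "f \<in> borel_measurable (m t)"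
      using f by (simp_all add: measurable_cong_sets[OF sets refl] measurable_cong_sets[OF sets_m refl])
    have "(\<integral>\<^sup>+y. f y \<partial>density \<nu> (\<lambda>y. ennreal (y t))) = (\<integral>\<^sup>+y. f y \<partial>density (m t) (indicator {y. 0 < y t}))"
      by (simp add: dens)
    then show ?thesis
      by (simp add: nn_integral_density)
  qed
  have int_comp: "integrable \<nu> (\<lambda>y. y t)" for t
  proof (rule integrableI_nonneg)
    have "(\<integral>\<^sup>+y. ennreal (y t) \<partial>\<nu>) \<le> (\<integral>\<^sup>+y. 1 \<partial>m t)"
    proof -
      have "(\<integral>\<^sup>+y. ennreal (y t) \<partial>\<nu>) = (\<integral>\<^sup>+y. indicator {y. 0 < y t} y \<partial>m t)"
        using weighted[of "\<lambda>_. 1" t] by simp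
      also have "\<dots> \<le> (\<integral>\<^sup>+y. 1 \<partial>m t)"
        by (intro nn_integral_mono) (simp add: indicator_def)
      finally show ?thesis .
    qed
    also have "\<dots> < \<infinity>"
      by (simp add: less_top[symmetric])
    finally show "(\<integral>\<^sup>+y. ennreal (y t) \<partial>\<nu>) < \<infinity>" .
  qed (use AE_cyl_nonneg[OF sets] in \<open>auto elim!: eventually_mono\<close>)
  have int_comb: "integrable \<nu> g" if "g \<in> nonneg_combs" for g
    using that by induction (use int_comp in auto)
  have int_comb_P: "integrable P g" if "g \<in> nonneg_combs" for g
    using that by induction (use integrable_P in auto)
  have m_split: "laplace (m t) h = drift t + (\<integral>y. y t * exp (- h y) \<partial>\<nu>)"
    if h: "h \<in> nonneg_combs" for h t
  proof -
    note [measurable] = meas_comb[OF h] measurable_comb_m[OF h]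
    have "(\<integral>y. y t * exp (- h y) \<partial>\<nu>) = enn2real (\<integral>\<^sup>+y. ennreal (y t) * ennreal (exp (- h y)) \<partial>\<nu>)"
      using AE_cyl_nonneg[OF sets]
      by (subst integral_eq_nn_integral) (auto elim!: eventually_mono simp: ennreal_mult'')
    also have "(\<integral>\<^sup>+y. ennreal (y t) * ennreal (exp (- h y)) \<partial>\<nu>)
             = (\<integral>\<^sup>+y. indicator {y. 0 < y t} y * ennreal (exp (- h y)) \<partial>m t)"
    proof (rule weighted)
      have [measurable]: "h \<in> borel_measurable cyl_nonneg"
        by (rule nonneg_combs_measurable_of_sets[OF h refl])
      show "(\<lambda>y. ennreal (exp (- h y))) \<in> borel_measurable cyl_nonneg" by measurable
    qed
    also have "enn2real \<dots> = (\<integral>y. indicator {y. 0 < y t} y * exp (- h y) \<partial>m t)"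
      by (subst integral_eq_nn_integral) (auto simp: ennreal_mult'' ennreal_indicator)
    finally have pos: "(\<integral>y. y t * exp (- h y) \<partial>\<nu>) = (\<integral>y. indicator {y. 0 < y t} y * exp (- h y) \<partial>m t)" .
    have "laplace (m t) h
        = (\<integral>y. indicator {y \<in> space (m t). y t = 0} y + indicator {y. 0 < y t} y * exp (- h y) \<partial>m t)"
    proof (rule integral_cong_AE)
      show "AE y in m t. exp (- h y) = indicator {y \<in> space (m t). y t = 0} y + indicator {y. 0 < y t} y * exp (- h y)"
        using AE_m_zero_comb[OF h, of t] AE_cyl_nonneg[OF sets_m, of t] AE_space[of "m t"]
        by eventually_elim (auto simp: indicator_def less_le)
    qed measurable
    also have "\<dots> = drift t + (\<integral>y. indicator {y. 0 < y t} y * exp (- h y) \<partial>m t)"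
    proof (subst Bochner_Integration.integral_add)
      show "integrable (m t) (\<lambda>y. indicator {y. 0 < y t} y * exp (- h y))"
        using integrable_exp_m[OF h, of t]
        by (rule Bochner_Integration.integrable_bound) (auto simp: indicator_def)
    qed (auto simp: drift_def less_top[symmetric] intro!: integrable_real_indicator)
    finally show ?thesis using pos by simp
  qed
  have bias_comb: "(\<integral>y. g y * exp (- h y) \<partial>P) = laplace P h * (g drift + (\<integral>y. g y * exp (- h y) \<partial>\<nu>))"
    if g: "g \<in> nonneg_combs" and h: "h \<in> nonneg_combs" for g h
    using g
  proof induction
    case (add g a t)
    have P: "(\<integral>y. (g y + a * y t) * exp (- h y) \<partial>P) = (\<integral>y. g y * exp (- h y) \<partial>P) + a * (\<integral>y. y t * exp (- h y) \<partial>P)"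
      using integrable_mult_exp_neg_comb[OF sets_P int_comb_P[OF add.hyps(1)] h] integrable_mult_exp_neg_comb[OF sets_P integrable_P[of t] h]
      by (simp add: distrib_right mult.assoc)
    have V: "(\<integral>y. (g y + a * y t) * exp (- h y) \<partial>\<nu>) = (\<integral>y. g y * exp (- h y) \<partial>\<nu>) + a * (\<integral>y. y t * exp (- h y) \<partial>\<nu>)"
      using integrable_mult_exp_neg_comb[OF sets int_comb[OF add.hyps(1)] h] integrable_mult_exp_neg_comb[OF sets int_comp[of t] h]
      by (simp add: distrib_right mult.assoc)
    show ?case
      unfolding P V add.IH using bias[OF h, of t] m_split[OF h, of t] by (simp add: algebra_simps)
  qed simp
  show ?thesis
    unfolding laplace_levy_def
  proof (intro ballI conjI)
    fix g :: "('t \<Rightarrow> real) \<Rightarrow> real" assume g: "g \<in> nonneg_combs"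
    note [measurable] = meas_comb[OF g] measurable_comb_P[OF g]
    have nn: "AE y in K. 0 \<le> g y" if "sets K = sets cyl_nonneg" for K
      using nonneg_combs_nonneg_space[OF g] by (intro AE_I2) (simp add: space_eq_cyl_nonneg[OF that])
    show "integrable \<nu> (\<lambda>y. 1 - exp (- g y))"
    proof (rule Bochner_Integration.integrable_bound[OF int_comb[OF g]])
      have "\<bar>1 - exp (- x)\<bar> \<le> x" if "0 \<le> x" for x :: real
        using exp_neg_lipschitz[OF _ that, of 0] that by simp
      then show "AE y in \<nu>. norm (1 - exp (- g y)) \<le> norm (g y)"
        using nn[OF sets] by (auto elim!: eventually_mono)
    qed measurable
    define L where "L u = (\<integral>y. 1 * exp (- (u * g y)) \<partial>P)" for u
    define K where "K u = u * g drift + (\<integral>y. 1 * (1 - exp (- (u * g y))) \<partial>\<nu>)" for u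
    have dL: "(L has_real_derivative - (L u * (g drift + (\<integral>y. g y * exp (- (u * g y)) \<partial>\<nu>)))) (at u within {0..})"
      if "0 \<le> u" for u
      using has_derivative_weighted_laplace[of P "\<lambda>_. 1" g u] nn[OF sets_P] int_comb_P[OF g] that
        bias_comb[OF g nonneg_combs_scale[OF g that]]
      unfolding L_def by simp
    have dK: "(K has_real_derivative g drift + (\<integral>y. g y * exp (- (u * g y)) \<partial>\<nu>)) (at u within {0..})"
      if "0 \<le> u" for u
      using has_derivative_integral_exp[of "\<lambda>_. 1" \<nu> g u] nn[OF sets] int_comb[OF g] that
      unfolding K_def by (auto intro!: derivative_eq_intros)
    \<comment> \<open>\<open>L u\<close> should equal \<open>exp (- K u)\<close>, and does so at \<open>u = 0\<close>.\<close>
    have "((\<lambda>u. L u * exp (K u)) has_real_derivative 0) (at u within {0..})" if "u \<in> {0..}" for u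
      using DERIV_mult[OF dL[of u] DERIV_chain2[OF DERIV_exp dK[of u]]] that
      by (simp add: algebra_simps)
    from has_field_derivative_zero_constant[OF convex_real_interval(1) this]
    obtain a where a: "\<And>u. 0 \<le> u \<Longrightarrow> L u * exp (K u) = a" by auto
    have "a = 1"
      using a[of 0] P.prob_space by (simp add: L_def K_def)
    then have "L 1 = exp (- K 1)"
      using a[of 1] by (simp add: exp_minus field_simps)
    then show "laplace P g = exp (- g drift - levy_exponent \<nu> g)"
      by (simp add: L_def K_def)
  qed
qed

end

text \<open>The sequence s detects, up to null sets of \<open>m t\<close>, whether the coordinate t is positive.\<close>

locale separated_size_biased_family = size_biased_family P m
  for P :: "('t \<Rightarrow> real) measure" and m +
  fixes s :: "nat \<Rightarrow> 't"
  assumes separating: "\<And>t. AE y in m t. (\<forall>k. y (s k) = 0) \<longrightarrow> y t = 0"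
begin

definition piece :: "nat \<Rightarrow> ('t \<Rightarrow> real) measure" where
  "piece k = density (m (s k)) (\<lambda>y. ennreal (inverse (y (s k))) * indicator {y. 0 < y (s k)} y)"

definition levy :: "('t \<Rightarrow> real) measure" where
  "levy = measure_series cyl_nonneg (\<lambda>k. density (piece k) (indicator (first_positive s k)))"

lemma sets_piece [simp]: "sets (piece k) = sets cyl_nonneg"
  by (simp add: piece_def sets_m)

lemma sets_levy [simp]: "sets levy = sets cyl_nonneg"
  by (simp add: levy_def)

lemma measurable_m_of_cyl: "f \<in> measurable cyl_nonneg K \<Longrightarrow> f \<in> measurable (m t) K"
  by (simp add: measurable_cong_sets[OF sets_m refl])

text \<open>Under \<open>piece k\<close> the weight \<open>y t\<close> turns \<open>m (s k)\<close> into \<open>m t\<close>: by \<open>density_compat\<close> it can be traded for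
  the weight \<open>y (s k)\<close>, which cancels the density of \<open>piece k\<close>.\<close>

lemma nn_integral_piece:
  assumes f: "f \<in> borel_measurable cyl_nonneg"
  shows "(\<integral>\<^sup>+y. ennreal (y t) * f y \<partial>piece k) = (\<integral>\<^sup>+y. indicator {y. 0 < y (s k)} y * f y \<partial>m t)"
proof -
  have [measurable]: "f \<in> borel_measurable (m r)" for r
    by (rule measurable_m_of_cyl[OF f])
  have [measurable]: "(\<lambda>y. y r) \<in> borel_measurable cyl_nonneg" for r
    by (rule measurable_cyl_nonneg_component)
  note f [measurable]
  let ?w = "\<lambda>y. ennreal (inverse (y (s k))) * indicator {y. 0 < y (s k)} y * f y"
  have "(\<integral>\<^sup>+y. ennreal (y t) * f y \<partial>piece k) = (\<integral>\<^sup>+y. ennreal (y t) * ?w y \<partial>m (s k))"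
    unfolding piece_def
    by (subst nn_integral_density)
       (auto simp: mult_ac measurable_cong_sets[OF sets_m refl, of "s k"])
  also have "\<dots> = (\<integral>\<^sup>+y. ?w y \<partial>density (m (s k)) (\<lambda>y. ennreal (y t)))"
    by (subst nn_integral_density) auto
  also have "\<dots> = (\<integral>\<^sup>+y. ?w y \<partial>density (m t) (\<lambda>y. ennreal (y (s k))))"
    by (simp add: density_compat)
  also have "\<dots> = (\<integral>\<^sup>+y. ennreal (y (s k)) * ?w y \<partial>m t)"
    by (subst nn_integral_density) auto
  also have "\<dots> = (\<integral>\<^sup>+y. indicator {y. 0 < y (s k)} y * f y \<partial>m t)"
  proof (intro nn_integral_cong)
    fix y
    have "ennreal x * ennreal (inverse x) = 1" if "0 < x" for x :: real
      using that by (simp flip: ennreal_mult ennreal_1)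
    then show "ennreal (y (s k)) * ?w y = indicator {y. 0 < y (s k)} y * f y"
      by (auto simp: indicator_def mult.assoc[symmetric])
  qed
  finally show ?thesis .
qed

lemma nn_integral_levy:
  assumes "f \<in> borel_measurable cyl_nonneg"
  shows "(\<integral>\<^sup>+y. f y \<partial>levy) = (\<Sum>k. \<integral>\<^sup>+y. indicator (first_positive s k) y * f y \<partial>piece k)"
proof -
  have [measurable]: "f \<in> borel_measurable (piece k)" "first_positive s k \<in> sets (piece k)" for k
    using assms first_positive_sets by (simp_all add: measurable_cong_sets[OF sets_piece refl])
  show ?thesis
    unfolding levy_def using assms
    by (subst nn_integral_measure_series) (auto simp: nn_integral_density)
qed

text \<open>One direction is \<open>separating\<close>, the other is \<open>AE_m_zero\<close> for the countably many indices \<open>s k\<close>.\<close>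

lemma AE_m_support:
  "AE y in m t. 0 < y t \<longleftrightarrow> y \<in> (\<Union>k. first_positive s k)"
proof -
  have "AE y in m t. \<forall>k. y t = 0 \<longrightarrow> y (s k) = 0"
    unfolding AE_all_countable by (intro allI AE_m_zero)
  then show ?thesis
    using separating[of t] AE_cyl_nonneg[OF sets_m] AE_space
  proof eventually_elim
    case (elim y)
    then show ?case
      by (auto simp: UN_first_positive space_eq_cyl_nonneg[OF sets_m] less_le)
  qed
qed

lemma density_levy:
  "density levy (\<lambda>y. ennreal (y t)) = density (m t) (indicator {y. 0 < y t})"
proof (rule measure_eqI)
  fix B assume "B \<in> sets (density levy (\<lambda>y. ennreal (y t)))"
  then have B: "B \<in> sets cyl_nonneg" by simp
  have [measurable]: "(\<lambda>y. y t) \<in> borel_measurable cyl_nonneg"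
    "B \<in> sets cyl_nonneg" "first_positive s k \<in> sets cyl_nonneg" for t k
    by (rule measurable_cyl_nonneg_component, rule B, rule first_positive_sets)
  have [measurable]: "first_positive s k \<in> sets (m t)" "B \<in> sets (m t)" for k t
    using first_positive_sets B by (auto simp: sets_m)
  have [measurable_cong]: "sets levy = sets cyl_nonneg" by simp
  have "emeasure (density levy (\<lambda>y. ennreal (y t))) B = (\<integral>\<^sup>+y. ennreal (y t) * indicator B y \<partial>levy)"
    using B by (subst emeasure_density) auto
  also have "\<dots> = (\<Sum>k. \<integral>\<^sup>+y. indicator (first_positive s k) y * (ennreal (y t) * indicator B y) \<partial>piece k)"
    by (rule nn_integral_levy) measurable
  also have "\<dots> = (\<Sum>k. \<integral>\<^sup>+y. ennreal (y t) * indicator (B \<inter> first_positive s k) y \<partial>piece k)"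
    by (intro suminf_cong nn_integral_cong) (auto simp: indicator_def)
  also have "\<dots> = (\<Sum>k. \<integral>\<^sup>+y. indicator {y. 0 < y (s k)} y * indicator (B \<inter> first_positive s k) y \<partial>m t)"
    by (intro suminf_cong nn_integral_piece) measurable
  also have "\<dots> = (\<Sum>k. \<integral>\<^sup>+y. indicator (B \<inter> first_positive s k) y \<partial>m t)"
    by (intro suminf_cong nn_integral_cong) (auto simp: indicator_def first_positive_def)
  also have "\<dots> = (\<Sum>k. emeasure (m t) (B \<inter> first_positive s k))"
    by (intro suminf_cong nn_integral_indicator) measurable
  also have "\<dots> = emeasure (m t) (\<Union>k. B \<inter> first_positive s k)"
    using disjoint_first_positive[of s]
    by (intro suminf_emeasure) (auto simp: disjoint_family_on_def)
  also have "\<dots> = (\<integral>\<^sup>+y. indicator (\<Union>k. B \<inter> first_positive s k) y \<partial>m t)"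
    by (subst nn_integral_indicator) auto
  also have "\<dots> = (\<integral>\<^sup>+y. indicator {y. 0 < y t} y * indicator B y \<partial>m t)"
    using AE_m_support[of t] by (intro nn_integral_cong_AE) (auto elim!: eventually_mono simp: indicator_def)
  also have "\<dots> = emeasure (density (m t) (indicator {y. 0 < y t})) B"
    by (subst emeasure_density) auto
  finally show "emeasure (density levy (\<lambda>y. ennreal (y t))) B = emeasure (density (m t) (indicator {y. 0 < y t})) B" .
qed (simp add: sets_m)

lemma AE_levy_support: "AE y in levy. y \<in> (\<Union>k. first_positive s k)"
proof -
  have N: "space cyl_nonneg - (\<Union>k. first_positive s k) \<in> sets cyl_nonneg" (is "?N \<in> _")
    using UN_first_positive_sets by auto
  have "emeasure levy ?N = (\<integral>\<^sup>+y. indicator ?N y \<partial>levy)"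
    using N by simp
  also have "\<dots> = (\<Sum>k. \<integral>\<^sup>+y. indicator (first_positive s k) y * indicator ?N y \<partial>piece k)"
    using N by (intro nn_integral_levy) auto
  also have "\<dots> = (\<Sum>k. \<integral>\<^sup>+y. 0 \<partial>piece k)"
    by (intro suminf_cong nn_integral_cong) (auto simp: indicator_def)
  finally have "emeasure levy ?N = 0" by simp
  then show ?thesis
    using N by (intro AE_I'[of ?N]) (auto simp: null_sets_def space_eq_cyl_nonneg[OF sets_levy])
qed

lemma laplace_levy_levy: "laplace_levy P levy drift"
  by (rule laplace_levyI[OF sets_levy density_levy])

lemma nn_integral_levy_component: "(\<integral>\<^sup>+y. ennreal (y t) \<partial>levy) < \<infinity>"
proof -
  have [measurable]: "(\<lambda>y. y t) \<in> borel_measurable levy"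
    by (rule measurable_component_of_sets) simp
  have "(\<integral>\<^sup>+y. ennreal (y t) \<partial>levy) = (\<integral>\<^sup>+y. 1 \<partial>density levy (\<lambda>y. ennreal (y t)))"
    by (subst nn_integral_density) simp_all
  also have "\<dots> = (\<integral>\<^sup>+y. 1 \<partial>density (m t) (indicator {y. 0 < y t}))"
    by (simp only: density_levy)
  also have "\<dots> = (\<integral>\<^sup>+y. indicator {y. 0 < y t} y * 1 \<partial>m t)"
    by (rule nn_integral_density) measurable
  also have "\<dots> \<le> (\<integral>\<^sup>+y. 1 \<partial>m t)"
    by (intro nn_integral_mono) (simp add: indicator_def)
  also have "\<dots> < \<infinity>" by (simp add: less_top[symmetric])
  finally show ?thesis .
qed

lemma levy_measure_levy: "levy_measure levy"
  by (rule levy_measureI[OF sets_levy nn_integral_levy_component UN_first_positive_sets _ AE_levy_support])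
     (simp add: UN_first_positive)

lemma levy_measure_piece: "levy_measure (piece k)"
proof (rule levy_measureI[OF sets_piece])
  have [measurable]: "(\<lambda>y. y t) \<in> borel_measurable cyl_nonneg" for t
    by (rule measurable_cyl_nonneg_component)
  show "{y \<in> space cyl_nonneg. 0 < y (s k)} \<in> sets cyl_nonneg" by measurable
  show "AE y in piece k. y \<in> {y \<in> space cyl_nonneg. 0 < y (s k)}"
    unfolding piece_def
    by (subst AE_density) (auto simp: space_eq_cyl_nonneg[OF sets_m] indicator_def intro!: AE_I2)
  fix t :: 't
  have "(\<integral>\<^sup>+y. ennreal (y t) \<partial>piece k) = (\<integral>\<^sup>+y. indicator {y. 0 < y (s k)} y \<partial>m t)"
    using nn_integral_piece[where f = "\<lambda>_. 1"] by simp
  also have "\<dots> \<le> (\<integral>\<^sup>+y. 1 \<partial>m t)"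
    by (intro nn_integral_mono) (simp add: indicator_def)
  also have "\<dots> < \<infinity>" by (simp add: less_top[symmetric])
  finally show "(\<integral>\<^sup>+y. ennreal (y t) \<partial>piece k) < \<infinity>" .
qed simp

end

section \<open>From Levy measure and drift to a size-biased family\<close>

text \<open>Fatou's lemma for the difference quotients of \<open>1 - exp (- h * y t)\<close> at \<open>h = 1 / (n + 1)\<close>.\<close>

lemma nn_integral_component_le_liminf:
  assumes sets: "sets \<nu> = sets cyl_nonneg"
    and int: "\<And>h. 0 \<le> h \<Longrightarrow> integrable \<nu> (\<lambda>y. 1 - exp (- (h * y t)))"
  shows "(\<integral>\<^sup>+y. ennreal (y t) \<partial>\<nu>)
    \<le> liminf (\<lambda>n. ennreal (real (Suc n) * (\<integral>y. 1 - exp (- (1 / real (Suc n) * y t)) \<partial>\<nu>)))"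
proof -
  have [measurable]: "(\<lambda>y. y t) \<in> borel_measurable \<nu>"
    by (rule measurable_component_of_sets[OF sets])
  define q where "q n x = real (Suc n) * (1 - exp (- (1 / real (Suc n) * x)))" for n and x :: real
  have q_nonneg: "0 \<le> q n x" if "0 \<le> x" for n x
    using that by (simp add: q_def)
  have q_lim: "(\<lambda>n. q n x) \<longlonglongrightarrow> x" for x
  proof -
    have "((\<lambda>h. 1 - exp (- (h * x))) has_real_derivative x) (at 0)"
      by (auto intro!: derivative_eq_intros)
    then have "((\<lambda>h. (1 - exp (- (h * x))) / h) \<longlongrightarrow> x) (at 0)"
      by (simp add: has_field_derivative_iff)
    moreover have "filterlim (\<lambda>n. 1 / real (Suc n)) (at 0) sequentially"
      unfolding filterlim_at using LIMSEQ_inverse_real_of_nat by (simp add: divide_inverse)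
    ultimately have "(\<lambda>n. (1 - exp (- (1 / real (Suc n) * x))) / (1 / real (Suc n))) \<longlonglongrightarrow> x"
      by (rule filterlim_compose)
    then show ?thesis by (simp add: q_def mult.commute)
  qed
  have "(\<integral>\<^sup>+y. ennreal (y t) \<partial>\<nu>) = (\<integral>\<^sup>+y. liminf (\<lambda>n. ennreal (q n (y t))) \<partial>\<nu>)"
    by (intro nn_integral_cong lim_imp_Liminf[symmetric] tendsto_ennrealI q_lim) simp
  also have "\<dots> \<le> liminf (\<lambda>n. \<integral>\<^sup>+y. ennreal (q n (y t)) \<partial>\<nu>)"
    by (rule nn_integral_liminf) (simp add: q_def)
  also have "(\<lambda>n. \<integral>\<^sup>+y. ennreal (q n (y t)) \<partial>\<nu>)
      = (\<lambda>n. ennreal (real (Suc n) * (\<integral>y. 1 - exp (- (1 / real (Suc n) * y t)) \<partial>\<nu>)))"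
  proof
    fix n
    have int': "integrable \<nu> (\<lambda>y. q n (y t))"
      unfolding q_def by (intro integrable_mult_right int) simp
    have nn: "AE y in \<nu>. 0 \<le> q n (y t)"
      using AE_cyl_nonneg[OF sets] by eventually_elim (simp add: q_nonneg)
    show "(\<integral>\<^sup>+y. ennreal (q n (y t)) \<partial>\<nu>) = ennreal (real (Suc n) * (\<integral>y. 1 - exp (- (1 / real (Suc n) * y t)) \<partial>\<nu>))"
      using nn by (subst nn_integral_eq_integral[OF int']) (simp_all add: q_def)
  qed
  finally show ?thesis .
qed

locale levy_triple =
  fixes P \<nu> :: "('t \<Rightarrow> real) measure" and c :: "'t \<Rightarrow> real"
  assumes prob_P: "prob_space P"
    and sets_P: "sets P = sets cyl_nonneg"
    and integrable_P: "\<And>t. integrable P (\<lambda>y. y t)"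
    and sets_nu: "sets \<nu> = sets cyl_nonneg"
    and c_nonneg: "\<And>t. 0 \<le> c t"
    and laplace: "laplace_levy P \<nu> c"
begin

sublocale P: prob_space P by (rule prob_P)

lemma measurable_component_P [measurable]: "(\<lambda>y. y t) \<in> borel_measurable P"
  by (rule measurable_component_of_sets[OF sets_P])

lemma measurable_component_nu [measurable]: "(\<lambda>y. y t) \<in> borel_measurable \<nu>"
  by (rule measurable_component_of_sets[OF sets_nu])

lemma nonneg_P: "AE y in P. 0 \<le> y t"
  using AE_cyl_nonneg[OF sets_P] by (auto elim: eventually_mono)

lemma nonneg_nu: "AE y in \<nu>. 0 \<le> y t"
  using AE_cyl_nonneg[OF sets_nu] by (auto elim: eventually_mono)

lemma integrable_nu: "g \<in> nonneg_combs \<Longrightarrow> integrable \<nu> (\<lambda>y. 1 - exp (- g y))"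
  using laplace unfolding laplace_levy_def by blast

lemma laplace_P: "g \<in> nonneg_combs \<Longrightarrow> laplace P g = exp (- g c - levy_exponent \<nu> g)"
  using laplace unfolding laplace_levy_def by blast

text \<open>The difference quotients \<open>(1 - exp (- h * y t)) / h\<close> have bounded integrals because the
  Laplace transform of P is differentiable at 0; Fatou's lemma passes this on to their limit.\<close>

lemma integrable_component_nu: "integrable \<nu> (\<lambda>y. y t)"
proof (rule integrableI_nonneg)
  define L where "L a = (\<integral>y. 1 * exp (- (a * y t)) \<partial>P)" for a
  define G where "G a = (\<integral>y. 1 - exp (- (a * y t)) \<partial>\<nu>)" for a
  have comb: "(\<lambda>y. a * y t) \<in> nonneg_combs" if "0 \<le> a" for a
    using nonneg_combs_scale[OF nonneg_combs_component that] .
  have L_eq: "L a = exp (- a * c t - G a)" if "0 \<le> a" for a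
    using laplace_P[OF comb[OF that]] by (simp add: L_def G_def)
  have L0: "L 0 = 1"
    using P.prob_space by (simp add: L_def)
  have dL: "(L has_real_derivative - (\<integral>y. y t \<partial>P)) (at 0 within {0..})"
    using has_derivative_weighted_laplace[of P "\<lambda>_. 1" "\<lambda>y. y t" 0] nonneg_P integrable_P[of t]
    unfolding L_def by simp
  have "((\<lambda>a. - ln (L a)) has_real_derivative (\<integral>y. y t \<partial>P)) (at 0 within {0..})"
    using DERIV_minus[OF DERIV_chain2[OF DERIV_ln dL]] by (simp add: L0)
  then have "((\<lambda>a. (- ln (L a) - (- ln (L 0))) / (a - 0)) \<longlongrightarrow> (\<integral>y. y t \<partial>P)) (at 0 within {0..})"
    by (simp add: has_field_derivative_iff)
  moreover have "filterlim (\<lambda>n. 1 / real (Suc n)) (at 0 within {0..}) sequentially"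
    unfolding filterlim_at using LIMSEQ_inverse_real_of_nat by (simp add: divide_inverse)
  ultimately have "(\<lambda>n. (- ln (L (1 / real (Suc n))) - (- ln (L 0))) / (1 / real (Suc n) - 0)) \<longlonglongrightarrow> (\<integral>y. y t \<partial>P)"
    by (rule filterlim_compose)
  then have "(\<lambda>n. c t + real (Suc n) * G (1 / real (Suc n))) \<longlonglongrightarrow> (\<integral>y. y t \<partial>P)"
  proof (rule Lim_transform_eventually, intro always_eventually allI)
    fix n
    have "0 < 1 / real (Suc n)" by simp
    then show "(- ln (L (1 / real (Suc n))) - (- ln (L 0))) / (1 / real (Suc n) - 0) = c t + real (Suc n) * G (1 / real (Suc n))"
      unfolding L0 by (subst L_eq) (simp_all add: algebra_simps add_divide_distrib del: of_nat_Suc)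
  qed
  then have lim: "(\<lambda>n. real (Suc n) * G (1 / real (Suc n))) \<longlonglongrightarrow> (\<integral>y. y t \<partial>P) - c t"
    using tendsto_diff[OF _ tendsto_const[of "c t"]] by fastforce
  have "(\<integral>\<^sup>+y. ennreal (y t) \<partial>\<nu>) \<le> liminf (\<lambda>n. ennreal (real (Suc n) * G (1 / real (Suc n))))"
    unfolding G_def by (rule nn_integral_component_le_liminf[OF sets_nu]) (intro integrable_nu comb)
  also have "liminf (\<lambda>n. ennreal (real (Suc n) * G (1 / real (Suc n)))) = ennreal ((\<integral>y. y t \<partial>P) - c t)"
    by (intro lim_imp_Liminf tendsto_ennrealI lim) simp
  finally show "(\<integral>\<^sup>+y. ennreal (y t) \<partial>\<nu>) < \<infinity>"
    by (rule le_less_trans) simp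
qed (use nonneg_nu in auto)

text \<open>Both sides of the Levy formula are differentiated in direction t.  Here \<open>k\<close> is the exponent at
  \<open>g\<close>, and \<open>G a\<close> is the increment of the integral part of the exponent when \<open>g\<close> is moved by \<open>a * y t\<close>.\<close>

lemma bias:
  assumes g: "g \<in> nonneg_combs"
  shows "(\<integral>y. y t * exp (- g y) \<partial>P) = laplace P g * (c t + (\<integral>y. y t * exp (- g y) \<partial>\<nu>))"
proof -
  have [measurable]: "g \<in> borel_measurable P" "g \<in> borel_measurable \<nu>"
    using nonneg_combs_measurable_of_sets[OF g] sets_P sets_nu by auto
  have int: "integrable K (\<lambda>y. exp (- g y) * y t)" if "sets K = sets cyl_nonneg" "integrable K (\<lambda>y. y t)" for K
    using integrable_mult_exp_neg_comb[OF that g] by (simp add: mult.commute)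
  define L where "L a = (\<integral>y. exp (- g y) * exp (- (a * y t)) \<partial>P)" for a
  define G where "G a = (\<integral>y. exp (- g y) * (1 - exp (- (a * y t))) \<partial>\<nu>)" for a
  define k where "k = - g c - levy_exponent \<nu> g"
  have G0: "G 0 = 0" by (simp add: G_def)
  have dL: "(L has_real_derivative - (\<integral>y. exp (- g y) * y t \<partial>P)) (at 0 within {0..})"
    using has_derivative_weighted_laplace[of P "\<lambda>y. exp (- g y)" "\<lambda>y. y t" 0] nonneg_P
      integrable_exp_neg_comb[OF P.finite_measure_axioms sets_P g] int[OF sets_P integrable_P[of t]]
    unfolding L_def by simp
  have dG: "(G has_real_derivative (\<integral>y. exp (- g y) * y t \<partial>\<nu>)) (at 0 within {0..})"
    using has_derivative_integral_exp[of "\<lambda>y. exp (- g y)" \<nu> "\<lambda>y. y t" 0] nonneg_nu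
      int[OF sets_nu integrable_component_nu[of t]]
    unfolding G_def by simp
  have L_eq: "L a = exp (k - a * c t - G a)" if a: "0 \<le> a" for a
  proof -
    note ga = nonneg_combs.add[OF g a, of t]
    have "G a = (\<integral>y. (1 - exp (- (g y + a * y t))) - (1 - exp (- g y)) \<partial>\<nu>)"
      unfolding G_def by (intro Bochner_Integration.integral_cong) (simp_all add: algebra_simps exp_add[symmetric])
    also have "\<dots> = (\<integral>y. 1 - exp (- (g y + a * y t)) \<partial>\<nu>) - levy_exponent \<nu> g"
      by (rule Bochner_Integration.integral_diff[OF integrable_nu[OF ga] integrable_nu[OF g]])
    finally show ?thesis
      using laplace_P[OF ga] by (simp add: L_def k_def exp_add[symmetric] algebra_simps)
  qed
  have "((\<lambda>a. exp (k - a * c t - G a)) has_real_derivative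
      exp k * - (c t + (\<integral>y. exp (- g y) * y t \<partial>\<nu>))) (at 0 within {0..})"
    using DERIV_chain2[OF DERIV_exp DERIV_diff[OF DERIV_diff[OF DERIV_const DERIV_cmult_right[OF DERIV_ident]] dG], of k "c t"]
    by (simp add: G0 algebra_simps)
  then have "(L has_real_derivative exp k * - (c t + (\<integral>y. exp (- g y) * y t \<partial>\<nu>))) (at 0 within {0..})"
    by (rule has_field_derivative_transform_within[of _ _ _ _ 1]) (simp_all add: L_eq)
  from has_real_derivative_right_unique[OF dL this]
  have "(\<integral>y. exp (- g y) * y t \<partial>P) = exp k * (c t + (\<integral>y. exp (- g y) * y t \<partial>\<nu>))"
    by (simp add: algebra_simps)
  then show ?thesis
    by (simp add: laplace_P[OF g] k_def mult.commute)
qed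

text \<open>The size-biased law that belongs to \<open>\<nu>\<close> and \<open>c\<close>, multiplied by the mean of the coordinate t.\<close>

definition bias_measure :: "'t \<Rightarrow> ('t \<Rightarrow> real) measure" where
  "bias_measure t = measure_plus (scale_measure (ennreal (c t)) (return cyl_nonneg (\<lambda>_. 0)))
     (density \<nu> (\<lambda>y. ennreal (y t)))"

lemma sets_bias_measure [simp]: "sets (bias_measure t) = sets cyl_nonneg"
  by (simp add: bias_measure_def)

lemma nn_integral_bias_measure:
  assumes f: "f \<in> borel_measurable cyl_nonneg"
  shows "(\<integral>\<^sup>+y. f y \<partial>bias_measure t) = ennreal (c t) * f (\<lambda>_. 0) + (\<integral>\<^sup>+y. ennreal (y t) * f y \<partial>\<nu>)"
proof -
  have [measurable]: "f \<in> borel_measurable \<nu>"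
    using f by (simp add: measurable_cong_sets[OF sets_nu refl])
  have z: "(\<lambda>_. 0) \<in> space cyl_nonneg" by (simp add: space_cyl_nonneg)
  have r: "(\<integral>\<^sup>+y. f y \<partial>return cyl_nonneg (\<lambda>_. 0)) = f (\<lambda>_. 0)"
    by (rule nn_integral_return[OF z f])
  have [measurable]: "f \<in> borel_measurable (return cyl_nonneg (\<lambda>_. 0))"
    using f by simp
  have [measurable]: "f \<in> borel_measurable (scale_measure (ennreal (c t)) (return cyl_nonneg (\<lambda>_. 0)))"
    by (subst measurable_cong_sets[OF sets_scale_measure refl]) measurable
  have sc: "(\<integral>\<^sup>+y. f y \<partial>scale_measure (ennreal (c t)) (return cyl_nonneg (\<lambda>_. 0))) = ennreal (c t) * f (\<lambda>_. 0)"
    by (subst nn_integral_scale_measure) (simp_all add: r f)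
  show ?thesis
    unfolding bias_measure_def
    by (subst nn_integral_measure_plus)
       (simp_all add: sets_nu nn_integral_density sc)
qed

lemma finite_bias_measure: "finite_measure (bias_measure t)"
proof (rule finite_measureI)
  have "emeasure (bias_measure t) (space (bias_measure t)) = (\<integral>\<^sup>+y. 1 \<partial>bias_measure t)" by simp
  also have "\<dots> = ennreal (c t) + (\<integral>\<^sup>+y. ennreal (y t) \<partial>\<nu>)"
    by (subst nn_integral_bias_measure) simp_all
  also have "\<dots> < \<infinity>"
    using integrable_component_nu[of t] nonneg_nu[of t]
    by (subst nn_integral_eq_integral) (auto simp: less_top[symmetric])
  finally show "emeasure (bias_measure t) (space (bias_measure t)) \<noteq> \<infinity>" by simp
qed

lemma size_biased_family_bias_measure: "size_biased_family P bias_measure"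
proof (rule size_biased_family.intro)
  fix t g assume g: "g \<in> (nonneg_combs :: (('t \<Rightarrow> real) \<Rightarrow> real) set)"
  have [measurable]: "g \<in> borel_measurable \<nu>" "g \<in> borel_measurable cyl_nonneg" "g \<in> borel_measurable (bias_measure t)"
    using nonneg_combs_measurable_of_sets[OF g] sets_nu by auto
  note int = integrable_mult_exp_neg_comb[OF sets_nu integrable_component_nu[of t] g]
  have I0: "0 \<le> (\<integral>y. y t * exp (- g y) \<partial>\<nu>)"
    using nonneg_nu[of t] by (intro integral_nonneg_AE) (auto elim: eventually_mono)
  have "laplace (bias_measure t) g = enn2real (\<integral>\<^sup>+y. ennreal (exp (- g y)) \<partial>bias_measure t)"
    by (subst integral_eq_nn_integral) auto
  also have "(\<integral>\<^sup>+y. ennreal (exp (- g y)) \<partial>bias_measure t) = ennreal (c t) + (\<integral>\<^sup>+y. ennreal (y t) * ennreal (exp (- g y)) \<partial>\<nu>)"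
    by (subst nn_integral_bias_measure) (simp_all add: nonneg_combs_zero_path[OF g])
  also have "(\<integral>\<^sup>+y. ennreal (y t) * ennreal (exp (- g y)) \<partial>\<nu>) = ennreal (\<integral>y. y t * exp (- g y) \<partial>\<nu>)"
    using nonneg_nu[of t]
    by (subst nn_integral_eq_integral[OF int, symmetric]) (auto elim: eventually_mono simp: ennreal_mult'')
  finally have "laplace (bias_measure t) g = c t + (\<integral>y. y t * exp (- g y) \<partial>\<nu>)"
    using c_nonneg[of t] I0 by (simp flip: ennreal_plus)
  then show "(\<integral>y. y t * exp (- g y) \<partial>P) = laplace P g * laplace (bias_measure t) g"
    using bias[OF g] by simp
qed (simp_all add: prob_P sets_P integrable_P finite_bias_measure)

end

text \<open>On the paths that vanish along a separating sequence every coordinate vanishes almost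
  everywhere, so there \<open>\<nu>\<close> cannot tell a measurable set that misses the zero path from the empty set.\<close>

lemma levy_measure_null_off_support:
  assumes lev: "levy_measure \<nu>"
    and sep: "\<And>t. AE y in \<nu>. (\<forall>k. y (s k) = 0) \<longrightarrow> y t = 0"
  shows "AE y in \<nu>. y \<in> (\<Union>k. first_positive s k)"
proof -
  have sets: "sets \<nu> = sets cyl_nonneg" using lev by (simp add: levy_measure_def)
  let ?Z = "\<lambda>y :: 'a \<Rightarrow> real. \<forall>k. y (s k) = 0"
  have det: "AE y in \<nu>. ?Z y \<longrightarrow> (y \<in> D \<longleftrightarrow> (\<lambda>_. 0) \<in> D)" if "D \<in> sets cyl_nonneg" for D
    using that unfolding cyl_nonneg_def sets_PiM_single
  proof (induction rule: sigma_sets.induct)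
    case (Basic D)
    then obtain t A where D: "D = {y \<in> Pi\<^sub>E UNIV (\<lambda>_. space (restrict_space borel {0..})). y t \<in> A}" by blast
    show ?case
      using sep[of t] AE_space[of \<nu>]
      by eventually_elim (auto simp: D space_eq_cyl_nonneg[OF sets] space_cyl_nonneg space_restrict_space)
  next
    case (Compl D)
    then show ?case
      using AE_space[of \<nu>]
      by eventually_elim (auto simp: space_eq_cyl_nonneg[OF sets] space_cyl_nonneg space_restrict_space)
  next
    case (Union D)
    then have "AE y in \<nu>. \<forall>i. ?Z y \<longrightarrow> (y \<in> D i \<longleftrightarrow> (\<lambda>_. 0) \<in> D i)"
      unfolding AE_all_countable by blast
    then show ?case by eventually_elim auto
  qed simp
  define N where "N = space cyl_nonneg - (\<Union>k. first_positive s k)"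
  have N: "N \<in> sets \<nu>" using UN_first_positive_sets sets by (auto simp: N_def)
  have "emeasure \<nu> N = inner_measure \<nu> (N - {\<lambda>_. 0})"
    using lev N by (simp add: levy_measure_def)
  also have "\<dots> = 0"
    unfolding inner_measure_def
  proof (rule antisym, rule SUP_least)
    fix D assume "D \<in> {D \<in> sets \<nu>. D \<subseteq> N - {\<lambda>_. 0}}"
    then have D: "D \<in> sets \<nu>" "D \<subseteq> N" "(\<lambda>_. 0) \<notin> D" by auto
    have "AE y in \<nu>. y \<notin> D"
      using det[of D] D sets by (auto elim!: eventually_mono simp: N_def UN_first_positive)
    then show "emeasure \<nu> D \<le> 0"
      using AE_iff_null_sets[OF D(1)] by (simp add: null_sets_def)
  qed simp
  finally show ?thesis
    using N by (intro AE_I'[of N]) (auto simp: null_sets_def N_def space_eq_cyl_nonneg[OF sets])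
qed

text \<open>On \<open>first_positive s k\<close> the density \<open>y (s k)\<close> is positive and can be divided out.\<close>

lemma measure_eq_from_densities:
  assumes sets: "sets \<mu> = sets cyl_nonneg" "sets \<nu> = sets cyl_nonneg"
    and dens: "\<And>k. density \<mu> (\<lambda>y. ennreal (y (s k))) = density \<nu> (\<lambda>y. ennreal (y (s k)))"
    and supp: "AE y in \<mu>. y \<in> (\<Union>k. first_positive s k)" "AE y in \<nu>. y \<in> (\<Union>k. first_positive s k)"
  shows "\<mu> = \<nu>"
proof (rule measure_eqI)
  fix B assume "B \<in> sets \<mu>"
  then have B: "B \<in> sets cyl_nonneg" by (simp add: sets)
  have split: "emeasure K B = (\<Sum>k. \<integral>\<^sup>+y. ennreal (inverse (y (s k))) * indicator (B \<inter> first_positive s k) y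
      \<partial>density K (\<lambda>y. ennreal (y (s k))))"
    if K: "sets K = sets cyl_nonneg" and S: "AE y in K. y \<in> (\<Union>k. first_positive s k)" for K
  proof -
    have [measurable]: "(\<lambda>y. y t) \<in> borel_measurable K" for t
      by (rule measurable_component_of_sets[OF K])
    have [measurable]: "B \<in> sets K" "first_positive s k \<in> sets K" for k
      using B first_positive_sets K by auto
    have "emeasure K B = emeasure K (\<Union>k. B \<inter> first_positive s k)"
      using S by (intro emeasure_eq_AE) (auto elim!: eventually_mono)
    also have "\<dots> = (\<Sum>k. emeasure K (B \<inter> first_positive s k))"
      using disjoint_first_positive[of s]
      by (intro suminf_emeasure[symmetric]) (auto simp: disjoint_family_on_def)
    also have "\<dots> = (\<Sum>k. \<integral>\<^sup>+y. ennreal (y (s k)) * (ennreal (inverse (y (s k))) * indicator (B \<inter> first_positive s k) y) \<partial>K)"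
    proof (intro suminf_cong)
      fix k
      have "ennreal x * ennreal (inverse x) = 1" if "0 < x" for x :: real
        using that by (simp flip: ennreal_mult ennreal_1)
      then have "ennreal (y (s k)) * (ennreal (inverse (y (s k))) * indicator (B \<inter> first_positive s k) y)
          = indicator (B \<inter> first_positive s k) y" for y
        by (auto simp: indicator_def first_positive_def)
      then show "emeasure K (B \<inter> first_positive s k) = (\<integral>\<^sup>+y. ennreal (y (s k)) * (ennreal (inverse (y (s k))) * indicator (B \<inter> first_positive s k) y) \<partial>K)"
        by simp
    qed
    also have "\<dots> = (\<Sum>k. \<integral>\<^sup>+y. ennreal (inverse (y (s k))) * indicator (B \<inter> first_positive s k) y
      \<partial>density K (\<lambda>y. ennreal (y (s k))))"
      by (intro suminf_cong nn_integral_density[symmetric]) measurable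
    finally show ?thesis .
  qed
  show "emeasure \<mu> B = emeasure \<nu> B"
    using split[OF sets(1) supp(1)] split[OF sets(2) supp(2)] by (simp add: dens)
qed (simp add: sets)

context separated_size_biased_family
begin

text \<open>The measures \<open>m t\<close> are determined by \<open>P\<close>, and \<open>m t = c t * \<delta>\<^sub>0 + y t * \<nu>(dy)\<close> by
  \<open>size_biased_family_bias_measure\<close>.  Evaluating this on \<open>{y. y t = 0}\<close> gives \<open>c t\<close>; restricting it to
  \<open>{y. 0 < y t}\<close> gives the densities that determine \<open>\<nu>\<close>.\<close>

theorem levy_drift_unique:
  assumes "laplace_levy P \<nu> c" "levy_measure \<nu>" "\<And>t. 0 \<le> c t"
  shows "\<nu> = levy" "c t = drift t"
proof -
  have sets: "sets \<nu> = sets cyl_nonneg" using assms(2) by (simp add: levy_measure_def)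
  interpret V: levy_triple P \<nu> c
    by unfold_locales (use prob_P sets_P integrable_P assms sets in auto)
  have m_eq: "m t = V.bias_measure t" for t
    by (rule size_biased_family_unique[OF size_biased_family_axioms V.size_biased_family_bias_measure])
  have [measurable]: "(\<lambda>y. y t) \<in> borel_measurable cyl_nonneg" for t
    by (rule measurable_cyl_nonneg_component)
  have z: "(\<lambda>_. 0) \<in> space cyl_nonneg" by (simp add: space_cyl_nonneg)
  show "c t = drift t"
  proof -
    define E where "E = {y \<in> space cyl_nonneg. y t = 0}"
    have [measurable]: "E \<in> sets cyl_nonneg" unfolding E_def by measurable
    have zE: "(\<lambda>_. 0) \<in> E" using z by (simp add: E_def)
    have "ennreal (drift t) = emeasure (V.bias_measure t) E"
      unfolding m_eq[of t, symmetric] drift_def E_def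
      by (simp add: m.emeasure_eq_measure space_eq_cyl_nonneg[OF sets_m])
    also have "\<dots> = (\<integral>\<^sup>+y. indicator E y \<partial>V.bias_measure t)" by simp
    also have "\<dots> = ennreal (c t) * indicator E (\<lambda>_. 0) + (\<integral>\<^sup>+y. ennreal (y t) * indicator E y \<partial>\<nu>)"
      by (rule V.nn_integral_bias_measure) measurable
    also have "(\<integral>\<^sup>+y. ennreal (y t) * indicator E y \<partial>\<nu>) = (\<integral>\<^sup>+y. 0 \<partial>\<nu>)"
      by (intro nn_integral_cong) (auto simp: E_def indicator_def)
    also have "ennreal (c t) * indicator E (\<lambda>_. 0) + (\<integral>\<^sup>+y. 0 \<partial>\<nu>) = ennreal (c t)"
      using zE by simp
    finally show ?thesis
      using assms(3)[of t] drift_nonneg[of t] by simp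
  qed
  have dens: "density \<nu> (\<lambda>y. ennreal (y t)) = density (m t) (indicator {y. 0 < y t})" for t
  proof (rule measure_eqI)
    fix B assume "B \<in> sets (density \<nu> (\<lambda>y. ennreal (y t)))"
    then have [measurable]: "B \<in> sets cyl_nonneg" by (simp add: sets)
    then have B: "B \<in> sets \<nu>" "B \<in> sets (m t)" by (simp_all add: sets sets_m)
    have [measurable]: "(\<lambda>y. y t) \<in> borel_measurable (V.bias_measure t)"
      by (rule measurable_component_of_sets) simp
    have "emeasure (density (m t) (indicator {y. 0 < y t})) B
        = (\<integral>\<^sup>+y. indicator {y. 0 < y t} y * indicator B y \<partial>V.bias_measure t)"
      unfolding m_eq[of t, symmetric] using B(2) by (intro emeasure_density) simp_all
    also have "\<dots> = ennreal (c t) * (indicator {y. 0 < y t} (\<lambda>_. 0 :: real) * indicator B (\<lambda>_. 0))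
        + (\<integral>\<^sup>+y. ennreal (y t) * (indicator {y. 0 < y t} y * indicator B y) \<partial>\<nu>)"
      by (rule V.nn_integral_bias_measure[where f = "\<lambda>y. indicator {y. 0 < y t} y * indicator B y"]) measurable
    also have "\<dots> = (\<integral>\<^sup>+y. ennreal (y t) * indicator B y \<partial>\<nu>)"
    proof -
      have "(\<integral>\<^sup>+y. ennreal (y t) * (indicator {y. 0 < y t} y * indicator B y) \<partial>\<nu>) = (\<integral>\<^sup>+y. ennreal (y t) * indicator B y \<partial>\<nu>)"
      proof (rule nn_integral_cong)
        fix y :: "'t \<Rightarrow> real"
        show "ennreal (y t) * (indicator {y. 0 < y t} y * indicator B y) = ennreal (y t) * indicator B y"
          by (cases "0 < y t") (simp_all add: ennreal_neg)
      qed
      then show ?thesis by simp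
    qed
    also have "\<dots> = emeasure (density \<nu> (\<lambda>y. ennreal (y t))) B"
      using B by (subst emeasure_density) auto
    finally show "emeasure (density \<nu> (\<lambda>y. ennreal (y t))) B = emeasure (density (m t) (indicator {y. 0 < y t})) B"
      by simp
  qed (simp add: sets sets_m)
  have "AE y in \<nu>. (\<forall>k. y (s k) = 0) \<longrightarrow> y t = 0" for t
  proof -
    have "AE y in density (m t) (indicator {y. 0 < y t}). \<exists>k. y (s k) \<noteq> 0"
      using separating[of t] by (subst AE_density) (auto elim!: eventually_mono simp: indicator_def)
    then have "AE y in \<nu>. 0 < ennreal (y t) \<longrightarrow> (\<exists>k. y (s k) \<noteq> 0)"
      unfolding dens[symmetric] by (subst (asm) AE_density) simp_all
    then show ?thesis
      using V.nonneg_nu[of t] by eventually_elim auto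
  qed
  note supp = levy_measure_null_off_support[OF assms(2) this]
  show "\<nu> = levy"
    by (rule measure_eq_from_densities[of _ _ s, OF sets sets_levy _ supp AE_levy_support])
       (simp only: dens density_levy)
qed

end

section \<open>Realizing a Levy measure and a drift\<close>

definition path_sum :: "nat \<Rightarrow> (nat \<Rightarrow> 't \<Rightarrow> real) \<Rightarrow> 't \<Rightarrow> real" where
  "path_sum n x = (\<lambda>t. \<Sum>i<n. x i t)"

definition conv_power :: "nat \<Rightarrow> ('t \<Rightarrow> real) measure \<Rightarrow> ('t \<Rightarrow> real) measure" where
  "conv_power n \<rho> = distr (PiM {..<n} (\<lambda>_. \<rho>)) cyl_nonneg (path_sum n)"

lemma measurable_path_sum:
  assumes "\<And>i. sets (R i) = sets cyl_nonneg" "{..<n} \<subseteq> I"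
  shows "path_sum n \<in> measurable (PiM I R) cyl_nonneg"
proof (rule measurable_into_cyl_nonneg)
  have [measurable]: "(\<lambda>\<omega>. \<omega> i t) \<in> borel_measurable (PiM I R)" if "i < n" for i t
    using measurable_compose[OF measurable_component_singleton[of i I R] measurable_component_of_sets[OF assms(1)[of i]]] that assms(2)
    by auto
  show "(\<lambda>\<omega>. path_sum n \<omega> t) \<in> borel_measurable (PiM I R)" for t
    unfolding path_sum_def by (intro borel_measurable_sum) auto
  fix \<omega> and t :: 'a assume \<omega>: "\<omega> \<in> space (PiM I R)"
  have "0 \<le> \<omega> i t" if "i < n" for i
    using \<omega> that assms(2) by (auto simp: space_PiM PiE_iff space_eq_cyl_nonneg[OF assms(1)] space_cyl_nonneg)
  then show "0 \<le> path_sum n \<omega> t"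
    by (auto simp: path_sum_def intro!: sum_nonneg)
qed

lemma comb_path_sum: "g \<in> nonneg_combs \<Longrightarrow> g (path_sum n x) = (\<Sum>i<n. g (x i))"
  unfolding path_sum_def by (rule nonneg_combs_path_sum) auto

lemma sets_conv_power [simp]: "sets (conv_power n \<rho>) = sets cyl_nonneg"
  by (simp add: conv_power_def)

lemma laplace_conv_power:
  assumes "finite_measure \<rho>" and sets: "sets \<rho> = sets cyl_nonneg" and g: "g \<in> nonneg_combs"
  shows "laplace (conv_power n \<rho>) g = laplace \<rho> g ^ n"
proof -
  interpret finite_measure \<rho> by fact
  interpret product_sigma_finite "\<lambda>_::nat. \<rho>" ..
  have [measurable]: "g \<in> borel_measurable cyl_nonneg"
    by (rule nonneg_combs_measurable_of_sets[OF g refl])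
  have "laplace (conv_power n \<rho>) g = (\<integral>x. exp (- g (path_sum n x)) \<partial>PiM {..<n} (\<lambda>_. \<rho>))"
    unfolding conv_power_def by (intro integral_distr measurable_path_sum sets) auto
  also have "\<dots> = (\<integral>x. (\<Prod>i<n. exp (- g (x i))) \<partial>PiM {..<n} (\<lambda>_. \<rho>))"
    by (simp add: comb_path_sum[OF g] exp_sum flip: sum_negf)
  also have "\<dots> = (\<Prod>i<n. \<integral>y. exp (- g y) \<partial>\<rho>)"
    by (rule product_integral_prod) (auto intro: integrable_exp_neg_comb[OF assms])
  finally show ?thesis by simp
qed

lemma finite_conv_power:
  assumes "finite_measure \<rho>" and sets: "sets \<rho> = sets cyl_nonneg"
  shows "finite_measure (conv_power n \<rho>)"
proof -
  interpret finite_measure \<rho> by fact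
  interpret product_sigma_finite "\<lambda>_::nat. \<rho>" ..
  have "emeasure (PiM {..<n} (\<lambda>_. \<rho>)) (\<Pi>\<^sub>E i\<in>{..<n}. space \<rho>) = (\<Prod>i<n. emeasure \<rho> (space \<rho>))"
    by (rule emeasure_PiM) auto
  then have "finite_measure (PiM {..<n} (\<lambda>_. \<rho>))"
    by (intro finite_measureI) (simp add: space_PiM power_eq_top_ennreal)
  then show ?thesis
    unfolding conv_power_def
    by (rule finite_measure.finite_measure_distr) (intro measurable_path_sum sets subset_refl)
qed

text \<open>The compound Poisson law \<open>exp (- \<lambda>) * (\<Sum>n. \<rho>\<^bsup>*n\<^esup> / n!)\<close>, where \<open>\<lambda>\<close> is the total mass of \<open>\<rho>\<close>.\<close>

lemma compound_poisson_exists: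
  fixes \<rho> :: "('t \<Rightarrow> real) measure"
  assumes fin: "finite_measure \<rho>" and sets: "sets \<rho> = sets cyl_nonneg"
  obtains R where "prob_space R" "sets R = sets cyl_nonneg"
    "\<And>g. g \<in> nonneg_combs \<Longrightarrow> laplace R g = exp (- levy_exponent \<rho> g)"
proof -
  interpret finite_measure \<rho> by fact
  define mass where "mass = measure \<rho> (space \<rho>)"
  define R where "R = measure_series cyl_nonneg (\<lambda>n. scale_measure (ennreal (exp (- mass) / fact n)) (conv_power n \<rho>))"
  have sets_R: "sets R = sets cyl_nonneg" by (simp add: R_def)
  have lap: "(\<integral>\<^sup>+y. ennreal (exp (- g y)) \<partial>R) = ennreal (exp (- levy_exponent \<rho> g))"
    if g: "g \<in> nonneg_combs" for g
  proof -
    have gm: "g \<in> borel_measurable cyl_nonneg"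
      by (rule nonneg_combs_measurable_of_sets[OF g refl])
    have [measurable]: "g \<in> borel_measurable (conv_power n \<rho>)" for n
      by (rule nonneg_combs_measurable_of_sets[OF g]) simp
    define a where "a = laplace \<rho> g"
    have a: "0 \<le> a" unfolding a_def by (rule integral_nonneg_AE) simp
    have "(\<integral>\<^sup>+y. ennreal (exp (- g y)) \<partial>scale_measure (ennreal (exp (- mass) / fact n)) (conv_power n \<rho>))
        = ennreal (exp (- mass) * (a ^ n / fact n))" for n
    proof -
      have "(\<integral>\<^sup>+y. ennreal (exp (- g y)) \<partial>conv_power n \<rho>) = ennreal (a ^ n)"
        using laplace_conv_power[OF fin sets g, of n]
          integrable_exp_neg_comb[OF finite_conv_power[OF fin sets] _ g, of n]
        by (subst nn_integral_eq_integral) (simp_all add: a_def)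
      then show ?thesis
        using a by (subst nn_integral_scale_measure) (simp_all flip: ennreal_mult'')
    qed
    then have "(\<integral>\<^sup>+y. ennreal (exp (- g y)) \<partial>R) = (\<Sum>n. ennreal (exp (- mass) * (a ^ n / fact n)))"
      unfolding R_def using gm by (subst nn_integral_measure_series) simp_all
    also have "\<dots> = ennreal (exp (- mass) * exp a)"
    proof (rule suminf_ennreal_eq)
      show "(\<lambda>n. exp (- mass) * (a ^ n / fact n)) sums (exp (- mass) * exp a)"
        using exp_converges[of a] by (intro sums_mult) (simp add: divide_inverse mult.commute)
    qed (use a in auto)
    also have "exp (- mass) * exp a = exp (- levy_exponent \<rho> g)"
      using integrable_exp_neg_comb[OF fin sets g]
      by (simp add: a_def mass_def exp_diff exp_minus divide_inverse mult.commute)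
    finally show ?thesis .
  qed
  have "prob_space R"
    using lap[OF nonneg_combs.zero] by (intro prob_spaceI) simp
  moreover have "laplace R g = exp (- levy_exponent \<rho> g)" if g: "g \<in> nonneg_combs" for g
    using lap[OF g] nonneg_combs_measurable_of_sets[OF g sets_R]
    by (subst integral_eq_nn_integral) auto
  ultimately show ?thesis using that sets_R by blast
qed

text \<open>Controls the mean of a compound Poisson law through its Laplace transform alone: the bound
  \<open>1 - exp (- x) \<le> x\<close> is used once for the outer and once for the inner exponential.\<close>

lemma nn_integral_component_le_of_laplace:
  assumes R: "prob_space R" "sets R = sets cyl_nonneg" and \<rho>: "finite_measure \<rho>" "sets \<rho> = sets cyl_nonneg"
    and lap: "\<And>g. g \<in> nonneg_combs \<Longrightarrow> laplace R g = exp (- levy_exponent \<rho> g)"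
  shows "(\<integral>\<^sup>+y. ennreal (y t) \<partial>R) \<le> (\<integral>\<^sup>+y. ennreal (y t) \<partial>\<rho>)"
proof -
  interpret R: prob_space R by fact
  interpret \<rho>: finite_measure \<rho> by fact
  have comb: "(\<lambda>y. h * y t) \<in> nonneg_combs" if "0 \<le> h" for h
    using nonneg_combs_scale[OF nonneg_combs_component that] .
  have int: "integrable K (\<lambda>y. 1 - exp (- (h * y t)))"
    if "finite_measure K" "sets K = sets cyl_nonneg" "0 \<le> h" for h K
    using integrable_exp_neg_comb[OF that(1,2) comb[OF that(3)]] finite_measure.integrable_const[OF that(1)]
    by (intro Bochner_Integration.integrable_diff) auto
  have "ennreal (real (Suc n) * (\<integral>y. 1 - exp (- (1 / real (Suc n) * y t)) \<partial>R)) \<le> (\<integral>\<^sup>+y. ennreal (y t) \<partial>\<rho>)" for n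
  proof -
    define h where "h = 1 / real (Suc n)"
    have h: "0 < h" by (simp add: h_def)
    define G where "G = (\<integral>y. 1 - exp (- (h * y t)) \<partial>\<rho>)"
    have nn: "AE y in \<rho>. 0 \<le> 1 - exp (- (h * y t))"
      using AE_cyl_nonneg[OF \<rho>(2)] by eventually_elim (use h in simp)
    have "(\<integral>y. 1 - exp (- (h * y t)) \<partial>R) = 1 - exp (- G)"
      using lap[OF comb[of h]] h integrable_exp_neg_comb[OF R.finite_measure_axioms R(2) comb[of h]]
      by (simp add: G_def R.prob_space)
    also have "\<dots> \<le> G" using exp_ge_add_one_self[of "- G"] by linarith
    finally have "ennreal (real (Suc n) * (\<integral>y. 1 - exp (- (h * y t)) \<partial>R)) \<le> ennreal (real (Suc n) * G)"
      by (intro ennreal_leI mult_left_mono) auto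
    also have "\<dots> = ennreal (real (Suc n)) * (\<integral>\<^sup>+y. ennreal (1 - exp (- (h * y t))) \<partial>\<rho>)"
      using h nn unfolding G_def
      by (subst nn_integral_eq_integral[OF int[OF \<rho>]]) (auto simp: ennreal_mult')
    also have "\<dots> \<le> ennreal (real (Suc n)) * (\<integral>\<^sup>+y. ennreal (h * y t) \<partial>\<rho>)"
    proof (intro mult_left_mono nn_integral_mono ennreal_leI)
      fix y show "1 - exp (- (h * y t)) \<le> h * y t"
        using exp_ge_add_one_self[of "- (h * y t)"] by linarith
    qed simp
    also have "\<dots> = ennreal (real (Suc n)) * (ennreal h * (\<integral>\<^sup>+y. ennreal (y t) \<partial>\<rho>))"
      using h measurable_component_of_sets[OF \<rho>(2), of t]
      by (subst nn_integral_cmult[symmetric]) (auto simp: ennreal_mult')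
    also have "\<dots> = (\<integral>\<^sup>+y. ennreal (y t) \<partial>\<rho>)"
    proof -
      have "ennreal (real (Suc n)) * ennreal h = 1"
        unfolding h_def by (simp flip: ennreal_mult ennreal_1 del: of_nat_Suc)
      then show ?thesis by (simp add: mult.assoc[symmetric])
    qed
    finally show ?thesis by (simp add: h_def)
  qed
  then have "liminf (\<lambda>n. ennreal (real (Suc n) * (\<integral>y. 1 - exp (- (1 / real (Suc n) * y t)) \<partial>R)))
      \<le> liminf (\<lambda>n. \<integral>\<^sup>+y. ennreal (y t) \<partial>\<rho>)"
    by (intro Liminf_mono always_eventually) auto
  then have "liminf (\<lambda>n. ennreal (real (Suc n) * (\<integral>y. 1 - exp (- (1 / real (Suc n) * y t)) \<partial>R)))
      \<le> (\<integral>\<^sup>+y. ennreal (y t) \<partial>\<rho>)"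
    by (simp only: Liminf_const[OF sequentially_bot])
  moreover have "(\<integral>\<^sup>+y. ennreal (y t) \<partial>R)
      \<le> liminf (\<lambda>n. ennreal (real (Suc n) * (\<integral>y. 1 - exp (- (1 / real (Suc n) * y t)) \<partial>R)))"
    by (rule nn_integral_component_le_liminf[OF R(2)]) (rule int[OF R.finite_measure_axioms R(2)])
  ultimately show ?thesis by (rule order_trans[rotated])
qed

text \<open>Convergence of the random series holds coordinatewise almost surely because the means are summable.\<close>

lemma independent_series_exists:
  fixes R :: "nat \<Rightarrow> ('t \<Rightarrow> real) measure"
  assumes prob: "\<And>k. prob_space (R k)" and sets: "\<And>k. sets (R k) = sets cyl_nonneg"
    and means: "\<And>t. (\<Sum>k. \<integral>\<^sup>+y. ennreal (y t) \<partial>R k) < \<infinity>"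
  obtains Q where "prob_space Q" "sets Q = sets cyl_nonneg"
    "\<And>g. g \<in> nonneg_combs \<Longrightarrow> (\<lambda>n. \<Prod>k<n. laplace (R k) g) \<longlonglongrightarrow> laplace Q g"
proof -
  interpret R: product_prob_space R UNIV
    by (rule product_prob_spaceI) (rule prob)
  let ?\<Omega> = "PiM UNIV R"
  have cm [measurable]: "(\<lambda>\<omega>. \<omega> k t) \<in> borel_measurable ?\<Omega>" for k t
    using measurable_compose[OF measurable_component_singleton[of k UNIV R] measurable_component_of_sets[OF sets[of k]]]
    by auto
  have nn: "0 \<le> \<omega> k t" if "\<omega> \<in> space ?\<Omega>" for \<omega> k t
    using that by (auto simp: space_PiM PiE_iff space_eq_cyl_nonneg[OF sets] space_cyl_nonneg)
  define X where "X \<omega> t = enn2real (\<Sum>k. ennreal (\<omega> k t))" for \<omega> :: "nat \<Rightarrow> 't \<Rightarrow> real" and t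
  have X_meas: "X \<in> measurable ?\<Omega> cyl_nonneg"
    by (rule measurable_into_cyl_nonneg) (auto simp: X_def)
  have X_lim: "AE \<omega> in ?\<Omega>. (\<lambda>n. path_sum n \<omega> t) \<longlonglongrightarrow> X \<omega> t" for t
  proof -
    have "(\<integral>\<^sup>+\<omega>. (\<Sum>k. ennreal (\<omega> k t)) \<partial>?\<Omega>) = (\<Sum>k. \<integral>\<^sup>+\<omega>. ennreal (\<omega> k t) \<partial>?\<Omega>)"
      by (rule nn_integral_suminf) measurable
    also have "\<dots> = (\<Sum>k. \<integral>\<^sup>+y. ennreal (y t) \<partial>R k)"
    proof (intro suminf_cong)
      fix k
      have "(\<integral>\<^sup>+y. ennreal (y t) \<partial>R k) = (\<integral>\<^sup>+y. ennreal (y t) \<partial>distr ?\<Omega> (R k) (\<lambda>\<omega>. \<omega> k))"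
        by (simp add: distr_PiM_component prob)
      also have "\<dots> = (\<integral>\<^sup>+\<omega>. ennreal (\<omega> k t) \<partial>?\<Omega>)"
        using measurable_component_of_sets[OF sets[of k], of t] by (subst nn_integral_distr) auto
      finally show "(\<integral>\<^sup>+\<omega>. ennreal (\<omega> k t) \<partial>?\<Omega>) = (\<integral>\<^sup>+y. ennreal (y t) \<partial>R k)" by simp
    qed
    finally have "(\<integral>\<^sup>+\<omega>. (\<Sum>k. ennreal (\<omega> k t)) \<partial>?\<Omega>) \<noteq> \<infinity>"
      using means[of t] by simp
    then have "AE \<omega> in ?\<Omega>. (\<Sum>k. ennreal (\<omega> k t)) \<noteq> \<infinity>"
      by (intro nn_integral_PInf_AE) measurable
    then show ?thesis
      using AE_space
    proof eventually_elim
      case (elim \<omega>)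
      have "(\<lambda>n. \<Sum>k<n. ennreal (\<omega> k t)) \<longlonglongrightarrow> (\<Sum>k. ennreal (\<omega> k t))"
        by (rule summable_LIMSEQ) simp
      then have "(\<lambda>n. ennreal (path_sum n \<omega> t)) \<longlonglongrightarrow> ennreal (X \<omega> t)"
        using elim nn by (simp add: X_def path_sum_def sum_ennreal ennreal_enn2real_if less_top)
      then show ?case
        using nn[OF elim(2)] by (subst (asm) tendsto_ennreal_iff) (auto simp: path_sum_def X_def intro!: always_eventually sum_nonneg)
    qed
  qed
  define Q where "Q = distr ?\<Omega> cyl_nonneg X"
  have "(\<lambda>n. \<Prod>k<n. laplace (R k) g) \<longlonglongrightarrow> laplace Q g" if g: "g \<in> nonneg_combs" for g
  proof -
    have gm: "g \<in> borel_measurable cyl_nonneg"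
      by (rule nonneg_combs_measurable_of_sets[OF g refl])
    have psm: "path_sum n \<in> measurable ?\<Omega> cyl_nonneg" for n
      by (rule measurable_path_sum[OF sets]) simp
    have [measurable]: "(\<lambda>\<omega>. g (path_sum n \<omega>)) \<in> borel_measurable ?\<Omega>" "(\<lambda>\<omega>. g (X \<omega>)) \<in> borel_measurable ?\<Omega>" for n
      using measurable_compose[OF psm gm] measurable_compose[OF X_meas gm] by auto
    have conv: "AE \<omega> in ?\<Omega>. (\<lambda>n. g (path_sum n \<omega>)) \<longlonglongrightarrow> g (X \<omega>)"
      using g
    proof induction
      case (add g a t)
      show ?case
        using add.IH X_lim[of t] by eventually_elim (auto intro!: tendsto_intros)
    qed simp
    have "(\<lambda>n. \<integral>\<omega>. exp (- g (path_sum n \<omega>)) \<partial>?\<Omega>) \<longlonglongrightarrow> (\<integral>\<omega>. exp (- g (X \<omega>)) \<partial>?\<Omega>)"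
    proof (rule integral_dominated_convergence[where w = "\<lambda>_. 1"])
      show "AE \<omega> in ?\<Omega>. (\<lambda>n. exp (- g (path_sum n \<omega>))) \<longlonglongrightarrow> exp (- g (X \<omega>))"
        using conv by eventually_elim (auto intro!: tendsto_intros)
      show "AE \<omega> in ?\<Omega>. norm (exp (- g (path_sum n \<omega>))) \<le> 1" for n
        using measurable_space[OF psm[of n]] nonneg_combs_nonneg_space[OF g] by (intro AE_I2) auto
    qed auto
    moreover have "(\<integral>\<omega>. exp (- g (path_sum n \<omega>)) \<partial>?\<Omega>) = (\<Prod>k<n. laplace (R k) g)" for n
    proof -
      have [measurable]: "g \<in> borel_measurable (R k)" for k
        by (rule nonneg_combs_measurable_of_sets[OF g sets])
      have "(\<integral>\<omega>. exp (- g (path_sum n \<omega>)) \<partial>?\<Omega>) = (\<integral>\<omega>. (\<Prod>k<n. exp (- g (restrict \<omega> {..<n} k))) \<partial>?\<Omega>)"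
        by (intro Bochner_Integration.integral_cong)
           (simp_all add: comb_path_sum[OF g] exp_sum flip: sum_negf)
      also have "\<dots> = (\<integral>x. (\<Prod>k<n. exp (- g (x k))) \<partial>distr ?\<Omega> (PiM {..<n} R) (\<lambda>\<omega>. restrict \<omega> {..<n}))"
        by (subst integral_distr) auto
      also have "\<dots> = (\<integral>x. (\<Prod>k<n. exp (- g (x k))) \<partial>PiM {..<n} R)"
        by (subst R.distr_PiM_restrict_finite) auto
      also have "\<dots> = (\<Prod>k<n. laplace (R k) g)"
        by (rule R.product_integral_prod)
           (auto intro!: integrable_exp_neg_comb[OF _ sets g] prob_space.finite_measure prob)
      finally show ?thesis .
    qed
    moreover have "(\<integral>\<omega>. exp (- g (X \<omega>)) \<partial>?\<Omega>) = laplace Q g"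
      unfolding Q_def using gm by (subst integral_distr[OF X_meas]) auto
    ultimately show ?thesis by simp
  qed
  moreover have "prob_space Q"
    unfolding Q_def by (rule R.prob_space_distr[OF X_meas])
  ultimately show ?thesis
    using that[of Q] by (simp add: Q_def)
qed

text \<open>A \<open>\<sigma>\<close>-finite \<open>\<nu>\<close> is cut into countably many finite pieces, each of which has a compound Poisson law.
  The scalar u lets the same statement produce the convolution roots, with \<open>u = 1 / n\<close>.\<close>

theorem levy_realization:
  fixes \<nu> :: "('t \<Rightarrow> real) measure" and u :: real
  assumes "sigma_finite_measure \<nu>" and sets: "sets \<nu> = sets cyl_nonneg"
    and means: "\<And>t. (\<integral>\<^sup>+y. ennreal (y t) \<partial>\<nu>) < \<infinity>"
    and c: "\<And>t. 0 \<le> c t" and u: "0 \<le> u"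
    and int: "\<And>g. g \<in> nonneg_combs \<Longrightarrow> integrable \<nu> (\<lambda>y. 1 - exp (- g y))"
  obtains R where "prob_space R" "sets R = sets cyl_nonneg"
    "\<And>g. g \<in> nonneg_combs \<Longrightarrow> laplace R g = exp (u * (- g c - levy_exponent \<nu> g))"
proof -
  interpret sigma_finite_measure \<nu> by fact
  obtain D :: "nat \<Rightarrow> _ set" where D: "range D \<subseteq> sets \<nu>" "(\<Union>i. D i) = space \<nu>"
    "\<And>i. emeasure \<nu> (D i) \<noteq> \<infinity>" "disjoint_family D"
    using sigma_finite_disjoint by blast
  have [measurable]: "D k \<in> sets \<nu>" for k using D(1) by auto
  have [measurable]: "(\<lambda>y. y t) \<in> borel_measurable \<nu>" for t
    by (rule measurable_component_of_sets[OF sets])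
  define \<rho> where "\<rho> k = density \<nu> (\<lambda>y. ennreal (u * indicator (D k) y))" for k
  have \<rho>_fin: "finite_measure (\<rho> k)" for k
  proof (rule finite_measureI)
    have "emeasure (\<rho> k) (space (\<rho> k)) = (\<integral>\<^sup>+y. ennreal u * indicator (D k) y \<partial>\<nu>)"
      unfolding \<rho>_def using u
      by (subst emeasure_density) (auto intro!: nn_integral_cong simp: indicator_def)
    also have "\<dots> = ennreal u * emeasure \<nu> (D k)"
      by (simp add: nn_integral_cmult)
    finally show "emeasure (\<rho> k) (space (\<rho> k)) \<noteq> \<infinity>"
      using D(3)[of k] by (simp add: ennreal_mult_eq_top_iff)
  qed
  have \<rho>_sets: "sets (\<rho> k) = sets cyl_nonneg" for k by (simp add: \<rho>_def sets)
  have "\<exists>R. prob_space R \<and> sets R = sets cyl_nonneg \<and>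
      (\<forall>g\<in>nonneg_combs. laplace R g = exp (- levy_exponent (\<rho> k) g))" for k
    using compound_poisson_exists[OF \<rho>_fin[of k] \<rho>_sets[of k]] by metis
  then obtain C where C: "prob_space (C k)" "sets (C k) = sets cyl_nonneg"
    "\<And>g. g \<in> nonneg_combs \<Longrightarrow> laplace (C k) g = exp (- levy_exponent (\<rho> k) g)" for k
    by metis
  define d where "d = (\<lambda>t. u * c t)"
  have d: "d \<in> space cyl_nonneg" using c u by (simp add: d_def space_cyl_nonneg)
  \<comment> \<open>The drift enters as a deterministic first summand.\<close>
  define T where "T k = (case k of 0 \<Rightarrow> return cyl_nonneg d | Suc k \<Rightarrow> C k)" for k
  have T: "prob_space (T k)" "sets (T k) = sets cyl_nonneg" for k
    using C d by (auto simp: T_def prob_space_return split: nat.split)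
  have "(\<Sum>k. \<integral>\<^sup>+y. ennreal (y t) \<partial>T k) < \<infinity>" for t
  proof -
    have [measurable]: "(\<lambda>y. y t) \<in> borel_measurable cyl_nonneg"
      by (rule measurable_cyl_nonneg_component)
    have "(\<Sum>k. \<integral>\<^sup>+y. ennreal (y t) \<partial>T k) = (\<integral>\<^sup>+y. ennreal (y t) \<partial>T 0) + (\<Sum>k. \<integral>\<^sup>+y. ennreal (y t) \<partial>C k)"
      by (subst suminf_offset[of _ 1]) (simp_all add: T_def)
    also have "(\<integral>\<^sup>+y. ennreal (y t) \<partial>T 0) = ennreal (d t)"
      using d by (simp add: T_def nn_integral_return)
    also have "(\<Sum>k. \<integral>\<^sup>+y. ennreal (y t) \<partial>C k) \<le> (\<Sum>k. \<integral>\<^sup>+y. ennreal (y t) \<partial>\<rho> k)"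
      by (intro suminf_le nn_integral_component_le_of_laplace C \<rho>_fin \<rho>_sets) simp_all
    also have "(\<Sum>k. \<integral>\<^sup>+y. ennreal (y t) \<partial>\<rho> k) = (\<Sum>k. \<integral>\<^sup>+y. ennreal u * ennreal (y t) * indicator (D k) y \<partial>\<nu>)"
      unfolding \<rho>_def using u
      by (subst nn_integral_density) (auto intro!: suminf_cong nn_integral_cong simp: indicator_def)
    also have "\<dots> = (\<integral>\<^sup>+y. (\<Sum>k. ennreal u * ennreal (y t) * indicator (D k) y) \<partial>\<nu>)"
      by (rule nn_integral_suminf[symmetric]) measurable
    also have "\<dots> = (\<integral>\<^sup>+y. ennreal u * ennreal (y t) \<partial>\<nu>)"
    proof (rule nn_integral_cong)
      fix y assume "y \<in> space \<nu>"
      then obtain k where "y \<in> D k" using D(2) by blast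
      then show "(\<Sum>k. ennreal u * ennreal (y t) * indicator (D k) y) = ennreal u * ennreal (y t)"
        by (rule suminf_cmult_indicator[OF D(4)])
    qed
    also have "\<dots> = ennreal u * (\<integral>\<^sup>+y. ennreal (y t) \<partial>\<nu>)"
      by (rule nn_integral_cmult) measurable
    finally have "(\<Sum>k. \<integral>\<^sup>+y. ennreal (y t) \<partial>T k) \<le> ennreal (d t) + ennreal u * (\<integral>\<^sup>+y. ennreal (y t) \<partial>\<nu>)"
      by (simp add: add_left_mono)
    also have "\<dots> < \<infinity>" using means[of t] by (simp add: ennreal_mult_less_top)
    finally show ?thesis .
  qed
  from independent_series_exists[of T, OF T this] obtain R where R: "prob_space R" "sets R = sets cyl_nonneg"
    "\<And>g. g \<in> nonneg_combs \<Longrightarrow> (\<lambda>n. \<Prod>k<n. laplace (T k) g) \<longlonglongrightarrow> laplace R g"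
    by blast
  have "laplace R g = exp (u * (- g c - levy_exponent \<nu> g))" if g: "g \<in> nonneg_combs" for g
  proof -
    have [measurable]: "g \<in> borel_measurable \<nu>" "g \<in> borel_measurable cyl_nonneg"
      using nonneg_combs_measurable_of_sets[OF g] sets by auto
    define f where "f y = 1 - exp (- g y)" for y
    have f_int: "integrable \<nu> f" unfolding f_def by (rule int[OF g])
    have f_meas [measurable]: "f \<in> borel_measurable \<nu>" using f_int by simp
    have \<rho>_int: "levy_exponent (\<rho> k) g = u * (\<integral>y. indicator (D k) y * f y \<partial>\<nu>)" for k
      unfolding \<rho>_def using u by (subst integral_density) (auto simp: f_def mult.assoc)
    have "(\<lambda>n. \<Sum>k<n. \<integral>y. indicator (D k) y * f y \<partial>\<nu>) \<longlonglongrightarrow> (\<integral>y. f y \<partial>\<nu>)"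
    proof -
      have f_ind: "integrable \<nu> (\<lambda>y. indicator (D k) y * f y)" for k
        using f_int by (rule Bochner_Integration.integrable_bound) (auto simp: indicator_def)
      have "(\<lambda>n. \<integral>y. (\<Sum>k<n. indicator (D k) y * f y) \<partial>\<nu>) \<longlonglongrightarrow> (\<integral>y. f y \<partial>\<nu>)"
      proof (rule integral_dominated_convergence[where w = "\<lambda>y. \<bar>f y\<bar>"])
        have *: "(\<Sum>k<n. indicator (D k) y * f y) = (if j < n then f y else 0)" if "y \<in> D j" for j n y
        proof -
          have "indicator (D k) y * f y = (if k = j then f y else 0)" for k
            using that D(4) by (auto simp: indicator_def disjoint_family_on_def)
          then show ?thesis by simp
        qed
        show "AE y in \<nu>. norm (\<Sum>k<n. indicator (D k) y * f y) \<le> \<bar>f y\<bar>" for n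
        proof (rule AE_I2)
          fix y assume "y \<in> space \<nu>"
          then obtain j where "y \<in> D j" using D(2) by blast
          then show "norm (\<Sum>k<n. indicator (D k) y * f y) \<le> \<bar>f y\<bar>" using *[of y j n] by simp
        qed
        show "AE y in \<nu>. (\<lambda>n. \<Sum>k<n. indicator (D k) y * f y) \<longlonglongrightarrow> f y"
        proof (rule AE_I2)
          fix y assume "y \<in> space \<nu>"
          then obtain j where j: "y \<in> D j" using D(2) by blast
          show "(\<lambda>n. \<Sum>k<n. indicator (D k) y * f y) \<longlonglongrightarrow> f y"
            unfolding *[OF j]
            by (rule tendsto_eventually) (auto simp: eventually_sequentially intro!: exI[of _ "Suc j"])
        qed
        show "(\<lambda>y. \<Sum>k<n. indicator (D k) y * f y) \<in> borel_measurable \<nu>" for n by measurable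
      qed (use f_int in auto)
      then show ?thesis
        by (simp only: Bochner_Integration.integral_sum[OF f_ind])
    qed
    then have "(\<lambda>n. exp (- (u * g c) - (\<Sum>k<n. u * (\<integral>y. indicator (D k) y * f y \<partial>\<nu>))))
        \<longlonglongrightarrow> exp (- (u * g c) - u * (\<integral>y. f y \<partial>\<nu>))"
      by (auto intro!: tendsto_intros simp flip: sum_distrib_left)
    moreover have "(\<Prod>k<Suc n. laplace (T k) g)
        = exp (- (u * g c) - (\<Sum>k<n. u * (\<integral>y. indicator (D k) y * f y \<partial>\<nu>)))" for n
    proof -
      have "(\<Prod>k<Suc n. laplace (T k) g) = laplace (T 0) g * (\<Prod>k<n. laplace (C k) g)"
        by (subst prod.lessThan_Suc_shift) (simp add: T_def)
      also have "laplace (T 0) g = exp (- (u * g c))"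
        using d by (simp add: T_def integral_return d_def nonneg_combs_homogeneous[OF g])
      also have "(\<Prod>k<n. laplace (C k) g) = exp (- (\<Sum>k<n. u * (\<integral>y. indicator (D k) y * f y \<partial>\<nu>)))"
        by (simp add: C(3)[OF g] \<rho>_int exp_sum flip: sum_negf)
      finally show ?thesis by (simp flip: exp_add)
    qed
    ultimately have "(\<lambda>n. \<Prod>k<Suc n. laplace (T k) g) \<longlonglongrightarrow> exp (- (u * g c) - u * (\<integral>y. f y \<partial>\<nu>))"
      by simp
    from LIMSEQ_unique[OF LIMSEQ_Suc[OF R(3)[OF g]] this]
    show ?thesis by (simp add: f_def algebra_simps)
  qed
  then show ?thesis using that R(1,2) by blast
qed

section \<open>Convolution roots\<close>

lemma prob_space_conv_power:
  assumes "prob_space R" "sets R = sets cyl_nonneg"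
  shows "prob_space (conv_power n R)"
proof -
  have "prob_space (PiM {..<n} (\<lambda>_. R))"
    by (rule prob_space_PiM) (rule assms(1))
  then show ?thesis
    unfolding conv_power_def
    by (rule prob_space.prob_space_distr) (intro measurable_path_sum assms(2) subset_refl)
qed

context separated_size_biased_family
begin

text \<open>The sets \<open>E k j\<close>, on which \<open>y (s k)\<close> stays away from 0, have finite measure because \<open>y (s k)\<close> is
  integrable; together with a null set they cover the space.\<close>

lemma sigma_finite_levy: "sigma_finite_measure levy"
proof
  have [measurable]: "(\<lambda>y. y t) \<in> borel_measurable levy" for t
    by (rule measurable_component_of_sets) simp
  have [measurable]: "(\<lambda>y. y t) \<in> borel_measurable cyl_nonneg" for t
    by (rule measurable_cyl_nonneg_component)
  define E where "E k j = {y \<in> space cyl_nonneg. 1 / real (Suc j) \<le> y (s k)}" for k j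
  define N where "N = space cyl_nonneg - (\<Union>k. first_positive s k)"
  have E_sets: "E k j \<in> sets levy" for k j
    unfolding E_def by simp
  have N_sets: "N \<in> sets levy"
    unfolding N_def using UN_first_positive_sets by auto
  have E_fin: "emeasure levy (E k j) < \<infinity>" for k j
  proof -
    have "emeasure levy (E k j) = (\<integral>\<^sup>+y. indicator (E k j) y \<partial>levy)"
      using E_sets by simp
    also have "\<dots> \<le> (\<integral>\<^sup>+y. ennreal (real (Suc j)) * ennreal (y (s k)) \<partial>levy)"
    proof (rule nn_integral_mono)
      fix y
      have "1 \<le> real (Suc j) * y (s k)" if "1 / real (Suc j) \<le> y (s k)"
        using that by (simp add: field_simps)
      then show "indicator (E k j) y \<le> ennreal (real (Suc j)) * ennreal (y (s k))"
        unfolding E_def indicator_def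
        by (simp add: ennreal_mult'[symmetric] ennreal_leI flip: ennreal_1 del: of_nat_Suc)
    qed
    also have "\<dots> = ennreal (real (Suc j)) * (\<integral>\<^sup>+y. ennreal (y (s k)) \<partial>levy)"
      by (rule nn_integral_cmult) measurable
    also have "\<dots> < \<infinity>"
      using nn_integral_levy_component[of "s k"] by (simp add: ennreal_mult_less_top)
    finally show ?thesis .
  qed
  have "emeasure levy N = 0"
    using AE_levy_support N_sets
    by (subst AE_iff_null_sets[THEN iffD2, THEN null_setsD1]) (auto elim!: eventually_mono simp: N_def)
  moreover have "\<Union> (insert N (range (\<lambda>(k, j). E k j))) = space levy"
  proof -
    have "y \<in> (\<Union>k j. E k j) \<union> N" if y: "y \<in> space cyl_nonneg" for y
    proof (cases "\<exists>k. y (s k) \<noteq> 0")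
      case True
      then obtain k where "y (s k) \<noteq> 0" by blast
      then have "0 < y (s k)" using y by (simp add: space_cyl_nonneg less_le)
      then obtain j where "inverse (real (Suc j)) < y (s k)"
        using reals_Archimedean by blast
      then have "y \<in> E k j" using y by (simp add: E_def divide_inverse)
      then show ?thesis by blast
    next
      case False
      then show ?thesis using y by (simp add: N_def UN_first_positive)
    qed
    then show ?thesis
      by (fastforce simp: space_eq_cyl_nonneg[OF sets_levy] E_def N_def)
  qed
  ultimately show "\<exists>A. countable A \<and> A \<subseteq> sets levy \<and> \<Union> A = space levy \<and> (\<forall>a\<in>A. emeasure levy a \<noteq> \<infinity>)"
    using E_fin E_sets N_sets
    by (intro exI[of _ "insert N (range (\<lambda>(k, j). E k j))"]) (auto simp: less_top)
qed

theorem convolution_root: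
  assumes n: "1 \<le> (n::nat)"
  obtains R where "prob_space R" "sets R = sets cyl_nonneg" "conv_power n R = P"
proof -
  have lev: "integrable levy (\<lambda>y. 1 - exp (- g y))"
      "laplace P g = exp (- g drift - levy_exponent levy g)"
    if "g \<in> nonneg_combs" for g
    using laplace_levy_levy that unfolding laplace_levy_def by auto
  obtain R where R: "prob_space R" "sets R = sets cyl_nonneg"
    "\<And>g. g \<in> nonneg_combs \<Longrightarrow>
      laplace R g = exp (1 / real n * (- g drift - levy_exponent levy g))"
    by (rule levy_realization[OF sigma_finite_levy sets_levy nn_integral_levy_component, of drift "1 / real n"])
       (use lev drift_nonneg in auto)
  have "conv_power n R = P"
  proof (rule laplace_unique)
    fix g :: "('t \<Rightarrow> real) \<Rightarrow> real" assume g: "g \<in> nonneg_combs"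
    show "laplace (conv_power n R) g = laplace P g"
      using n laplace_conv_power[OF prob_space.finite_measure[OF R(1)] R(2) g, of n]
      by (simp add: R(3)[OF g] lev(2)[OF g] flip: exp_of_nat_mult)
  qed (use R prob_space_conv_power[OF R(1,2)] in \<open>auto intro: prob_space.finite_measure simp: sets_P prob_P\<close>)
  then show ?thesis using that R by blast
qed

end

text \<open>Setting a path to zero off J keeps it in the same path space, so that finite-dimensional
  distributions need no separate treatment.\<close>

definition truncate :: "'t set \<Rightarrow> ('t \<Rightarrow> real) \<Rightarrow> 't \<Rightarrow> real" where
  "truncate J y = (\<lambda>t. if t \<in> J then y t else 0)"

lemma comb_truncate: "g \<in> nonneg_combs \<Longrightarrow> (\<lambda>y. g (truncate J y)) \<in> nonneg_combs"
proof (induction rule: nonneg_combs.induct)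
  case (add g a t)
  then show ?case
    using nonneg_combs.add[OF add.IH add.hyps(2), of t] by (cases "t \<in> J") (auto simp: truncate_def)
qed (rule nonneg_combs.zero)

lemma measurable_truncate:
  assumes "sets \<mu> = sets cyl_nonneg"
  shows "truncate J \<in> measurable \<mu> cyl_nonneg"
proof (rule measurable_into_cyl_nonneg)
  have [measurable]: "(\<lambda>y. y t) \<in> borel_measurable \<mu>" for t
    by (rule measurable_component_of_sets[OF assms])
  show "(\<lambda>y. truncate J y t) \<in> borel_measurable \<mu>" for t
    unfolding truncate_def by simp
qed (auto simp: truncate_def space_eq_cyl_nonneg[OF assms] space_cyl_nonneg)

context size_biased_family
begin

lemma size_biased_family_truncate:
  "size_biased_family (distr P cyl_nonneg (truncate J))
     (\<lambda>t. if t \<in> J then distr (m t) cyl_nonneg (truncate J) else null_measure cyl_nonneg)"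
proof (rule size_biased_family.intro)
  note tm = measurable_truncate[OF sets_P, of J] measurable_truncate[OF sets_m, of J]
  have [measurable]: "(\<lambda>y. y t) \<in> borel_measurable cyl_nonneg" for t
    by (rule measurable_cyl_nonneg_component)
  show "prob_space (distr P cyl_nonneg (truncate J))"
    by (rule P.prob_space_distr[OF tm(1)])
  show "integrable (distr P cyl_nonneg (truncate J)) (\<lambda>y. y t)" for t
  proof -
    have "integrable P (\<lambda>y. truncate J y t)"
      using integrable_P[of t] by (cases "t \<in> J") (simp_all add: truncate_def)
    then show ?thesis
      by (subst integrable_distr_eq[OF tm(1)]) simp_all
  qed
  show "finite_measure (if t \<in> J then distr (m t) cyl_nonneg (truncate J) else null_measure cyl_nonneg)" for t
    using m.finite_measure_distr[OF tm(2)] by (auto intro: finite_measureI)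
  fix t g assume g: "g \<in> (nonneg_combs :: (('t \<Rightarrow> real) \<Rightarrow> real) set)"
  have [measurable]: "g \<in> borel_measurable cyl_nonneg"
    by (rule nonneg_combs_measurable_of_sets[OF g refl])
  have 1: "(\<integral>y. y t * exp (- g y) \<partial>distr P cyl_nonneg (truncate J)) = (\<integral>y. truncate J y t * exp (- g (truncate J y)) \<partial>P)"
    by (rule integral_distr[OF tm(1)]) measurable
  have 2: "laplace (distr K cyl_nonneg (truncate J)) g = (\<integral>y. exp (- g (truncate J y)) \<partial>K)"
    if "sets K = sets cyl_nonneg" for K
    by (rule integral_distr[OF measurable_truncate[OF that]]) measurable
  show "(\<integral>y. y t * exp (- g y) \<partial>distr P cyl_nonneg (truncate J)) = laplace (distr P cyl_nonneg (truncate J)) g *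
      laplace ((if t \<in> J then distr (m t) cyl_nonneg (truncate J) else null_measure cyl_nonneg)) g"
    using bias[OF comb_truncate[OF g, of J], of t]
    by (cases "t \<in> J") (simp_all add: 1 2[OF sets_P] 2[OF sets_m], simp_all add: truncate_def)
qed (simp_all add: sets_m)

text \<open>For the truncated family an enumeration of J is trivially separating.\<close>

lemma convolution_root_truncate:
  assumes J: "finite J" "J \<noteq> {}" and n: "1 \<le> (n::nat)"
  obtains R where "prob_space R" "sets R = sets cyl_nonneg" "conv_power n R = distr P cyl_nonneg (truncate J)"
proof -
  let ?m = "\<lambda>t. if t \<in> J then distr (m t) cyl_nonneg (truncate J) else null_measure cyl_nonneg"
  interpret T: size_biased_family "distr P cyl_nonneg (truncate J)" ?m
    by (rule size_biased_family_truncate)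
  have rng: "range (from_nat_into J) = J"
    using J by (intro range_from_nat_into) (auto intro: countable_finite)
  interpret T: separated_size_biased_family "distr P cyl_nonneg (truncate J)" ?m "from_nat_into J"
  proof
    fix t :: 't
    show "AE y in ?m t. (\<forall>k. y (from_nat_into J k) = 0) \<longrightarrow> y t = 0"
    proof (cases "t \<in> J")
      case True
      then obtain k where "t = from_nat_into J k" using rng by blast
      then show ?thesis by (intro AE_I2) auto
    next
      case False
      then show ?thesis by (intro AE_I[of _ _ "space cyl_nonneg"]) auto
    qed
  qed
  show ?thesis using T.convolution_root[OF n] that by blast
qed

end

section \<open>Laws of nonnegative processes\<close>

locale nonneg_process = prob_space M for M :: "'w measure" +
  fixes Y :: "'t \<Rightarrow> 'w \<Rightarrow> real"
  assumes process: "process M Y" and nonneg: "\<And>t. AE \<omega> in M. 0 \<le> Y t \<omega>"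
begin

lemma measurable_Y [measurable]: "Y t \<in> borel_measurable M"
  using process by (simp add: process_def)

lemma measurable_path: "(\<lambda>\<omega> t. max 0 (Y t \<omega>)) \<in> measurable M cyl_nonneg"
  by (rule measurable_into_cyl_nonneg) auto

lemma sets_law [simp]: "sets (law_nonneg M Y) = sets cyl_nonneg"
  by (simp add: law_nonneg_def)

lemma prob_space_law: "prob_space (law_nonneg M Y)"
  unfolding law_nonneg_def by (rule prob_space_distr[OF measurable_path])

lemma AE_comb_eq:
  assumes "g \<in> nonneg_combs"
  shows "AE \<omega> in M. g (\<lambda>t. max 0 (Y t \<omega>)) = g (\<lambda>t. Y t \<omega>)"
proof (rule nonneg_combs_AE_cong[OF assms])
  show "AE \<omega> in M. max 0 (Y t \<omega>) = Y t \<omega>" for t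
    using nonneg[of t] by eventually_elim simp
qed

lemma AE_comb_nonneg:
  assumes "g \<in> nonneg_combs"
  shows "AE \<omega> in M. 0 \<le> g (\<lambda>t. Y t \<omega>)"
  using AE_comb_eq[OF assms] by eventually_elim (metis max.cobounded1 nonneg_combs_nonneg[OF assms])

lemma measurable_comb [measurable (raw)]:
  "g \<in> nonneg_combs \<Longrightarrow> (\<lambda>\<omega>. g (\<lambda>t. Y t \<omega>)) \<in> borel_measurable M"
  by (erule nonneg_combs_measurable) simp

lemma integrable_exp_comb:
  assumes "g \<in> nonneg_combs"
  shows "integrable M (\<lambda>\<omega>. exp (- g (\<lambda>t. Y t \<omega>)))"
  using AE_comb_nonneg[OF assms] measurable_comb[OF assms]
  by (intro integrable_const_bound[of _ 1]) (auto elim: eventually_mono)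

lemma laplace_law:
  assumes g: "g \<in> nonneg_combs"
  shows "laplace (law_nonneg M Y) g = (\<integral>\<omega>. exp (- g (\<lambda>t. Y t \<omega>)) \<partial>M)"
proof -
  have gm: "g \<in> borel_measurable cyl_nonneg"
    by (rule nonneg_combs_measurable_of_sets[OF g refl])
  note [measurable] = measurable_comb[OF g] measurable_compose[OF measurable_path gm]
  have "laplace (law_nonneg M Y) g = (\<integral>\<omega>. exp (- g (\<lambda>t. max 0 (Y t \<omega>))) \<partial>M)"
    unfolding law_nonneg_def using gm by (intro integral_distr measurable_path) auto
  also have "\<dots> = (\<integral>\<omega>. exp (- g (\<lambda>t. Y t \<omega>)) \<partial>M)"
    using AE_comb_eq[OF g] by (intro integral_cong_AE) (auto elim: eventually_mono)
  finally show ?thesis .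
qed

lemma weighted_laplace_law:
  assumes g: "g \<in> nonneg_combs"
  shows "(\<integral>y. y t * exp (- g y) \<partial>law_nonneg M Y) = (\<integral>\<omega>. Y t \<omega> * exp (- g (\<lambda>t. Y t \<omega>)) \<partial>M)"
proof -
  have gm: "g \<in> borel_measurable cyl_nonneg"
    by (rule nonneg_combs_measurable_of_sets[OF g refl])
  have [measurable]: "(\<lambda>y. y t) \<in> borel_measurable cyl_nonneg"
    by (rule measurable_cyl_nonneg_component)
  note [measurable] = measurable_comb[OF g] measurable_compose[OF measurable_path gm]
  have "(\<integral>y. y t * exp (- g y) \<partial>law_nonneg M Y) = (\<integral>\<omega>. max 0 (Y t \<omega>) * exp (- g (\<lambda>t. max 0 (Y t \<omega>))) \<partial>M)"
    unfolding law_nonneg_def using gm by (intro integral_distr measurable_path) auto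
  also have "\<dots> = (\<integral>\<omega>. Y t \<omega> * exp (- g (\<lambda>t. Y t \<omega>)) \<partial>M)"
    using AE_comb_eq[OF g] nonneg[of t] by (intro integral_cong_AE) (auto elim: eventually_elim2)
  finally show ?thesis .
qed

lemma integrable_law:
  assumes "integrable M (Y t)"
  shows "integrable (law_nonneg M Y) (\<lambda>y. y t)"
proof -
  have "integrable M (\<lambda>\<omega>. max 0 (Y t \<omega>))" using assms by simp
  then show ?thesis
    unfolding law_nonneg_def
    by (subst integrable_distr_eq[OF measurable_path measurable_cyl_nonneg_component])
qed

lemma levy_characteristics_iff:
  "levy_characteristics M Y \<nu> c \<longleftrightarrow>
     levy_measure \<nu> \<and> (\<forall>t. 0 \<le> c t) \<and> laplace_levy (law_nonneg M Y) \<nu> c"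
proof (intro iffI conjI)
  assume L: "levy_characteristics M Y \<nu> c"
  then show "levy_measure \<nu>" "\<forall>t. 0 \<le> c t"
    by (auto simp: levy_characteristics_def)
  show "laplace_levy (law_nonneg M Y) \<nu> c"
    unfolding laplace_levy_def
  proof (intro ballI)
    fix g :: "('t \<Rightarrow> real) \<Rightarrow> real" assume g: "g \<in> nonneg_combs"
    from g obtain n :: nat and t \<alpha> where *: "1 \<le> n" "\<forall>i<n. 0 \<le> \<alpha> i" "g = (\<lambda>y. \<Sum>i<n. \<alpha> i * y (t i))"
      by (rule nonneg_combsE)
    show "integrable \<nu> (\<lambda>y. 1 - exp (- g y)) \<and>
      laplace (law_nonneg M Y) g = exp (- g c - levy_exponent \<nu> g)"
      unfolding laplace_law[OF g] using L * unfolding levy_characteristics_def by blast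
  qed
next
  assume R: "levy_measure \<nu> \<and> (\<forall>t. 0 \<le> c t) \<and> laplace_levy (law_nonneg M Y) \<nu> c"
  show "levy_characteristics M Y \<nu> c"
    unfolding levy_characteristics_def
  proof (intro conjI allI impI)
    fix n :: nat and t :: "nat \<Rightarrow> 't" and \<alpha> :: "nat \<Rightarrow> real"
    assume "1 \<le> n" and a: "\<forall>i<n. 0 \<le> \<alpha> i"
    note g = nonneg_combs_sum[OF a, of t]
    show "integrable \<nu> (\<lambda>y. 1 - exp (- (\<Sum>i<n. \<alpha> i * y (t i))))"
      and "(\<integral>\<omega>. exp (- (\<Sum>i<n. \<alpha> i * Y (t i) \<omega>)) \<partial>M) =
          exp (- (\<Sum>i<n. \<alpha> i * c (t i)) - (\<integral>y. 1 - exp (- (\<Sum>i<n. \<alpha> i * y (t i))) \<partial>\<nu>))"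
      using R g laplace_law[OF g] unfolding laplace_levy_def by auto
  qed (use R in auto)
qed

text \<open>A convolution root of the truncated law of \<open>Y\<close> is restricted to J; restriction commutes with sums.\<close>

theorem inf_divisible_of_size_biased_family:
  assumes "size_biased_family (law_nonneg M Y) m"
  shows "inf_divisible_process M Y"
  unfolding inf_divisible_process_def inf_divisible_law_def
proof (intro allI impI)
  fix J :: "'t set" and n :: nat
  assume J: "finite J" and n: "1 \<le> n"
  interpret F: size_biased_family "law_nonneg M Y" m by fact
  let ?B = "PiM J (\<lambda>_. borel :: real measure)"
  \<comment> \<open>An arbitrary index is added because only a nonempty set can be enumerated.\<close>
  define J' where "J' = insert undefined J"
  obtain R where R: "prob_space R" "sets R = sets cyl_nonneg"
    "conv_power n R = distr (law_nonneg M Y) cyl_nonneg (truncate J')"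
    using F.convolution_root_truncate[of J' n] J n by (auto simp: J'_def)
  define f where "f = (\<lambda>y :: 't \<Rightarrow> real. restrict y J)"
  have f: "f \<in> measurable K ?B" if "sets K = sets cyl_nonneg" for K
    unfolding f_def restrict_def
    by (rule measurable_restrict[unfolded restrict_def]) (rule measurable_component_of_sets[OF that])
  define \<rho> where "\<rho> = distr R ?B f"
  have \<rho>_prob: "prob_space \<rho>" unfolding \<rho>_def by (rule prob_space.prob_space_distr[OF R(1) f[OF R(2)]])
  have \<rho>_sets [measurable_cong]: "sets \<rho> = sets ?B" by (simp add: \<rho>_def)
  define S where "S = (\<lambda>x :: nat \<Rightarrow> 't \<Rightarrow> real. \<lambda>t\<in>J. \<Sum>i<n. x i t)"
  have comp\<rho>: "(\<lambda>x. x i t) \<in> borel_measurable (PiM {..<n} (\<lambda>_. \<rho>))" if "t \<in> J" "i < n" for t i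
    using measurable_compose[OF measurable_component_singleton[of i "{..<n}" "\<lambda>_. \<rho>"], of "\<lambda>y. y t" borel]
      measurable_component_singleton[OF that(1), of "\<lambda>_. borel :: real measure"] that(2)
    by (simp add: measurable_cong_sets[OF \<rho>_sets refl])
  have S: "S \<in> measurable (PiM {..<n} (\<lambda>_. \<rho>)) ?B"
    unfolding S_def by (intro measurable_restrict borel_measurable_sum comp\<rho>) auto
  have cf: "compose {..<n} f \<in> measurable (PiM {..<n} (\<lambda>_. R)) (PiM {..<n} (\<lambda>_. \<rho>))"
    unfolding compose_def
  proof (rule measurable_restrict)
    fix i assume "i \<in> {..<n}"
    then have "(\<lambda>x. x i) \<in> measurable (PiM {..<n} (\<lambda>_. R)) R" by (rule measurable_component_singleton)
    from measurable_compose[OF this f[OF R(2)]]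
    show "(\<lambda>x. f (x i)) \<in> measurable (PiM {..<n} (\<lambda>_. R)) \<rho>"
      by (simp add: measurable_cong_sets[OF refl \<rho>_sets])
  qed
  have ps: "path_sum n \<in> measurable (PiM {..<n} (\<lambda>_. R)) cyl_nonneg"
    by (rule measurable_path_sum[OF R(2)]) simp
  have "distr R \<rho> f = \<rho>"
    unfolding \<rho>_def by (rule distr_cong) simp_all
  then have "PiM {..<n} (\<lambda>_. \<rho>) = PiM {..<n} (\<lambda>_. distr R \<rho> f)"
    by (simp only:)
  also have "\<dots> = distr (PiM {..<n} (\<lambda>_. R)) (PiM {..<n} (\<lambda>_. \<rho>)) (compose {..<n} f)"
    using R(1) \<rho>_prob f[OF R(2)]
    by (intro distr_PiM_finite_prob_space'[symmetric]) (auto simp: measurable_cong_sets[OF refl \<rho>_sets])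
  finally have "distr (PiM {..<n} (\<lambda>_. \<rho>)) ?B S
      = distr (distr (PiM {..<n} (\<lambda>_. R)) (PiM {..<n} (\<lambda>_. \<rho>)) (compose {..<n} f)) ?B S"
    by simp
  also have "\<dots> = distr (PiM {..<n} (\<lambda>_. R)) ?B (S \<circ> compose {..<n} f)"
    by (rule distr_distr[OF S cf])
  also have "S \<circ> compose {..<n} f = f \<circ> path_sum n"
    by (auto simp: fun_eq_iff S_def f_def compose_def path_sum_def)
  also have "distr (PiM {..<n} (\<lambda>_. R)) ?B (f \<circ> path_sum n) = distr (conv_power n R) ?B f"
    unfolding conv_power_def by (rule distr_distr[symmetric, OF f[OF refl] ps])
  also have "\<dots> = distr (distr (law_nonneg M Y) cyl_nonneg (truncate J')) ?B f"
    by (simp add: R(3))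
  also have "\<dots> = distr (law_nonneg M Y) ?B (f \<circ> truncate J')"
    by (rule distr_distr[OF f[OF refl] measurable_truncate]) simp
  also have "f \<circ> truncate J' = f"
    by (auto simp: fun_eq_iff f_def truncate_def J'_def)
  also have "distr (law_nonneg M Y) ?B f = distr M ?B (f \<circ> (\<lambda>\<omega> t. max 0 (Y t \<omega>)))"
    unfolding law_nonneg_def by (rule distr_distr[OF f[OF refl] measurable_path])
  also have "\<dots> = fin_dim_law M Y J"
    unfolding fin_dim_law_def
  proof (rule distr_cong_AE)
    have "AE \<omega> in M. \<forall>t\<in>J. 0 \<le> Y t \<omega>"
      using nonneg J by (simp add: AE_finite_all)
    then show "AE \<omega> in M. (f \<circ> (\<lambda>\<omega> t. max 0 (Y t \<omega>))) \<omega> = (\<lambda>t\<in>J. Y t \<omega>)"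
      by eventually_elim (auto simp: f_def fun_eq_iff)
    show "f \<circ> (\<lambda>\<omega> t. max 0 (Y t \<omega>)) \<in> measurable M ?B"
      by (rule measurable_comp[OF measurable_path f[OF refl]])
    show "(\<lambda>\<omega>. \<lambda>t\<in>J. Y t \<omega>) \<in> measurable M ?B"
      by measurable
  qed simp_all
  finally have "fin_dim_law M Y J = distr (PiM {..<n} (\<lambda>_. \<rho>)) ?B S" by simp
  then show "\<exists>\<rho>. prob_space \<rho> \<and> sets \<rho> = sets ?B \<and>
      fin_dim_law M Y J = distr (PiM {..<n} (\<lambda>_. \<rho>)) ?B (\<lambda>x. \<lambda>t\<in>J. \<Sum>i<n. x i t)"
    using \<rho>_prob \<rho>_sets unfolding S_def by blast
qed

end

section \<open>The size-bias identity in terms of laws\<close>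

lemma measurable_comb_cyl:
  assumes "g \<in> nonneg_combs"
  shows "g \<in> borel_measurable cyl"
  by (rule nonneg_combs_measurable[OF assms, of "\<lambda>y. y"]) (rule measurable_cyl_component)

lemma laplace_indep_sum:
  assumes "prob_space N" and ind: "prob_space.indep_var N cyl (\<lambda>\<omega> t. A t \<omega>) cyl (\<lambda>\<omega> t. B t \<omega>)"
    and nonneg: "\<And>t. AE \<omega> in N. 0 \<le> A t \<omega>" "\<And>t. AE \<omega> in N. 0 \<le> B t \<omega>"
    and g: "g \<in> nonneg_combs"
  shows "(\<integral>\<omega>. exp (- g (\<lambda>t. A t \<omega> + B t \<omega>)) \<partial>N)
    = (\<integral>\<omega>. exp (- g (\<lambda>t. A t \<omega>)) \<partial>N) * (\<integral>\<omega>. exp (- g (\<lambda>t. B t \<omega>)) \<partial>N)"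
proof -
  interpret prob_space N by fact
  have rv: "(\<lambda>\<omega> t. A t \<omega>) \<in> measurable N cyl" "(\<lambda>\<omega> t. B t \<omega>) \<in> measurable N cyl"
    using indep_var_rv1[OF ind] indep_var_rv2[OF ind] by auto
  have meas: "A t \<in> borel_measurable N" "B t \<in> borel_measurable N" for t
    using measurable_compose[OF rv(1) measurable_cyl_component[of t]] measurable_compose[OF rv(2) measurable_cyl_component[of t]]
    by auto
  interpret A: nonneg_process N A
    by unfold_locales (use meas nonneg in \<open>auto simp: process_def\<close>)
  interpret B: nonneg_process N B
    by unfold_locales (use meas nonneg in \<open>auto simp: process_def\<close>)
  have gm: "(\<lambda>y. exp (- g y)) \<in> borel_measurable cyl"
    using measurable_comb_cyl[OF g] by measurable
  have "(\<integral>\<omega>. exp (- g (\<lambda>t. A t \<omega> + B t \<omega>)) \<partial>N) = (\<integral>\<omega>. exp (- g (\<lambda>t. A t \<omega>)) * exp (- g (\<lambda>t. B t \<omega>)) \<partial>N)"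
    by (simp add: nonneg_combs_additive[OF g] flip: exp_add)
  also have "\<dots> = (\<integral>\<omega>. exp (- g (\<lambda>t. A t \<omega>)) \<partial>N) * (\<integral>\<omega>. exp (- g (\<lambda>t. B t \<omega>)) \<partial>N)"
    using indep_var_compose[OF ind gm gm, unfolded comp_def]
    by (intro indep_var_lebesgue_integral A.integrable_exp_comb B.integrable_exp_comb g)
  finally show ?thesis .
qed

locale size_biased_process = nonneg_process M Y
  for M :: "'w measure" and Y :: "'t \<Rightarrow> 'w \<Rightarrow> real" +
  fixes s :: 't and N :: "'v measure" and \<pi> :: "'v \<Rightarrow> 'w" and Z :: "'t \<Rightarrow> 'v \<Rightarrow> real"
  assumes integrable_Y: "\<And>t. integrable M (Y t)"
    and size_bias: "size_bias M Y s N \<pi> Z"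
    and mean_pos: "0 < (\<integral>\<omega>. Y s \<omega> \<partial>M)"
begin

lemma extension: "prob_space N" "\<pi> \<in> measurable N M" "distr N M \<pi> = M"
  using size_bias by (auto simp: size_bias_def extension_of_def)

sublocale N: prob_space N by (rule extension(1))

lemma measurable_pi [measurable]: "\<pi> \<in> measurable N M" by (rule extension(2))

lemma measurable_Z [measurable]: "Z t \<in> borel_measurable N"
  using size_bias by (auto simp: size_bias_def process_def)

lemma indep: "N.indep_var cyl (\<lambda>\<omega> t. Y t (\<pi> \<omega>)) cyl (\<lambda>\<omega> t. Z t \<omega>)"
  using size_bias by (auto simp: size_bias_def)

lemma size_bias_integral:
  assumes "F \<in> borel_measurable cyl"
  shows "(\<integral>\<omega>. F (\<lambda>t. Y t (\<pi> \<omega>) + Z t \<omega>) \<partial>N)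
       = (\<integral>\<omega>. F (\<lambda>t. Y t \<omega>) * (inverse (\<integral>\<omega>. Y s \<omega> \<partial>M) * Y s \<omega>) \<partial>M)"
  using size_bias assms unfolding size_bias_def by blast

lemma integral_pi:
  assumes "f \<in> borel_measurable M"
  shows "(\<integral>\<omega>. f (\<pi> \<omega>) \<partial>N) = (\<integral>\<omega>. f \<omega> \<partial>M :: real)"
  using integral_distr[OF extension(2) assms] extension(3) by simp

lemma prob_pi:
  assumes "A \<in> sets M"
  shows "N.prob (\<pi> -` A \<inter> space N) = prob A"
  using measure_distr[OF extension(2) assms] extension(3) by simp

lemma AE_pi:
  assumes "AE \<omega> in M. Q \<omega>"
  shows "AE \<omega> in N. Q (\<pi> \<omega>)"
proof (rule AE_distrD[OF extension(2)])
  show "AE \<omega> in distr N M \<pi>. Q \<omega>" unfolding extension(3) by (rule assms)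
qed

text \<open>The law of \<open>Y + Z\<close> is absolutely continuous with respect to that of \<open>Y\<close>, so \<open>Y t + Z t\<close>
  does not fall below the essential infimum of \<open>Y t\<close>.  By independence it would do so with
  positive probability if \<open>Z t\<close> could be negative.  The essential infimum is approximated by a
  multiple \<open>k * \<epsilon>\<close> such that \<open>Y t\<close> falls below \<open>(k + 1) * \<epsilon>\<close> with positive probability, but almost
  surely not below \<open>k * \<epsilon>\<close>.\<close>

lemma AE_Z_nonneg: "AE \<omega> in N. 0 \<le> Z t \<omega>"
proof -
  have no_neg: "AE \<omega> in N. - \<epsilon> \<le> Z t \<omega>" if \<epsilon>: "0 < \<epsilon>" for \<epsilon>
  proof -
    have ex: "\<exists>n. 0 < prob {\<omega> \<in> space M. Y t \<omega> < real n * \<epsilon>}"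
    proof (rule ccontr)
      assume no: "\<not> (\<exists>n. 0 < prob {\<omega> \<in> space M. Y t \<omega> < real n * \<epsilon>})"
      have "AE \<omega> in M. \<not> Y t \<omega> < real n * \<epsilon>" for n
      proof -
        have "prob {\<omega> \<in> space M. Y t \<omega> < real n * \<epsilon>} = 0"
          using no by (simp add: not_less measure_le_0_iff)
        then show ?thesis by (subst (asm) prob_eq_0) auto
      qed
      then have "AE \<omega> in M. \<forall>n. \<not> Y t \<omega> < real n * \<epsilon>" by (simp add: AE_all_countable)
      moreover have "\<exists>n. x < real n * \<epsilon>" for x
        using reals_Archimedean3[OF \<epsilon>] by blast
      ultimately have "AE \<omega> in M. False" by (elim eventually_mono) blast
      then show False by (simp add: AE_False)
    qed
    define n where "n = (LEAST n. 0 < prob {\<omega> \<in> space M. Y t \<omega> < real n * \<epsilon>})"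
    have pos: "0 < prob {\<omega> \<in> space M. Y t \<omega> < real n * \<epsilon>}"
      unfolding n_def by (rule LeastI_ex[OF ex])
    have "prob {\<omega> \<in> space M. Y t \<omega> < real 0 * \<epsilon>} = 0"
      using nonneg[of t] by (subst prob_eq_0) (auto elim!: eventually_mono)
    then obtain k where k: "n = Suc k" using pos by (cases n) auto
    have zero: "prob {\<omega> \<in> space M. Y t \<omega> < real k * \<epsilon>} = 0"
      using not_less_Least[of k "\<lambda>n. 0 < prob {\<omega> \<in> space M. Y t \<omega> < real n * \<epsilon>}"] k
      by (simp add: n_def[symmetric] measure_le_0_iff not_less)
    define F :: "('t \<Rightarrow> real) \<Rightarrow> real" where "F y = indicator {..<real k * \<epsilon>} (y t)" for y
    have F: "F \<in> borel_measurable cyl"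
      unfolding F_def using measurable_cyl_component[of t] by measurable
    have "(\<integral>\<omega>. F (\<lambda>t. Y t (\<pi> \<omega>) + Z t \<omega>) \<partial>N) = (\<integral>\<omega>. 0 \<partial>M)"
      unfolding size_bias_integral[OF F]
    proof (rule integral_cong_AE)
      have "AE \<omega> in M. \<not> Y t \<omega> < real k * \<epsilon>"
        using zero by (subst (asm) prob_eq_0) auto
      then show "AE \<omega> in M. F (\<lambda>t. Y t \<omega>) * (inverse (\<integral>\<omega>. Y s \<omega> \<partial>M) * Y s \<omega>) = 0"
        by eventually_elim (simp add: F_def)
    qed (simp_all add: F_def)
    moreover have "(\<integral>\<omega>. F (\<lambda>t. Y t (\<pi> \<omega>) + Z t \<omega>) \<partial>N)
        = (\<integral>\<omega>. indicator {\<omega> \<in> space N. Y t (\<pi> \<omega>) + Z t \<omega> < real k * \<epsilon>} \<omega> \<partial>N)"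
      by (intro Bochner_Integration.integral_cong) (simp_all add: F_def indicator_def)
    ultimately have sum0: "N.prob {\<omega> \<in> space N. Y t (\<pi> \<omega>) + Z t \<omega> < real k * \<epsilon>} = 0"
      by simp
    have "N.prob {\<omega> \<in> space N. Y t (\<pi> \<omega>) < real n * \<epsilon>} * N.prob {\<omega> \<in> space N. Z t \<omega> < - \<epsilon>}
        = N.prob {\<omega> \<in> space N. Y t (\<pi> \<omega>) < real n * \<epsilon> \<and> Z t \<omega> < - \<epsilon>}"
    proof -
      have "(\<lambda>y. y t) -` {..<a} \<inter> space cyl \<in> sets cyl" for a :: real
        using measurable_sets[OF measurable_cyl_component[of t], of "{..<a}"] by simp
      then have "N.prob ((\<lambda>\<omega>. (\<lambda>t. Y t (\<pi> \<omega>), \<lambda>t. Z t \<omega>)) -`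
            (((\<lambda>y. y t) -` {..<real n * \<epsilon>} \<inter> space cyl) \<times> ((\<lambda>y. y t) -` {..<- \<epsilon>} \<inter> space cyl)) \<inter> space N)
          = N.prob ((\<lambda>\<omega> t. Y t (\<pi> \<omega>)) -` ((\<lambda>y. y t) -` {..<real n * \<epsilon>} \<inter> space cyl) \<inter> space N)
          * N.prob ((\<lambda>\<omega> t. Z t \<omega>) -` ((\<lambda>y. y t) -` {..<- \<epsilon>} \<inter> space cyl) \<inter> space N)"
        by (intro N.indep_varD[OF indep])
      moreover have "space cyl = (UNIV :: ('t \<Rightarrow> real) set)"
        by (simp add: cyl_def space_PiM)
      ultimately show ?thesis
        by (simp add: vimage_def Int_def conj_commute)
    qed
    also have "\<dots> \<le> N.prob {\<omega> \<in> space N. Y t (\<pi> \<omega>) + Z t \<omega> < real k * \<epsilon>}"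
      by (intro N.finite_measure_mono) (auto simp: k algebra_simps)
    finally have "N.prob {\<omega> \<in> space N. Y t (\<pi> \<omega>) < real n * \<epsilon>} * N.prob {\<omega> \<in> space N. Z t \<omega> < - \<epsilon>} \<le> 0"
      by (simp add: sum0)
    moreover have "N.prob {\<omega> \<in> space N. Y t (\<pi> \<omega>) < real n * \<epsilon>} = prob {\<omega> \<in> space M. Y t \<omega> < real n * \<epsilon>}"
      using measurable_space[OF extension(2)]
      by (subst prob_pi[symmetric]) (auto intro!: arg_cong[where f = N.prob])
    ultimately have "N.prob {\<omega> \<in> space N. Z t \<omega> < - \<epsilon>} = 0"
      using pos by (simp add: mult_le_0_iff measure_le_0_iff)
    then show ?thesis
      by (subst (asm) N.prob_eq_0) (auto elim!: eventually_mono)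
  qed
  have "AE \<omega> in N. \<forall>n. - (1 / real (Suc n)) \<le> Z t \<omega>"
    unfolding AE_all_countable by (intro allI no_neg) simp
  then show ?thesis
  proof eventually_elim
    case (elim \<omega>)
    show ?case
    proof (rule ccontr)
      assume "\<not> 0 \<le> Z t \<omega>"
      then obtain n where "inverse (real (Suc n)) < - Z t \<omega>"
        using reals_Archimedean[of "- Z t \<omega>"] by auto
      then show False using elim[rule_format, of n] by (simp add: divide_inverse)
    qed
  qed
qed

sublocale Z: nonneg_process N Z
  by unfold_locales (auto simp: process_def AE_Z_nonneg)

text \<open>The size-bias identity tested on \<open>exp (- g)\<close>.\<close>

lemma bias_law:
  assumes g: "g \<in> nonneg_combs"
  shows "(\<integral>y. y s * exp (- g y) \<partial>law_nonneg M Y)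
    = laplace (law_nonneg M Y) g * ((\<integral>\<omega>. Y s \<omega> \<partial>M) * laplace (law_nonneg N Z) g)"
proof -
  let ?\<theta> = "\<integral>\<omega>. Y s \<omega> \<partial>M"
  have F: "(\<lambda>y. exp (- g y)) \<in> borel_measurable cyl"
    using measurable_comb_cyl[OF g] by measurable
  note [measurable] = measurable_comb[OF g]
  have "(\<integral>\<omega>. exp (- g (\<lambda>t. Y t \<omega>)) * (inverse ?\<theta> * Y s \<omega>) \<partial>M)
      = (\<integral>\<omega>. exp (- g (\<lambda>t. Y t (\<pi> \<omega>) + Z t \<omega>)) \<partial>N)"
    by (rule size_bias_integral[OF F, symmetric])
  also have "\<dots> = (\<integral>\<omega>. exp (- g (\<lambda>t. Y t (\<pi> \<omega>))) \<partial>N) * (\<integral>\<omega>. exp (- g (\<lambda>t. Z t \<omega>)) \<partial>N)"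
    by (rule laplace_indep_sum[where A = "\<lambda>t \<omega>. Y t (\<pi> \<omega>)", OF extension(1) indep AE_pi[OF nonneg] AE_Z_nonneg g])
  also have "(\<integral>\<omega>. exp (- g (\<lambda>t. Y t (\<pi> \<omega>))) \<partial>N) = (\<integral>\<omega>. exp (- g (\<lambda>t. Y t \<omega>)) \<partial>M)"
    by (rule integral_pi) measurable
  finally have eq: "(\<integral>\<omega>. inverse ?\<theta> * (Y s \<omega> * exp (- g (\<lambda>t. Y t \<omega>))) \<partial>M)
      = (\<integral>\<omega>. exp (- g (\<lambda>t. Y t \<omega>)) \<partial>M) * (\<integral>\<omega>. exp (- g (\<lambda>t. Z t \<omega>)) \<partial>N)"
    by (simp add: mult_ac)
  then have "inverse ?\<theta> * (\<integral>\<omega>. Y s \<omega> * exp (- g (\<lambda>t. Y t \<omega>)) \<partial>M)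
      = (\<integral>\<omega>. exp (- g (\<lambda>t. Y t \<omega>)) \<partial>M) * (\<integral>\<omega>. exp (- g (\<lambda>t. Z t \<omega>)) \<partial>N)"
    by (simp only: integral_mult_right_zero)
  then show ?thesis
    using mean_pos by (simp add: laplace_law[OF g] weighted_laplace_law[OF g] Z.laplace_law[OF g] field_simps)
qed

end

text \<open>The measure \<open>m s\<close> of a size-biased family, where \<open>a\<close> is the mean of the process at s.\<close>

definition biased_law :: "'v measure \<Rightarrow> ('t \<Rightarrow> 'v \<Rightarrow> real) \<Rightarrow> real \<Rightarrow> ('t \<Rightarrow> real) measure" where
  "biased_law N Z a = (if 0 < a then scale_measure (ennreal a) (law_nonneg N Z) else null_measure cyl_nonneg)"

text \<open>If \<open>\<theta> s = 0\<close>, then \<open>Y s\<close> vanishes almost surely, and the identity holds with \<open>m s = 0\<close>.\<close>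

lemma (in nonneg_process) size_biased_family_of_processes:
  assumes int: "\<And>t. integrable M (Y t)" and \<theta>: "\<And>t. \<theta> t = (\<integral>\<omega>. Y t \<omega> \<partial>M)"
    and sb: "\<And>s. 0 < \<theta> s \<Longrightarrow> size_bias M Y s (N s) (\<pi> s) (Z s)"
  shows "size_biased_family (law_nonneg M Y) (\<lambda>s. biased_law (N s) (Z s) (\<theta> s))"
proof (rule size_biased_family.intro)
  show "prob_space (law_nonneg M Y)" by (rule prob_space_law)
  show "integrable (law_nonneg M Y) (\<lambda>y. y t)" for t by (rule integrable_law[OF int])
  have spr: "size_biased_process M Y s (N s) (\<pi> s) (Z s)" if "0 < \<theta> s" for s
    by unfold_locales (use int sb[OF that] that \<theta> in auto)
  show sets: "sets (biased_law (N s) (Z s) (\<theta> s)) = sets cyl_nonneg" for s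
    by (simp add: biased_law_def law_nonneg_def)
  show "finite_measure (biased_law (N s) (Z s) (\<theta> s))" for s
  proof (cases "0 < \<theta> s")
    case True
    interpret S: size_biased_process M Y s "N s" "\<pi> s" "Z s" by (rule spr[OF True])
    interpret L: prob_space "law_nonneg (N s) (Z s)" by (rule S.Z.prob_space_law)
    show ?thesis
      using True by (intro finite_measureI) (simp add: biased_law_def space_scale_measure L.emeasure_space_1)
  qed (auto simp: biased_law_def intro!: finite_measureI)
  fix s and g :: "('t \<Rightarrow> real) \<Rightarrow> real" assume g: "g \<in> nonneg_combs"
  show "(\<integral>y. y s * exp (- g y) \<partial>law_nonneg M Y)
    = laplace (law_nonneg M Y) g * laplace (biased_law (N s) (Z s) (\<theta> s)) g"
  proof (cases "0 < \<theta> s")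
    case True
    interpret S: size_biased_process M Y s "N s" "\<pi> s" "Z s" by (rule spr[OF True])
    have "laplace (scale_measure (ennreal (\<theta> s)) (law_nonneg (N s) (Z s))) g = \<theta> s * laplace (law_nonneg (N s) (Z s)) g"
      using True by (intro laplace_scale_measure g) simp_all
    then show ?thesis
      using S.bias_law[OF g] True by (simp add: biased_law_def \<theta>)
  next
    case False
    have "0 \<le> \<theta> s" unfolding \<theta> using nonneg by (rule integral_nonneg_AE)
    with False have "\<theta> s = 0" by simp
    then have "AE \<omega> in M. Y s \<omega> = 0"
      using integral_nonneg_eq_0_iff_AE[OF int nonneg] \<theta> by simp
    then have "(\<integral>\<omega>. Y s \<omega> * exp (- g (\<lambda>t. Y t \<omega>)) \<partial>M) = (\<integral>\<omega>. 0 \<partial>M)"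
      using measurable_comb[OF g] by (intro integral_cong_AE) (auto elim!: eventually_mono)
    then show ?thesis
      using False by (simp add: weighted_laplace_law[OF g] biased_law_def)
  qed
qed simp

section \<open>Separability\<close>

text \<open>If \<open>Y t\<close> is approximated by \<open>Y (r n)\<close>, then so are its Laplace transforms, and with them those
  of \<open>m t\<close>.  Hence \<open>y (r n)\<close> approximates \<open>y t\<close> under \<open>m t\<close> as well.\<close>

lemma (in size_biased_family) AE_m_zero_of_approximation:
  assumes approx: "(\<lambda>n. \<integral>y. \<bar>exp (- y (r n)) - exp (- y t)\<bar> \<partial>P) \<longlonglongrightarrow> 0"
  shows "AE y in m t. (\<forall>n. y (r n) = 0) \<longrightarrow> y t = 0"
proof -
  define d where "d n = (\<integral>y. \<bar>exp (- y (r n)) - exp (- y t)\<bar> \<partial>P)" for n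
  define e where "e i j n y = exp (- y t) ^ i * exp (- y (r n)) ^ j" for i j n and y :: "'t \<Rightarrow> real"
  \<comment> \<open>By \<open>e_exp\<close>, the transforms of \<open>P\<close> and \<open>m t\<close> at \<open>i * y t + j * y (r n)\<close>.\<close>
  define L where "L i j n = (\<integral>y. e i j n y \<partial>P)" for i j n
  define K where "K i j n = (\<integral>y. e i j n y \<partial>m t)" for i j n
  define \<theta> where "\<theta> = measure (m t) (space (m t))"
  have comb: "(\<lambda>y. real i * y t + real j * y (r n)) \<in> nonneg_combs" for i j n
    using nonneg_combs.add[OF nonneg_combs.add[OF nonneg_combs.zero, of "real i" t], of "real j" "r n"] by simp
  have e_exp: "e i j n = (\<lambda>y. exp (- (real i * y t + real j * y (r n))))" for i j n
  proof
    fix y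
    have "exp (- (real i * y t + real j * y (r n))) = exp (real i * - y t) * exp (real j * - y (r n))"
      by (simp flip: exp_add)
    then show "e i j n y = exp (- (real i * y t + real j * y (r n)))"
      by (simp only: exp_of_nat_mult e_def)
  qed
  have intP: "integrable P (e i j n)" and intm: "integrable (m t) (e i j n)"
    and int_ye: "integrable P (\<lambda>y. y t * e i j n y)" for i j n
    unfolding e_exp by (rule integrable_exp_P[OF comb] integrable_exp_m[OF comb]
        integrable_mult_exp_neg_comb[OF sets_P integrable_P comb])+
  have bias_e: "(\<integral>y. y t * e i j n y \<partial>P) = L i j n * K i j n" for i j n
    unfolding L_def K_def e_exp by (rule bias[OF comb])
  have e01: "0 < exp (- y t)" "exp (- y t) \<le> 1" if "y \<in> space cyl_nonneg" for y :: "'t \<Rightarrow> real" and t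
    using that by (auto simp: space_cyl_nonneg)
  have sp: "space P = space cyl_nonneg" "space (m t) = space cyl_nonneg"
    by (rule space_eq_cyl_nonneg[OF sets_P], rule space_eq_cyl_nonneg[OF sets_m])
  have K_bound: "0 \<le> K i j n" "K i j n \<le> \<theta>" for i j n
  proof -
    show "0 \<le> K i j n" unfolding K_def e_def by (rule integral_nonneg_AE) simp
    have "K i j n \<le> (\<integral>y. 1 \<partial>m t)"
      unfolding K_def
    proof (intro integral_mono intm)
      fix y assume "y \<in> space (m t)"
      then show "e i j n y \<le> 1"
        unfolding e_def sp using e01 by (intro mult_le_one power_le_one zero_le_power) (auto simp: less_imp_le)
    qed simp
    then show "K i j n \<le> \<theta>" by (simp add: \<theta>_def)
  qed
  have int_d: "integrable P (\<lambda>y. \<bar>exp (- y (r n)) - exp (- y t)\<bar>)" for n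
    using Bochner_Integration.integrable_diff[OF intP[of 0 1 n] intP[of 1 0 n]]
    by (intro integrable_abs) (simp add: e_def)
  have L_approx: "\<bar>L i j n - L (i + j) 0 n\<bar> \<le> real j * d n" for i j n
  proof -
    have "L i j n - L (i + j) 0 n = (\<integral>y. e i j n y - e (i + j) 0 n y \<partial>P)"
      unfolding L_def by (rule Bochner_Integration.integral_diff[symmetric, OF intP intP])
    also have "\<bar>\<dots>\<bar> \<le> (\<integral>y. real j * \<bar>exp (- y (r n)) - exp (- y t)\<bar> \<partial>P)"
    proof (rule order_trans[OF integral_abs_bound], rule integral_mono)
      fix y assume y: "y \<in> space P"
      define a b where "a = exp (- y t)" and "b = exp (- y (r n))"
      have ab: "0 < a" "a \<le> 1" "0 < b" "b \<le> 1" using e01 y by (auto simp: a_def b_def sp)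
      have "\<bar>a ^ i * b ^ j - a ^ (i + j)\<bar> = a ^ i * \<bar>b ^ j - a ^ j\<bar>"
        using ab by (simp add: power_add abs_mult flip: right_diff_distrib)
      also have "\<dots> \<le> 1 * (real j * \<bar>b - a\<bar>)"
        using ab norm_power_diff[of b a j] by (intro mult_mono power_le_one) auto
      finally show "\<bar>e i j n y - e (i + j) 0 n y\<bar> \<le> real j * \<bar>exp (- y (r n)) - exp (- y t)\<bar>"
        by (simp add: e_def a_def b_def)
    qed (intro integrable_abs Bochner_Integration.integrable_diff integrable_mult_right intP int_d)+
    finally show ?thesis by (simp add: d_def)
  qed
  \<comment> \<open>The factor \<open>exp (- y t)\<close> compensates the weight \<open>y t\<close> in \<open>bias\<close>: \<open>y t * exp (- y t) \<le> 1\<close>.\<close>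
  define w where "w n y = exp (- y t) * (exp (- y t) - exp (- y (r n)))^2" for n and y :: "'t \<Rightarrow> real"
  have w_eq: "w n = (\<lambda>y. e 3 0 n y - 2 * e 2 1 n y + e 1 2 n y)" for n
    unfolding e_def w_def by (simp add: fun_eq_iff power2_eq_square power3_eq_cube algebra_simps)
  have int_w: "integrable (m t) (w n)" for n
    unfolding w_eq by (intro Bochner_Integration.integrable_add Bochner_Integration.integrable_diff integrable_mult_right intm)
  have int_w_m: "(\<integral>y. w n y \<partial>m t) = K 3 0 n - 2 * K 2 1 n + K 1 2 n" for n
    unfolding w_eq K_def using intm by simp
  have yw_eq: "(\<lambda>y. y t * w n y) = (\<lambda>y. y t * e 3 0 n y - 2 * (y t * e 2 1 n y) + y t * e 1 2 n y)" for n
    unfolding w_eq by (simp add: fun_eq_iff algebra_simps)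
  have yw_P: "(\<integral>y. y t * w n y \<partial>P) = L 3 0 n * K 3 0 n - 2 * (L 2 1 n * K 2 1 n) + L 1 2 n * K 1 2 n" for n
    unfolding yw_eq using int_ye by (simp add: bias_e)
  have yw_bound: "(\<integral>y. y t * w n y \<partial>P) \<le> d n" for n
    unfolding d_def
  proof (rule integral_mono)
    show "integrable P (\<lambda>y. y t * w n y)"
      unfolding yw_eq by (intro Bochner_Integration.integrable_add Bochner_Integration.integrable_diff integrable_mult_right int_ye)
    fix y assume y: "y \<in> space P"
    define a b where "a = exp (- y t)" and "b = exp (- y (r n))"
    have ab: "0 < a" "a \<le> 1" "0 < b" "b \<le> 1" using e01 y by (auto simp: a_def b_def sp)
    have nn: "0 \<le> y t" using y by (simp add: sp space_cyl_nonneg)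
    have "y t * w n y = (y t * a) * (\<bar>b - a\<bar> * \<bar>b - a\<bar>)"
      by (simp add: w_def a_def b_def power2_eq_square algebra_simps)
    also have "\<dots> \<le> 1 * (1 * \<bar>b - a\<bar>)"
    proof (intro mult_mono mult_right_mono)
      show "y t * a \<le> 1" unfolding a_def by (rule mult_exp_neg_le_1[OF nn])
      show "\<bar>b - a\<bar> \<le> 1" using ab by linarith
    qed auto
    finally show "y t * w n y \<le> \<bar>exp (- y (r n)) - exp (- y t)\<bar>" by (simp add: a_def b_def)
  qed (rule int_d)
  have three: "2 + 1 = (3 :: nat)" "1 + 2 = (3 :: nat)" by simp_all
  have d_nonneg: "0 \<le> d n" for n unfolding d_def by (rule integral_nonneg_AE) simp
  define B where "B = {y \<in> space (m t). \<forall>n. y (r n) = 0}"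
  define I where "I = (\<integral>y. indicator B y * (exp (- y t) * (exp (- y t) - 1)^2) \<partial>m t)"
  have B: "B \<in> sets (m t)" unfolding B_def by measurable
  have bound1: "exp (- x) * (exp (- x) - 1)^2 \<le> 1" if "0 \<le> x" for x :: real
  proof (rule mult_le_one)
    have e: "0 < exp (- x)" "exp (- x) \<le> 1" using that by simp_all
    have "\<bar>exp (- x) - 1\<bar> \<le> 1" unfolding abs_le_iff using e by linarith
    then show "(exp (- x) - 1)\<^sup>2 \<le> 1" by (simp only: abs_square_le_1)
  qed (use that in auto)
  have int_I: "integrable (m t) (\<lambda>y. indicator B y * (exp (- y t) * (exp (- y t) - 1)^2))"
    using B bound1 by (intro m.integrable_const_bound[where B = 1] AE_I2)
      (auto simp: indicator_def space_eq_cyl_nonneg[OF sets_m] space_cyl_nonneg)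
  have I_nonneg: "0 \<le> I" unfolding I_def by (rule integral_nonneg_AE) simp
  have I_le: "I \<le> (\<integral>y. w n y \<partial>m t)" for n
    unfolding I_def by (intro integral_mono int_I int_w) (auto simp: w_def B_def indicator_def)
  have L0: "L 3 0 n = L 3 0 0" for n by (simp add: L_def e_def)
  have L0_pos: "0 < L 3 0 0" unfolding L_def e_exp by (rule laplace_P_pos[OF comb])
  have "L 3 0 0 * I \<le> (1 + 4 * \<theta>) * d n" for n
  proof -
    have expand: "L 3 0 n * (\<integral>y. w n y \<partial>m t) = (\<integral>y. y t * w n y \<partial>P) + 2 * ((L 2 1 n - L 3 0 n) * K 2 1 n) - (L 1 2 n - L 3 0 n) * K 1 2 n"
      unfolding int_w_m yw_P by (simp add: algebra_simps)
    have "(L 2 1 n - L 3 0 n) * K 2 1 n \<le> d n * \<theta>"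
      using L_approx[of 2 1 n, unfolded three] K_bound[of 2 1 n] d_nonneg[of n] by (intro mult_mono) auto
    moreover have "- ((L 1 2 n - L 3 0 n) * K 1 2 n) \<le> 2 * d n * \<theta>"
    proof -
      have "(L 3 0 n - L 1 2 n) * K 1 2 n \<le> (2 * d n) * \<theta>"
        using L_approx[of 1 2 n, unfolded three] K_bound[of 1 2 n] d_nonneg[of n] by (intro mult_mono) auto
      then show ?thesis by (simp add: algebra_simps)
    qed
    ultimately have "L 3 0 n * (\<integral>y. w n y \<partial>m t) \<le> d n + 2 * (d n * \<theta>) + 2 * d n * \<theta>"
      using yw_bound[of n] expand by linarith
    moreover have "L 3 0 0 * I \<le> L 3 0 n * (\<integral>y. w n y \<partial>m t)"
      unfolding L0[of n] using I_le[of n] L0_pos by (intro mult_left_mono) auto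
    ultimately show ?thesis by (simp add: algebra_simps)
  qed
  moreover have "(\<lambda>n. (1 + 4 * \<theta>) * d n) \<longlonglongrightarrow> (1 + 4 * \<theta>) * 0"
    unfolding d_def by (intro tendsto_mult_left approx)
  ultimately have "L 3 0 0 * I \<le> 0"
    by (intro LIMSEQ_le_const[of "\<lambda>n. (1 + 4 * \<theta>) * d n"]) auto
  then have "I = 0" using L0_pos I_nonneg by (simp add: mult_le_0_iff)
  then have "AE y in m t. indicator B y * (exp (- y t) * (exp (- y t) - 1)^2) = 0"
    unfolding I_def by (subst (asm) integral_nonneg_eq_0_iff_AE[OF int_I]) auto
  then show ?thesis
    using AE_space by eventually_elim (auto simp: B_def indicator_def split: if_splits)
qed

text \<open>The function \<open>exp (- x)\<close> is bounded and Lipschitz on \<open>x \<ge> 0\<close>, so convergence in probability becomes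
  convergence in mean.\<close>

lemma (in nonneg_process) laplace_approximation:
  assumes conv: "converges_in_prob M (\<lambda>n. Y (r n)) (Y t)"
  shows "(\<lambda>n. \<integral>y. \<bar>exp (- y (r n)) - exp (- y t)\<bar> \<partial>law_nonneg M Y) \<longlonglongrightarrow> 0"
proof -
  have [measurable]: "(\<lambda>y. y t) \<in> borel_measurable cyl_nonneg" for t
    by (rule measurable_cyl_nonneg_component)
  have eq: "(\<integral>y. \<bar>exp (- y (r n)) - exp (- y t)\<bar> \<partial>law_nonneg M Y)
      = (\<integral>\<omega>. \<bar>exp (- max 0 (Y (r n) \<omega>)) - exp (- max 0 (Y t \<omega>))\<bar> \<partial>M)" for n
    unfolding law_nonneg_def by (intro integral_distr measurable_path) measurable
  have bound: "(\<integral>\<omega>. \<bar>exp (- max 0 (Y (r n) \<omega>)) - exp (- max 0 (Y t \<omega>))\<bar> \<partial>M)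
      \<le> \<epsilon> + prob {\<omega> \<in> space M. \<epsilon> < \<bar>Y (r n) \<omega> - Y t \<omega>\<bar>}" if \<epsilon>: "0 < \<epsilon>" for n \<epsilon>
  proof -
    let ?A = "{\<omega> \<in> space M. \<epsilon> < \<bar>Y (r n) \<omega> - Y t \<omega>\<bar>}"
    have le1: "\<bar>exp (- max 0 a) - exp (- max 0 b)\<bar> \<le> 1" for a b :: real
    proof -
      have "0 < exp (- max 0 a)" "exp (- max 0 a) \<le> 1" "0 < exp (- max 0 b)" "exp (- max 0 b) \<le> 1" by auto
      then show ?thesis unfolding abs_le_iff by linarith
    qed
    have lip: "\<bar>exp (- max 0 a) - exp (- max 0 b)\<bar> \<le> \<bar>a - b\<bar>" for a b :: real
      using exp_neg_lipschitz[of "max 0 a" "max 0 b"] by (auto simp: max_def split: if_splits)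
    have "(\<integral>\<omega>. \<bar>exp (- max 0 (Y (r n) \<omega>)) - exp (- max 0 (Y t \<omega>))\<bar> \<partial>M) \<le> (\<integral>\<omega>. \<epsilon> + indicator ?A \<omega> \<partial>M)"
    proof (intro integral_mono)
      show "integrable M (\<lambda>\<omega>. \<bar>exp (- max 0 (Y (r n) \<omega>)) - exp (- max 0 (Y t \<omega>))\<bar>)"
        using le1 by (intro integrable_const_bound[of _ 1] AE_I2) auto
      show "integrable M (\<lambda>\<omega>. \<epsilon> + indicator ?A \<omega>)"
        by (intro integrable_const_bound[of _ "\<epsilon> + 1"] AE_I2) (use \<epsilon> in \<open>auto simp: indicator_def\<close>)
      fix \<omega> assume \<omega>: "\<omega> \<in> space M"
      let ?d = "\<bar>exp (- max 0 (Y (r n) \<omega>)) - exp (- max 0 (Y t \<omega>))\<bar>"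
      show "?d \<le> \<epsilon> + indicator ?A \<omega>"
      proof (cases "\<epsilon> < \<bar>Y (r n) \<omega> - Y t \<omega>\<bar>")
        case True
        then have "indicator ?A \<omega> = (1 :: real)" using \<omega> by simp
        then show ?thesis using le1[of "Y (r n) \<omega>" "Y t \<omega>"] \<epsilon> by linarith
      next
        case False
        then have "?d \<le> \<epsilon>" using lip[of "Y (r n) \<omega>" "Y t \<omega>"] by linarith
        then show ?thesis by (rule order_trans) simp
      qed
    qed
    also have "\<dots> = \<epsilon> + prob ?A"
      by (subst Bochner_Integration.integral_add) (auto simp: prob_space emeasure_eq_measure)
    finally show ?thesis .
  qed
  show ?thesis
    unfolding eq
  proof (rule LIMSEQ_I)
    fix e :: real assume e: "0 < e"
    have "(\<lambda>n. prob {\<omega> \<in> space M. e / 2 < \<bar>Y (r n) \<omega> - Y t \<omega>\<bar>}) \<longlonglongrightarrow> 0"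
      using conv half_gt_zero[OF e] unfolding converges_in_prob_def by blast
    from LIMSEQ_D[OF this, of "e / 2"] e
    obtain n0 where n0: "\<And>n. n0 \<le> n \<Longrightarrow> prob {\<omega> \<in> space M. e / 2 < \<bar>Y (r n) \<omega> - Y t \<omega>\<bar>} < e / 2" by auto
    show "\<exists>n0. \<forall>n\<ge>n0. norm ((\<integral>\<omega>. \<bar>exp (- max 0 (Y (r n) \<omega>)) - exp (- max 0 (Y t \<omega>))\<bar> \<partial>M) - 0) < e"
    proof (intro exI[of _ n0] allI impI)
      fix n assume "n0 \<le> n"
      then show "norm ((\<integral>\<omega>. \<bar>exp (- max 0 (Y (r n) \<omega>)) - exp (- max 0 (Y t \<omega>))\<bar> \<partial>M) - 0) < e"
        using bound[of "e / 2" n] n0[of n] e by (simp add: integral_nonneg_AE)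
    qed
  qed
qed

section \<open>Size-biasing processes built from Levy characteristics\<close>

locale process_with_levy_characteristics = nonneg_process M Y
  for M :: "'w measure" and Y :: "'t \<Rightarrow> 'w \<Rightarrow> real" +
  fixes \<nu> :: "('t \<Rightarrow> real) measure" and c :: "'t \<Rightarrow> real" and s :: 't
  assumes integrable_Y: "\<And>t. integrable M (Y t)"
    and characteristics: "levy_characteristics M Y \<nu> c"
    and mean_pos: "0 < (\<integral>\<omega>. Y s \<omega> \<partial>M)"
begin

abbreviation mean :: real where "mean \<equiv> (\<integral>\<omega>. Y s \<omega> \<partial>M)"

sublocale L: levy_triple "law_nonneg M Y" \<nu> c
proof (rule levy_triple.intro)
  show "prob_space (law_nonneg M Y)" by (rule prob_space_law)
  show "integrable (law_nonneg M Y) (\<lambda>y. y t)" for t by (rule integrable_law[OF integrable_Y])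
  have char: "levy_measure \<nu>" "\<forall>t. 0 \<le> c t" "laplace_levy (law_nonneg M Y) \<nu> c"
    using characteristics unfolding levy_characteristics_iff by blast+
  show "sets \<nu> = sets cyl_nonneg" using char(1) by (simp add: levy_measure_def)
  show "0 \<le> c t" for t using char(2) by blast
  show "laplace_levy (law_nonneg M Y) \<nu> c" by (rule char(3))
qed (rule sets_law)

sublocale F: size_biased_family "law_nonneg M Y" L.bias_measure
  by (rule L.size_biased_family_bias_measure)

text \<open>The law of \<open>Z\<close>.\<close>

definition Q :: "('t \<Rightarrow> real) measure" where
  "Q = scale_measure (ennreal (inverse mean)) (L.bias_measure s)"

lemma sets_Q [simp]: "sets Q = sets cyl_nonneg"
  by (simp add: Q_def)

lemma space_Q: "space Q = space cyl_nonneg"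
  by (rule space_eq_cyl_nonneg) simp

lemma mean_law: "(\<integral>y. y s \<partial>law_nonneg M Y) = mean"
  using weighted_laplace_law[OF nonneg_combs.zero, of s] by simp

lemma prob_space_Q: "prob_space Q"
proof (rule prob_spaceI)
  have "emeasure (L.bias_measure s) (space (L.bias_measure s)) = ennreal mean"
    using F.mass_m[of s] mean_law by (simp add: F.m.emeasure_eq_measure)
  then show "emeasure Q (space Q) = 1"
    using mean_pos by (simp add: Q_def space_scale_measure flip: ennreal_mult)
qed

sublocale Q: prob_space Q by (rule prob_space_Q)

definition N :: "('w \<times> ('t \<Rightarrow> real)) measure" where "N = M \<Otimes>\<^sub>M Q"

definition Z :: "'t \<Rightarrow> 'w \<times> ('t \<Rightarrow> real) \<Rightarrow> real" where "Z t = (\<lambda>\<omega>. snd \<omega> t)"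

sublocale MQ: pair_prob_space M Q ..

sublocale N: prob_space N
  unfolding N_def by (rule MQ.prob_space_axioms)

lemma measurable_fst_N [measurable]: "fst \<in> measurable N M"
  by (simp add: N_def)

lemma measurable_snd_N [measurable]: "snd \<in> measurable N Q"
  by (simp add: N_def)

lemma measurable_Z [measurable]: "Z t \<in> borel_measurable N"
  unfolding Z_def using measurable_compose[OF measurable_snd_N measurable_component_of_sets[OF sets_Q]] by simp

lemma distr_fst_N: "distr N M fst = M"
proof (rule measure_eqI)
  fix A assume "A \<in> sets (distr N M fst)"
  then have A: "A \<in> sets M" by simp
  then have "fst -` A \<inter> space N = A \<times> space Q"
    using sets.sets_into_space by (auto simp: N_def space_pair_measure)
  moreover have "emeasure N (A \<times> space Q) = emeasure M A * emeasure Q (space Q)"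
    unfolding N_def by (rule Q.emeasure_pair_measure_Times[OF A sets.top])
  ultimately show "emeasure (distr N M fst) A = emeasure M A"
    using A by (simp add: emeasure_distr Q.emeasure_space_1)
qed simp

lemma distr_snd_N: "distr N Q snd = Q"
proof (rule measure_eqI)
  fix A assume "A \<in> sets (distr N Q snd)"
  then have A: "A \<in> sets Q" by simp
  have "snd -` A \<inter> space N = space M \<times> A"
    using sets.sets_into_space[OF A] by (auto simp: N_def space_pair_measure)
  moreover have "emeasure N (space M \<times> A) = emeasure M (space M) * emeasure Q A"
    unfolding N_def by (rule Q.emeasure_pair_measure_Times[OF sets.top A])
  ultimately show "emeasure (distr N Q snd) A = emeasure Q A"
    using emeasure_distr[OF measurable_snd_N A] by (simp add: emeasure_space_1)
qed simp

lemma Z_nonneg: "\<omega> \<in> space N \<Longrightarrow> 0 \<le> Z t \<omega>"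
  by (auto simp: N_def Z_def space_pair_measure space_Q space_cyl_nonneg)

sublocale Z: nonneg_process N Z
  by unfold_locales (auto simp: process_def Z_nonneg)

lemma law_Z: "law_nonneg N Z = Q"
proof -
  have "law_nonneg N Z = distr N Q snd"
    unfolding law_nonneg_def
    by (rule distr_cong) (auto simp: Z_def fun_eq_iff N_def space_pair_measure space_Q space_cyl_nonneg)
  then show ?thesis by (simp add: distr_snd_N)
qed

lemma emeasure_law_Z:
  assumes B: "B \<in> sets cyl_nonneg"
  shows "emeasure (law_nonneg N Z) B =
    emeasure (scale_measure (ennreal (c s / mean)) (return cyl_nonneg (\<lambda>_. 0))) B +
    emeasure (density \<nu> (\<lambda>y. ennreal (y s / mean))) B"
proof -
  have [measurable]: "B \<in> sets \<nu>" using B by (simp add: L.sets_nu)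
  have "emeasure (density \<nu> (\<lambda>y. ennreal (y s / mean))) B = (\<integral>\<^sup>+y. ennreal (inverse mean) * (ennreal (y s) * indicator B y) \<partial>\<nu>)"
    using mean_pos
    by (subst emeasure_density)
       (auto intro!: nn_integral_cong simp: divide_inverse mult.commute[of _ "inverse mean"] ennreal_mult' mult.assoc)
  also have "\<dots> = ennreal (inverse mean) * emeasure (density \<nu> (\<lambda>y. ennreal (y s))) B"
    by (subst nn_integral_cmult) (auto simp: emeasure_density)
  finally have "emeasure (density \<nu> (\<lambda>y. ennreal (y s / mean))) B = ennreal (inverse mean) * emeasure (density \<nu> (\<lambda>y. ennreal (y s))) B" .
  moreover have "emeasure Q B = ennreal (inverse mean) * (ennreal (c s) * emeasure (return cyl_nonneg (\<lambda>_. 0)) B + emeasure (density \<nu> (\<lambda>y. ennreal (y s))) B)"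
    using B unfolding Q_def L.bias_measure_def
    by (simp add: emeasure_measure_plus L.sets_nu)
  moreover have "ennreal (c s / mean) = ennreal (inverse mean) * ennreal (c s)"
    using L.c_nonneg[of s] mean_pos by (simp add: divide_inverse mult.commute flip: ennreal_mult)
  ultimately show ?thesis
    by (simp add: law_Z distrib_left mult.assoc)
qed

lemma measurable_Y_fst: "(\<lambda>\<omega> t. Y t (fst \<omega>)) \<in> measurable N cyl"
  by (rule measurable_into_cyl) measurable

lemma measurable_Z_path: "(\<lambda>\<omega> t. Z t \<omega>) \<in> measurable N cyl"
  by (rule measurable_into_cyl) measurable

lemma indep: "N.indep_var cyl (\<lambda>\<omega> t. Y t (fst \<omega>)) cyl (\<lambda>\<omega> t. Z t \<omega>)"
proof -
  have Ym: "(\<lambda>\<omega> t. Y t \<omega>) \<in> measurable M cyl"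
    by (rule measurable_into_cyl) measurable
  have Im: "(\<lambda>y t. y t) \<in> measurable Q cyl"
    by (rule measurable_into_cyl) (rule measurable_component_of_sets[OF sets_Q])
  have "distr N cyl (\<lambda>\<omega> t. Y t (fst \<omega>)) = distr (distr N M fst) cyl (\<lambda>\<omega> t. Y t \<omega>)"
    using Ym by (subst distr_distr) (auto simp: comp_def)
  then have 1: "distr N cyl (\<lambda>\<omega> t. Y t (fst \<omega>)) = distr M cyl (\<lambda>\<omega> t. Y t \<omega>)"
    by (simp add: distr_fst_N)
  have "distr N cyl (\<lambda>\<omega> t. Z t \<omega>) = distr (distr N Q snd) cyl (\<lambda>y t. y t)"
    using Im by (subst distr_distr) (auto simp: comp_def Z_def)
  then have 2: "distr N cyl (\<lambda>\<omega> t. Z t \<omega>) = distr Q cyl (\<lambda>y t. y t)"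
    by (simp add: distr_snd_N)
  have "distr M cyl (\<lambda>\<omega> t. Y t \<omega>) \<Otimes>\<^sub>M distr Q cyl (\<lambda>y t. y t)
      = distr (M \<Otimes>\<^sub>M Q) (cyl \<Otimes>\<^sub>M cyl) (\<lambda>(x, y). (\<lambda>t. Y t x, \<lambda>t. y t))"
    using prob_space_imp_sigma_finite[OF Q.prob_space_distr[OF Im]]
    by (intro pair_measure_distr Ym Im) simp
  also have "\<dots> = distr N (cyl \<Otimes>\<^sub>M cyl) (\<lambda>\<omega>. (\<lambda>t. Y t (fst \<omega>), \<lambda>t. Z t \<omega>))"
    by (simp add: N_def Z_def case_prod_beta')
  finally show ?thesis
    unfolding N.indep_var_distribution_eq 1 2 using measurable_Y_fst measurable_Z_path by simp
qed

text \<open>Both sides of the size-bias identity are integrals against laws on nonnegative paths; these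
  have the same Laplace transform.\<close>

lemma size_biased_law:
  "distr N cyl (\<lambda>\<omega> t. Y t (fst \<omega>) + Z t \<omega>)
    = distr (density M (\<lambda>\<omega>. ennreal (inverse mean * Y s \<omega>))) cyl (\<lambda>\<omega> t. Y t \<omega>)"
proof -
  define X where "X t \<omega> = Y t (fst \<omega>) + Z t \<omega>" for t \<omega>
  define Ms where "Ms = density M (\<lambda>\<omega>. ennreal (inverse mean * Y s \<omega>))"
  have Y_fst: "AE \<omega> in N. 0 \<le> Y t (fst \<omega>)" for t
  proof (rule AE_distrD[OF measurable_fst_N])
    show "AE \<omega> in distr N M fst. 0 \<le> Y t \<omega>" unfolding distr_fst_N by (rule nonneg)
  qed
  have w_nonneg: "AE \<omega> in M. 0 \<le> inverse mean * Y s \<omega>"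
    using nonneg[of s] mean_pos by (auto elim!: eventually_mono)
  have X_meas: "process N X"
    unfolding process_def X_def by measurable
  interpret X: nonneg_process N X
  proof
    show "process N X" by (rule X_meas)
    show "AE \<omega> in N. 0 \<le> X t \<omega>" for t
      using Y_fst[of t] Z.nonneg[of t] by eventually_elim (simp add: X_def)
  qed
  have prob_Ms: "prob_space Ms"
  proof (rule prob_spaceI)
    have "emeasure Ms (space Ms) = (\<integral>\<^sup>+\<omega>. ennreal (inverse mean * Y s \<omega>) \<partial>M)"
      unfolding Ms_def by (subst emeasure_density) (auto intro!: nn_integral_cong)
    also have "\<dots> = ennreal (\<integral>\<omega>. inverse mean * Y s \<omega> \<partial>M)"
      using integrable_Y[of s] w_nonneg by (intro nn_integral_eq_integral) auto
    finally show "emeasure Ms (space Ms) = 1" using mean_pos by simp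
  qed
  interpret B: nonneg_process Ms Y
  proof (rule nonneg_process.intro[OF prob_Ms], unfold_locales)
    show "process Ms Y" unfolding process_def Ms_def by simp
    show "AE \<omega> in Ms. 0 \<le> Y t \<omega>" for t
      unfolding Ms_def using nonneg[of t] by (subst AE_density) (auto elim!: eventually_mono)
  qed
  have "law_nonneg N X = law_nonneg Ms Y"
  proof (rule laplace_unique)
    fix g :: "('t \<Rightarrow> real) \<Rightarrow> real" assume g: "g \<in> nonneg_combs"
    note [measurable] = measurable_comb[OF g]
    have lapQ: "laplace Q g = inverse mean * laplace (L.bias_measure s) g"
      unfolding Q_def using mean_pos by (intro laplace_scale_measure g) simp_all
    have "laplace (law_nonneg N X) g = (\<integral>\<omega>. exp (- g (\<lambda>t. Y t (fst \<omega>) + Z t \<omega>)) \<partial>N)"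
      unfolding X.laplace_law[OF g] X_def ..
    also have "\<dots> = (\<integral>\<omega>. exp (- g (\<lambda>t. Y t (fst \<omega>))) \<partial>N) * (\<integral>\<omega>. exp (- g (\<lambda>t. Z t \<omega>)) \<partial>N)"
      by (rule laplace_indep_sum[where A = "\<lambda>t \<omega>. Y t (fst \<omega>)", OF N.prob_space_axioms indep Y_fst Z.nonneg g])
    also have "(\<integral>\<omega>. exp (- g (\<lambda>t. Z t \<omega>)) \<partial>N) = laplace Q g"
      using Z.laplace_law[OF g] by (simp add: law_Z)
    also have "(\<integral>\<omega>. exp (- g (\<lambda>t. Y t (fst \<omega>))) \<partial>N) = (\<integral>\<omega>. exp (- g (\<lambda>t. Y t \<omega>)) \<partial>distr N M fst)"
      by (rule integral_distr[symmetric]) measurable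
    also have "\<dots> = laplace (law_nonneg M Y) g"
      by (simp add: distr_fst_N laplace_law[OF g])
    also have "\<dots> * laplace Q g = inverse mean * (\<integral>y. y s * exp (- g y) \<partial>law_nonneg M Y)"
      using F.bias[OF g, of s] by (simp add: lapQ)
    also have "\<dots> = (\<integral>\<omega>. inverse mean * Y s \<omega> * exp (- g (\<lambda>t. Y t \<omega>)) \<partial>M)"
      by (simp add: weighted_laplace_law[OF g] mult.assoc)
    also have "\<dots> = (\<integral>\<omega>. exp (- g (\<lambda>t. Y t \<omega>)) \<partial>Ms)"
      unfolding Ms_def using w_nonneg by (subst integral_density) auto
    also have "\<dots> = laplace (law_nonneg Ms Y) g"
      by (rule B.laplace_law[OF g, symmetric])
    finally show "laplace (law_nonneg N X) g = laplace (law_nonneg Ms Y) g" .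
  qed (auto intro: prob_space.finite_measure X.prob_space_law B.prob_space_law)
  then have "distr (law_nonneg N X) cyl (\<lambda>y. y) = distr (law_nonneg Ms Y) cyl (\<lambda>y. y)" by simp
  then have "distr N cyl (\<lambda>\<omega> t. X t \<omega>) = distr Ms cyl (\<lambda>\<omega> t. Y t \<omega>)"
    unfolding distr_law_nonneg[OF N.prob_space_axioms X.process X.nonneg]
      distr_law_nonneg[OF prob_Ms B.process B.nonneg] .
  then show ?thesis by (simp add: X_def Ms_def)
qed

theorem size_bias_N: "size_bias M Y s N fst Z"
  unfolding size_bias_def extension_of_def
proof (intro conjI ballI)
  show "prob_space N" by (rule N.prob_space_axioms)
  show "fst \<in> measurable N M" by measurable
  show "distr N M fst = M" by (rule distr_fst_N)
  show "process N Z" by (rule Z.process)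
  show "N.indep_var cyl (\<lambda>\<omega> t. Y t (fst \<omega>)) cyl (\<lambda>\<omega> t. Z t \<omega>)" by (rule indep)
  fix F :: "('t \<Rightarrow> real) \<Rightarrow> real" assume F: "F \<in> borel_measurable cyl"
  have Xm: "(\<lambda>\<omega> t. Y t (fst \<omega>) + Z t \<omega>) \<in> measurable N cyl"
    by (rule measurable_into_cyl) measurable
  have Ym: "(\<lambda>\<omega> t. Y t \<omega>) \<in> measurable M cyl"
    by (rule measurable_into_cyl) measurable
  have FY [measurable]: "(\<lambda>\<omega>. F (\<lambda>t. Y t \<omega>)) \<in> borel_measurable M"
    using measurable_compose[OF Ym F] .
  let ?Ms = "density M (\<lambda>\<omega>. ennreal (inverse mean * Y s \<omega>))"
  have Ym': "(\<lambda>\<omega> t. Y t \<omega>) \<in> measurable ?Ms cyl" using Ym by simp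
  have w_nonneg: "AE \<omega> in M. 0 \<le> inverse mean * Y s \<omega>"
    using nonneg[of s] mean_pos by (auto elim!: eventually_mono)
  have "integrable N (\<lambda>\<omega>. F (\<lambda>t. Y t (fst \<omega>) + Z t \<omega>)) \<longleftrightarrow> integrable (distr N cyl (\<lambda>\<omega> t. Y t (fst \<omega>) + Z t \<omega>)) F"
    by (rule integrable_distr_eq[OF Xm F, symmetric])
  also have "\<dots> \<longleftrightarrow> integrable ?Ms (\<lambda>\<omega>. F (\<lambda>t. Y t \<omega>))"
    unfolding size_biased_law by (rule integrable_distr_eq[OF Ym' F])
  also have "\<dots> \<longleftrightarrow> integrable M (\<lambda>\<omega>. F (\<lambda>t. Y t \<omega>) * (inverse mean * Y s \<omega>))"
    using w_nonneg by (subst integrable_density) (auto simp: mult.commute)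
  finally show "integrable N (\<lambda>\<omega>. F (\<lambda>t. Y t (fst \<omega>) + Z t \<omega>)) \<longleftrightarrow>
      integrable M (\<lambda>\<omega>. F (\<lambda>t. Y t \<omega>) * (inverse mean * Y s \<omega>))" .
  have "(\<integral>\<omega>. F (\<lambda>t. Y t (fst \<omega>) + Z t \<omega>) \<partial>N) = (\<integral>y. F y \<partial>distr N cyl (\<lambda>\<omega> t. Y t (fst \<omega>) + Z t \<omega>))"
    by (rule integral_distr[OF Xm F, symmetric])
  also have "\<dots> = (\<integral>\<omega>. F (\<lambda>t. Y t \<omega>) \<partial>?Ms)"
    unfolding size_biased_law by (rule integral_distr[OF Ym' F])
  also have "\<dots> = (\<integral>\<omega>. F (\<lambda>t. Y t \<omega>) * (inverse mean * Y s \<omega>) \<partial>M)"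
    using w_nonneg by (subst integral_density) (auto simp: mult.commute)
  finally show "(\<integral>\<omega>. F (\<lambda>t. Y t (fst \<omega>) + Z t \<omega>) \<partial>N) = (\<integral>\<omega>. F (\<lambda>t. Y t \<omega>) * (inverse mean * Y s \<omega>) \<partial>M)" .
qed

end

section \<open>The characterization\<close>

theorem proposition4p7:
  fixes M :: "'w measure" and Y :: "'t \<Rightarrow> 'w \<Rightarrow> real" and \<theta> :: "'t \<Rightarrow> real"
  assumes "prob_space M"
    and "process M Y"
    and "\<And>t. AE \<omega> in M. 0 \<le> Y t \<omega>"
    and "\<And>t. integrable M (Y t)"
    and "\<And>t. \<theta> t = (\<integral>\<omega>. Y t \<omega> \<partial>M)"
  shows
    "(\<forall>(N :: 't \<Rightarrow> 'v measure) (\<pi> :: 't \<Rightarrow> 'v \<Rightarrow> 'w) (Z :: 't \<Rightarrow> 't \<Rightarrow> 'v \<Rightarrow> real).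
        (\<forall>s. 0 < \<theta> s \<longrightarrow> size_bias M Y s (N s) (\<pi> s) (Z s)) \<longrightarrow>
        inf_divisible_process M Y \<and>
        (\<forall>s :: nat \<Rightarrow> 't. separant M Y (range s) \<longrightarrow>
          (let A = first_positive s;
               \<nu>k = (\<lambda>k. if 0 < \<theta> (s k)
                     then density (law_nonneg (N (s k)) (Z (s k)))
                            (\<lambda>y. ennreal (\<theta> (s k) * inverse (y (s k))) * indicator {y. 0 < y (s k)} y)
                     else null_measure cyl_nonneg)
           in disjoint_family A \<and>
              (\<forall>k. levy_measure (\<nu>k k)) \<and>
              (\<exists>\<nu> c. levy_characteristics M Y \<nu> c) \<and>
              (\<forall>\<nu> c. levy_characteristics M Y \<nu> c \<longrightarrow>
                 (\<forall>B\<in>sets cyl_nonneg.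
                    emeasure \<nu> B = (\<Sum>k. emeasure (density (\<nu>k k) (indicator (A k))) B)) \<and>
                 (\<forall>t. c t = (if 0 < \<theta> t
                             then \<theta> t * measure (N t) {\<omega> \<in> space (N t). Z t t \<omega> = 0}
                             else 0))))))
     \<and>
     (inf_divisible_process M Y \<longrightarrow>
        (\<forall>\<nu> c. levy_characteristics M Y \<nu> c \<longrightarrow>
           (\<forall>s. 0 < \<theta> s \<longrightarrow>
              (\<exists>(N :: ('w \<times> ('t \<Rightarrow> real)) measure) (\<pi> :: 'w \<times> ('t \<Rightarrow> real) \<Rightarrow> 'w)
                 (Z :: 't \<Rightarrow> 'w \<times> ('t \<Rightarrow> real) \<Rightarrow> real).
                 size_bias M Y s N \<pi> Z \<and>
                 (\<forall>B\<in>sets cyl_nonneg.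
                    emeasure (law_nonneg N Z) B =
                      emeasure (scale_measure (ennreal (c s / \<theta> s)) (return cyl_nonneg (\<lambda>_. 0))) B +
                      emeasure (density \<nu> (\<lambda>y. ennreal (y s / \<theta> s))) B)))))"
proof -
  interpret nonneg_process M Y
    by (intro nonneg_process.intro nonneg_process_axioms.intro) (use assms in auto)
  note \<theta> = assms(5)
  show ?thesis
  proof (intro conjI allI impI)
    fix N :: "'t \<Rightarrow> 'v measure" and \<pi> :: "'t \<Rightarrow> 'v \<Rightarrow> 'w" and Z :: "'t \<Rightarrow> 't \<Rightarrow> 'v \<Rightarrow> real"
    assume sb: "\<forall>s. 0 < \<theta> s \<longrightarrow> size_bias M Y s (N s) (\<pi> s) (Z s)"
    define m where "m s = biased_law (N s) (Z s) (\<theta> s)" for s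
    have fam: "size_biased_family (law_nonneg M Y) m"
      unfolding m_def using size_biased_family_of_processes[of \<theta> N \<pi> Z] assms(4) \<theta> sb by blast
    show "inf_divisible_process M Y"
      by (rule inf_divisible_of_size_biased_family[OF fam])
    fix s :: "nat \<Rightarrow> 't" assume sep: "separant M Y (range s)"
    interpret F: size_biased_family "law_nonneg M Y" m by (rule fam)
    interpret F: separated_size_biased_family "law_nonneg M Y" m s
    proof
      fix t
      obtain r where r: "range r \<subseteq> range s" "converges_in_prob M (\<lambda>n. Y (r n)) (Y t)"
        using sep unfolding separant_def by blast
      show "AE y in m t. (\<forall>k. y (s k) = 0) \<longrightarrow> y t = 0"
        using F.AE_m_zero_of_approximation[OF laplace_approximation[OF r(2)]]
      proof eventually_elim
        case (elim y)
        show ?case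
        proof
          assume "\<forall>k. y (s k) = 0"
          then have "\<forall>n. y (r n) = 0" using r(1) by (metis rangeE rangeI subsetD)
          then show "y t = 0" using elim by simp
        qed
      qed
    qed
    define \<nu>k where "\<nu>k k = (if 0 < \<theta> (s k)
        then density (law_nonneg (N (s k)) (Z (s k)))
               (\<lambda>y. ennreal (\<theta> (s k) * inverse (y (s k))) * indicator {y. 0 < y (s k)} y)
        else null_measure cyl_nonneg)" for k
    have piece: "\<nu>k k = F.piece k" for k
    proof (cases "0 < \<theta> (s k)")
      case True
      have sets: "sets (law_nonneg (N (s k)) (Z (s k))) = sets cyl_nonneg"
        by (simp add: law_nonneg_def)
      have [measurable]: "(\<lambda>y. y t) \<in> borel_measurable (law_nonneg (N (s k)) (Z (s k)))" for t
        by (rule measurable_component_of_sets[OF sets])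
      have "m (s k) = density (law_nonneg (N (s k)) (Z (s k))) (\<lambda>_. ennreal (\<theta> (s k)))"
        using True unfolding m_def biased_law_def by (intro measure_eqI) (auto simp: emeasure_density_const)
      then have "F.piece k = density (law_nonneg (N (s k)) (Z (s k)))
          (\<lambda>y. ennreal (\<theta> (s k)) * (ennreal (inverse (y (s k))) * indicator {y. 0 < y (s k)} y))"
        unfolding F.piece_def by (simp add: density_density_eq)
      also have "\<dots> = \<nu>k k"
        using True unfolding \<nu>k_def by (simp add: ennreal_mult' mult.assoc)
      finally show ?thesis ..
    next
      case False
      then have "m (s k) = null_measure cyl_nonneg" by (simp add: m_def biased_law_def)
      then have "emeasure (F.piece k) A = 0" for A
      proof -
        have "(\<lambda>y. ennreal (inverse (y (s k))) * indicator {y. 0 < y (s k)} y) \<in> borel_measurable (null_measure cyl_nonneg)"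
          using measurable_cyl_nonneg_component[of "s k"] by simp
        then show ?thesis
          using \<open>m (s k) = null_measure cyl_nonneg\<close>
          by (cases "A \<in> sets cyl_nonneg") (auto simp: F.piece_def emeasure_density emeasure_notin_sets)
      qed
      then show ?thesis using False by (intro measure_eqI) (auto simp: \<nu>k_def)
    qed
    have drift: "F.drift t = (if 0 < \<theta> t then \<theta> t * measure (N t) {\<omega> \<in> space (N t). Z t t \<omega> = 0} else 0)" for t
    proof (cases "0 < \<theta> t")
      case True
      interpret S: size_biased_process M Y t "N t" "\<pi> t" "Z t"
        by unfold_locales (use assms(4) sb True \<theta> in auto)
      have "{y \<in> space cyl_nonneg. y t = 0} \<in> sets cyl_nonneg"
        using measurable_cyl_nonneg_component[of t] by measurable
      then have "measure (law_nonneg (N t) (Z t)) {y \<in> space cyl_nonneg. y t = 0}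
          = measure (N t) ((\<lambda>\<omega> t'. max 0 (Z t t' \<omega>)) -` {y \<in> space cyl_nonneg. y t = 0} \<inter> space (N t))"
        unfolding law_nonneg_def by (intro measure_distr S.Z.measurable_path)
      also have "\<dots> = measure (N t) {\<omega> \<in> space (N t). Z t t \<omega> = 0}"
      proof (rule measure_eq_AE)
        show "AE \<omega> in N t. \<omega> \<in> (\<lambda>\<omega> t'. max 0 (Z t t' \<omega>)) -` {y \<in> space cyl_nonneg. y t = 0} \<inter> space (N t)
            \<longleftrightarrow> \<omega> \<in> {\<omega> \<in> space (N t). Z t t \<omega> = 0}"
          using S.Z.nonneg[of t] by eventually_elim (auto simp: space_cyl_nonneg)
        show "(\<lambda>\<omega> t'. max 0 (Z t t' \<omega>)) -` {y \<in> space cyl_nonneg. y t = 0} \<inter> space (N t) \<in> sets (N t)"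
          by (rule measurable_sets[OF S.Z.measurable_path]) fact
      qed measurable
      finally show ?thesis
        using True by (simp add: F.drift_def m_def biased_law_def space_scale_measure space_eq_cyl_nonneg[OF S.Z.sets_law])
    next
      case False
      then show ?thesis by (simp add: F.drift_def m_def biased_law_def)
    qed
    have existence: "levy_characteristics M Y F.levy F.drift"
      unfolding levy_characteristics_iff
      using F.levy_measure_levy F.drift_nonneg F.laplace_levy_levy by blast
    have uniqueness: "\<nu> = F.levy" "c t = F.drift t" if "levy_characteristics M Y \<nu> c" for \<nu> c t
      using F.levy_drift_unique[of \<nu> c] that unfolding levy_characteristics_iff by blast+
    have expansion: "emeasure F.levy B = (\<Sum>k. emeasure (density (\<nu>k k) (indicator (first_positive s k))) B)"
      if "B \<in> sets cyl_nonneg" for B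
      unfolding F.levy_def piece using that by (intro emeasure_measure_series) simp_all
    show "let A = first_positive s;
               \<nu>k = (\<lambda>k. if 0 < \<theta> (s k)
                     then density (law_nonneg (N (s k)) (Z (s k)))
                            (\<lambda>y. ennreal (\<theta> (s k) * inverse (y (s k))) * indicator {y. 0 < y (s k)} y)
                     else null_measure cyl_nonneg)
           in disjoint_family A \<and>
              (\<forall>k. levy_measure (\<nu>k k)) \<and>
              (\<exists>\<nu> c. levy_characteristics M Y \<nu> c) \<and>
              (\<forall>\<nu> c. levy_characteristics M Y \<nu> c \<longrightarrow>
                 (\<forall>B\<in>sets cyl_nonneg.
                    emeasure \<nu> B = (\<Sum>k. emeasure (density (\<nu>k k) (indicator (A k))) B)) \<and>
                 (\<forall>t. c t = (if 0 < \<theta> t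
                             then \<theta> t * measure (N t) {\<omega> \<in> space (N t). Z t t \<omega> = 0}
                             else 0)))"
      unfolding Let_def \<nu>k_def[symmetric]
    proof (intro conjI allI impI ballI)
      show "disjoint_family (first_positive s)" by (rule disjoint_first_positive)
      show "levy_measure (\<nu>k k)" for k unfolding piece by (rule F.levy_measure_piece)
      show "\<exists>\<nu> c. levy_characteristics M Y \<nu> c" using existence by blast
      fix \<nu> c assume char: "levy_characteristics M Y \<nu> c"
      show "emeasure \<nu> B = (\<Sum>k. emeasure (density (\<nu>k k) (indicator (first_positive s k))) B)"
        if "B \<in> sets cyl_nonneg" for B
        unfolding uniqueness(1)[OF char] by (rule expansion[OF that])
      show "c t = (if 0 < \<theta> t then \<theta> t * measure (N t) {\<omega> \<in> space (N t). Z t t \<omega> = 0} else 0)" for t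
        unfolding uniqueness(2)[OF char] by (rule drift)
    qed
  next
    fix \<nu> :: "('t \<Rightarrow> real) measure" and c :: "'t \<Rightarrow> real" and s :: 't
    assume "levy_characteristics M Y \<nu> c" "0 < \<theta> s"
    then interpret V: process_with_levy_characteristics M Y \<nu> c s
      by unfold_locales (use assms(4) \<theta> in auto)
    show "\<exists>(N :: ('w \<times> ('t \<Rightarrow> real)) measure) (\<pi> :: 'w \<times> ('t \<Rightarrow> real) \<Rightarrow> 'w)
         (Z :: 't \<Rightarrow> 'w \<times> ('t \<Rightarrow> real) \<Rightarrow> real).
         size_bias M Y s N \<pi> Z \<and>
         (\<forall>B\<in>sets cyl_nonneg.
            emeasure (law_nonneg N Z) B =
              emeasure (scale_measure (ennreal (c s / \<theta> s)) (return cyl_nonneg (\<lambda>_. 0))) B +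
              emeasure (density \<nu> (\<lambda>y. ennreal (y s / \<theta> s))) B)"
      unfolding \<theta> using V.size_bias_N V.emeasure_law_Z by blast
  qed
qed

end
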